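(* Let $G$ be an amenable, unimodular, second-countable locally compact group with identity $e$, let $\Lambda\subseteq G$, and denote by $D^-(\Lambda)$ and $D^+(\Lambda)$ respectively the lower and upper Beurling density of $\Lambda$ with respect to a strong Følner sequence. Let $\mathcal{H}$ be a reproducing kernel Hilbert space of complex-valued functions on $G$ such that: (a) $\mathcal{H}$ is isometrically embedded into $L^2(G)$; (b) for every $f\in\mathcal{H}$ and $x\in G$, the function $y\mapsto f(x^{-1}y)$ is in $\mathcal{H}$; (c) for some compact neighborhood $Q$ of the identity, $\int_G\sup_{t\in xQ}|f(t)|^2\,dx<\infty$ for all $f\in\mathcal{H}$. Let $k_e\in\mathcal{H}$ be the vector with $f(e)=\langle f,k_e\rangle$ for all $f\in\mathcal{H}$. Then: (i) If $\Lambda$ is a set of sampling for $\mathcal{H}$, then $D^-(\Lambda)\ge\|k_e\|^2$. (ii) If $\Lambda$ is a set of interpolation for $\mathcal{H}$, then $D^+(\Lambda)\le\|k_e\|^2$.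
   Context: A Haar measure $m$ on $G$ is fixed, and $\int_G \cdots dx$ denotes integration with respect to it. A reproducing kernel Hilbert space on $G$ is a Hilbert space of functions on $G$ on which point evaluations are continuous. Isometrically embedded into $L^2(G)$ means each $f\in\mathcal{H}$ is (a representative of) an element of $L^2(G)$ with $\|f\|_{\mathcal{H}}=\|f\|_{L^2(G)}$. Set of sampling: there exist $0<A\le B<\infty$ with $A\|f\|^2\le\sum_{\lambda\in\Lambda}|f(\lambda)|^2\le B\|f\|^2$ for all $f\in\mathcal{H}$. Set of interpolation: for every $(c_\lambda)\in\ell^2(\Lambda)$ there is $f\in\mathcal{H}$ with $f(\lambda)=c_\lambda$ for all $\lambda\in\Lambda$. A (right) strong Følner sequence is a sequence $(F_n)_n$ of compact subsets of $G$ of positive measure such that for every compact $K\subseteq G$, $\lim_n m(F_nK\cap F_n^cK)/m(F_n)=0$, where $F_n^c=G\setminus F_n$. The Beurling densities are \[ D^-(\Lambda)=\lim_{n\to\infty}\inf_{x\in G}\frac{|\Lambda\cap xF_n|}{m(F_n)},\qquad D^+(\Lambda)=\lim_{n\to\infty}\sup_{x\in G}\frac{|\Lambda\cap xF_n|}{m(F_n)}. \] Equivalently (and in particular independently of the sequence), $D^-(\Lambda)=\sup_K\inf_{x\in G}|\Lambda\cap xK|/m(K)$ and $D^+(\Lambda)=\inf_K\sup_{x\in G}|\Lambda\cap xK|/m(K)$, with $K$ ranging over compact subsets of $G$ of positive measure; these latter formulas are the paper's definition. *)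

theory Defs
  imports "HOL-Analysis.Analysis" "HOL-Library.Set_Algebras"
begin

text \<open>
  The library's class of not necessarily commutative topological groups,
  \<^class>\<open>topological_group_add\<close>, is written additively. Hence \<open>x y\<close>, \<open>x\<inverse> y\<close> and the
  identity \<open>e\<close> appear as \<open>x + y\<close>, \<open>- x + y\<close> and \<open>0\<close>, the left translate \<open>x F\<close> is
  \<open>(+) x ` F\<close>, and the product set \<open>F K\<close> is \<open>F + K\<close>. Commutativity is never assumed.
\<close>

section \<open>Haar measure, unimodularity, amenability\<close>

definition haar_measure :: "'a::topological_group_add measure \<Rightarrow> bool" where
  "haar_measure m \<longleftrightarrow>
     sets m = sets borel \<and>
     emeasure m UNIV \<noteq> 0 \<and>
     (\<forall>x. \<forall>A\<in>sets borel. emeasure m ((+) x ` A) = emeasure m A) \<and>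
     (\<forall>K. compact K \<longrightarrow> emeasure m K < \<infinity>) \<and>
     (\<forall>A\<in>sets borel. emeasure m A = (INF U\<in>{U. open U \<and> A \<subseteq> U}. emeasure m U)) \<and>
     (\<forall>U. open U \<longrightarrow> emeasure m U = (SUP K\<in>{K. compact K \<and> K \<subseteq> U}. emeasure m K))"

text \<open>
  As Haar measure is unique up to scaling, unimodularity of the group may be tested
  on any given left Haar measure.
\<close>

definition unimodular :: "'a::topological_group_add measure \<Rightarrow> bool" where
  "unimodular m \<longleftrightarrow>
     (\<forall>x. \<forall>A\<in>sets borel. emeasure m ((\<lambda>y. y + x) ` A) = emeasure m A)"

definition ess_bounded :: "'a measure \<Rightarrow> ('a \<Rightarrow> real) set" where
  "ess_bounded m = {f \<in> borel_measurable m. \<exists>C. AE y in m. \<bar>f y\<bar> \<le> C}"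

text \<open>
  Existence of a left-invariant mean on \<open>L\<^sup>\<infinity>(G)\<close>. Functionals are applied to representatives;
  positivity is required up to null sets, which makes them well defined on classes.
\<close>

definition amenable :: "'a::topological_group_add measure \<Rightarrow> bool" where
  "amenable m \<longleftrightarrow>
     (\<exists>M :: ('a \<Rightarrow> real) \<Rightarrow> real.
        (\<forall>f\<in>ess_bounded m. \<forall>g\<in>ess_bounded m. M (\<lambda>y. f y + g y) = M f + M g) \<and>
        (\<forall>f\<in>ess_bounded m. \<forall>c. M (\<lambda>y. c * f y) = c * M f) \<and>
        (\<forall>f\<in>ess_bounded m. (AE y in m. 0 \<le> f y) \<longrightarrow> 0 \<le> M f) \<and>
        M (\<lambda>y. 1) = 1 \<and>
        (\<forall>f\<in>ess_bounded m. \<forall>x. M (\<lambda>y. f (- x + y)) = M f))"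

section \<open>Strong Folner sequences and Beurling densities\<close>

text \<open>
  In a Hausdorff group \<open>F n + K\<close> is compact and \<open>(UNIV - F n) + K\<close> is open, so the
  intersection below is a Borel set.
\<close>

definition strong_folner :: "'a::topological_group_add measure \<Rightarrow> (nat \<Rightarrow> 'a set) \<Rightarrow> bool" where
  "strong_folner m F \<longleftrightarrow>
     (\<forall>n. compact (F n) \<and> 0 < emeasure m (F n)) \<and>
     (\<forall>K. compact K \<longrightarrow>
        (\<lambda>n. emeasure m ((F n + K) \<inter> ((UNIV - F n) + K)) / emeasure m (F n)) \<longlonglongrightarrow> 0)"

text \<open>
  Cardinalities are taken with respect to counting measure, as \<^const>\<open>card\<close> is \<open>0\<close> on infinite
  sets.
\<close>

definition relative_count ::
  "'a::topological_group_add measure \<Rightarrow> 'a set \<Rightarrow> 'a set \<Rightarrow> 'a \<Rightarrow> ennreal" where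
  "relative_count m \<Lambda> K x = emeasure (count_space UNIV) (\<Lambda> \<inter> (+) x ` K) / emeasure m K"

definition lower_beurling_density ::
  "'a::topological_group_add measure \<Rightarrow> 'a set \<Rightarrow> ennreal" where
  "lower_beurling_density m \<Lambda> =
     (SUP K\<in>{K. compact K \<and> 0 < emeasure m K}. INF x. relative_count m \<Lambda> K x)"

definition upper_beurling_density ::
  "'a::topological_group_add measure \<Rightarrow> 'a set \<Rightarrow> ennreal" where
  "upper_beurling_density m \<Lambda> =
     (INF K\<in>{K. compact K \<and> 0 < emeasure m K}. SUP x. relative_count m \<Lambda> K x)"

text \<open>
  The densities along a strong Folner sequence \<open>F\<close>; in the unimodular case the limits exist
  and equal the two densities above.
\<close>

definition folner_lower_density ::
  "'a::topological_group_add measure \<Rightarrow> (nat \<Rightarrow> 'a set) \<Rightarrow> 'a set \<Rightarrow> ennreal" where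
  "folner_lower_density m F \<Lambda> = lim (\<lambda>n. INF x. relative_count m \<Lambda> (F n) x)"

definition folner_upper_density ::
  "'a::topological_group_add measure \<Rightarrow> (nat \<Rightarrow> 'a set) \<Rightarrow> 'a set \<Rightarrow> ennreal" where
  "folner_upper_density m F \<Lambda> = lim (\<lambda>n. SUP x. relative_count m \<Lambda> (F n) x)"

section \<open>Reproducing kernel Hilbert spaces of complex-valued functions\<close>

text \<open>
  A function space is given by its carrier \<open>H\<close> and its inner product \<open>ip\<close>, linear in the
  first argument; values of \<open>ip\<close> outside \<open>H\<close> are irrelevant.
\<close>

definition ip_norm :: "(('a \<Rightarrow> complex) \<Rightarrow> ('a \<Rightarrow> complex) \<Rightarrow> complex) \<Rightarrow> ('a \<Rightarrow> complex) \<Rightarrow> real" where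
  "ip_norm ip f = sqrt (Re (ip f f))"

definition ip_dist ::
  "(('a \<Rightarrow> complex) \<Rightarrow> ('a \<Rightarrow> complex) \<Rightarrow> complex) \<Rightarrow> ('a \<Rightarrow> complex) \<Rightarrow> ('a \<Rightarrow> complex) \<Rightarrow> real" where
  "ip_dist ip f g = ip_norm ip (\<lambda>x. f x - g x)"

definition function_inner_product_space ::
  "('a \<Rightarrow> complex) set \<Rightarrow> (('a \<Rightarrow> complex) \<Rightarrow> ('a \<Rightarrow> complex) \<Rightarrow> complex) \<Rightarrow> bool" where
  "function_inner_product_space H ip \<longleftrightarrow>
     (\<lambda>x. 0) \<in> H \<and>
     (\<forall>f\<in>H. \<forall>g\<in>H. (\<lambda>x. f x + g x) \<in> H) \<and>
     (\<forall>f\<in>H. \<forall>c. (\<lambda>x. c * f x) \<in> H) \<and>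
     (\<forall>f\<in>H. \<forall>g\<in>H. \<forall>h\<in>H. ip (\<lambda>x. f x + g x) h = ip f h + ip g h) \<and>
     (\<forall>f\<in>H. \<forall>g\<in>H. \<forall>c. ip (\<lambda>x. c * f x) g = c * ip f g) \<and>
     (\<forall>f\<in>H. \<forall>g\<in>H. ip g f = cnj (ip f g)) \<and>
     (\<forall>f\<in>H. f \<noteq> (\<lambda>x. 0) \<longrightarrow> 0 < Re (ip f f))"

definition rkhs ::
  "('a \<Rightarrow> complex) set \<Rightarrow> (('a \<Rightarrow> complex) \<Rightarrow> ('a \<Rightarrow> complex) \<Rightarrow> complex) \<Rightarrow> bool" where
  "rkhs H ip \<longleftrightarrow>
     function_inner_product_space H ip \<and>
     (\<forall>u :: nat \<Rightarrow> 'a \<Rightarrow> complex.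
        (\<forall>n. u n \<in> H) \<and>
        (\<forall>\<epsilon>>0. \<exists>N. \<forall>i\<ge>N. \<forall>j\<ge>N. ip_dist ip (u i) (u j) < \<epsilon>) \<longrightarrow>
        (\<exists>f\<in>H. (\<lambda>n. ip_dist ip (u n) f) \<longlonglongrightarrow> 0)) \<and>
     (\<forall>x. \<forall>f\<in>H. \<forall>\<epsilon>>0. \<exists>\<delta>>0. \<forall>g\<in>H. ip_dist ip g f < \<delta> \<longrightarrow> cmod (g x - f x) < \<epsilon>)"

definition isometric_in_L2 ::
  "'a measure \<Rightarrow> ('a \<Rightarrow> complex) set \<Rightarrow>
   (('a \<Rightarrow> complex) \<Rightarrow> ('a \<Rightarrow> complex) \<Rightarrow> complex) \<Rightarrow> bool" where
  "isometric_in_L2 m H ip \<longleftrightarrow>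
     (\<forall>f\<in>H. f \<in> borel_measurable m \<and>
            integrable m (\<lambda>x. (cmod (f x))\<^sup>2) \<and>
            ip_norm ip f = sqrt (\<integral>x. (cmod (f x))\<^sup>2 \<partial>m))"

text \<open>
  The index set may be uncountable, so the sum is an unordered one; it is taken in
  \<^typ>\<open>ennreal\<close>, where a divergent sum is \<open>\<infinity>\<close> and not \<open>0\<close>.
\<close>

definition sampling_set ::
  "('a \<Rightarrow> complex) set \<Rightarrow> (('a \<Rightarrow> complex) \<Rightarrow> ('a \<Rightarrow> complex) \<Rightarrow> complex) \<Rightarrow> 'a set \<Rightarrow> bool" where
  "sampling_set H ip \<Lambda> \<longleftrightarrow>
     (\<exists>A B :: real. 0 < A \<and> A \<le> B \<and>
        (\<forall>f\<in>H. ennreal (A * (ip_norm ip f)\<^sup>2) \<le> (\<Sum>\<^sub>\<infinity>l\<in>\<Lambda>. ennreal ((cmod (f l))\<^sup>2)) \<and>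
               (\<Sum>\<^sub>\<infinity>l\<in>\<Lambda>. ennreal ((cmod (f l))\<^sup>2)) \<le> ennreal (B * (ip_norm ip f)\<^sup>2)))"

definition interpolation_set :: "('a \<Rightarrow> complex) set \<Rightarrow> 'a set \<Rightarrow> bool" where
  "interpolation_set H \<Lambda> \<longleftrightarrow>
     (\<forall>c :: 'a \<Rightarrow> complex. (\<lambda>l. (cmod (c l))\<^sup>2) summable_on \<Lambda> \<longrightarrow>
        (\<exists>f\<in>H. \<forall>l\<in>\<Lambda>. f l = c l))"

end

theory Submission
  imports Defs
begin

text \<open>
  Both inequalities compare a dimension with a local trace. For an orthonormal basis \<open>E\<close> of a
  finite-dimensional subspace \<open>V\<close> of \<open>H\<close>, the function \<open>\<rho> x = (\<Sum>e\<in>E. \<bar>e x\<bar>\<^sup>2)\<close> is the squared norm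
  of the projection to \<open>V\<close> of the reproducing kernel at \<open>x\<close>. Translation invariance makes all
  kernels translates of \<open>k\<^sub>e\<close>, so \<open>0 \<le> \<rho> x \<le> \<parallel>k\<^sub>e\<parallel>\<^sup>2\<close>; and since \<open>H\<close> carries the \<open>L\<^sup>2\<close> norm, the
  integral of \<open>\<rho>\<close> over the group is \<open>dim V\<close>.

  If \<open>\<Lambda>\<close> is a set of interpolation, let \<open>V\<close> be spanned by the kernels at finitely many points
  of \<open>\<Lambda> \<inter> x F\<close>. They are linearly independent, so \<open>dim V\<close> is the number of points. A uniform
  boundedness argument (\<open>gliding_hump\<close>) shows that the kernels at points of \<open>\<Lambda>\<close> satisfy the lower
  inequality of a Riesz sequence, so \<open>\<rho>\<close> is dominated outside \<open>x F K\<close> by \<open>L\<^sup>2\<close> tails of these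
  kernels. Thus \<open>\<rho>\<close> lives essentially on \<open>x F K\<close>, and the number of points is at most about
  \<open>\<parallel>k\<^sub>e\<parallel>\<^sup>2 m(F K)\<close> (\<open>interpolation_card_le\<close>).

  If \<open>\<Lambda>\<close> is a set of sampling, let \<open>V\<close> be spanned by the dual frame vectors at the points of
  \<open>\<Lambda> \<inter> x F K\<close>. For \<open>y\<close> in \<open>x F\<close> the kernel at \<open>y\<close> is nearly in \<open>V\<close>, since its samples outside
  \<open>y K\<close> are negligible by the integrability condition on the local maximal function
  (\<open>kernel_tail\<close>). Hence \<open>\<rho>\<close> is nearly \<open>\<parallel>k\<^sub>e\<parallel>\<^sup>2\<close> on \<open>x F\<close>, and the number of points is at least about
  \<open>\<parallel>k\<^sub>e\<parallel>\<^sup>2 m(F)\<close> (\<open>sampling_card_ge\<close>).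

  Along a strong Folner sequence \<open>m(F K) / m(F)\<close> is asymptotically at most one, which gives the bounds for the
  densities defined with compact sets. The densities along the sequence agree with these by a
  double counting argument that uses invariance of Haar measure under inversion.
\<close>

section \<open>Haar measure on a second countable group\<close>

lemma open_translate:
  fixes U :: "'a::topological_group_add set"
  assumes "open U" shows "open ((+) x ` U)"
proof -
  have "(+) x ` U = (\<lambda>y. - x + y) -` U"
    by (auto simp: image_iff simp flip: add.assoc intro!: bexI[of _ "- x + _"])
  moreover have "open ((\<lambda>y. - x + y) -` U)"
    by (intro open_vimage assms continuous_intros)
  ultimately show ?thesis by simp
qed

lemma compact_set_plus:
  fixes A B :: "'a::topological_monoid_add set"
  assumes "compact A" "compact B" shows "compact (A + B)"
proof -
  have "A + B = (\<lambda>p. fst p + snd p) ` (A \<times> B)"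
    by (force simp: set_plus_def)
  moreover have "compact ((\<lambda>p. fst p + snd p) ` (A \<times> B))"
    by (intro compact_continuous_image compact_Times assms continuous_intros)
  ultimately show ?thesis by simp
qed

lemma compact_neighbourhood_in_open:
  fixes K U :: "'a::topological_group_add set"
  assumes "compact K" "open U" "K \<subseteq> U"
  obtains V where "open V" "0 \<in> V" "\<And>v k. v \<in> V \<Longrightarrow> k \<in> K \<Longrightarrow> v + k \<in> U"
    "\<And>v k. v \<in> V \<Longrightarrow> k \<in> K \<Longrightarrow> - v + k \<in> U"
proof -
  define W where "W = (\<lambda>p::'a \<times> 'a. fst p + snd p) -` U"
  have "open W" unfolding W_def by (intro open_vimage assms continuous_intros)
  moreover have "{0} \<times> K \<subseteq> W" using assms by (auto simp: W_def)
  ultimately obtain X where X: "0 \<in> X" "open X" "X \<times> K \<subseteq> W"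
    using Elementary_Topology.tube_lemma[OF assms(1), of W 0] by blast
  have "open (uminus -` X)" by (intro open_vimage X continuous_intros)
  then show ?thesis
    using X by (intro that[of "X \<inter> uminus -` X"]) (auto simp: W_def)
qed

locale haar_group =
  fixes m :: "'a::{topological_group_add, t2_space, second_countable_topology} measure"
  assumes locally_compact: "locally_compact_space (euclidean :: 'a topology)"
    and haar: "haar_measure m"
begin

lemma sets_m [measurable_cong, simp]: "sets m = sets borel"
  using haar by (simp add: haar_measure_def)

lemma space_m [simp]: "space m = UNIV"
  using sets_eq_imp_space_eq[OF sets_m] by simp

lemma measurable_m [simp]: "f \<in> borel_measurable m \<longleftrightarrow> f \<in> borel_measurable borel"
  by (rule iffI; erule measurable_cong_sets[THEN equalityD1, THEN subsetD, rotated 2]) simp_all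

lemma emeasure_translate: "A \<in> sets borel \<Longrightarrow> emeasure m ((+) x ` A) = emeasure m A"
  using haar by (simp add: haar_measure_def)

lemma emeasure_compact_finite: "compact K \<Longrightarrow> emeasure m K < \<infinity>"
  using haar by (simp add: haar_measure_def)

lemma borel_compact: "compact K \<Longrightarrow> K \<in> sets (borel :: 'a measure)"
  by (simp add: borel_closed compact_imp_closed)

lemma compact_exhaustion:
  "\<exists>C :: nat \<Rightarrow> 'a set. incseq C \<and> (\<forall>n. compact (C n)) \<and> (\<Union>n. C n) = UNIV"
proof -
  have "\<forall>x::'a. \<exists>U K. open U \<and> compact K \<and> x \<in> U \<and> U \<subseteq> K"
    using locally_compact by (simp add: locally_compact_space_def)
  then obtain U K where UK: "\<And>x::'a. open (U x)" "\<And>x. compact (K x)" "\<And>x. x \<in> U x" "\<And>x. U x \<subseteq> K x"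
    by metis
  obtain \<F> where \<F>: "\<F> \<subseteq> range U" "countable \<F>" "\<Union>\<F> = \<Union>(range U)"
    using Lindelof[of "range U"] UK(1) by (metis (no_types, lifting) imageE)
  then have "\<exists>X. countable X \<and> \<F> = U ` X"
    using countable_subset_image[of \<F> U UNIV] by blast
  then obtain X where X: "countable X" "\<F> = U ` X" by blast
  have cover: "(\<Union>x\<in>X. U x) = UNIV" using \<F>(3) X UK(3) by blast
  then have "X \<noteq> {}" by blast
  define C where "C n = (\<Union>i\<le>n. K (from_nat_into X i))" for n
  have "incseq C" unfolding C_def by (intro monoI UN_mono) auto
  moreover have "compact (C n)" for n unfolding C_def by (intro compact_UN) (auto simp: UK)
  moreover have "(\<Union>n. C n) = UNIV"
  proof -
    have "\<exists>n. y \<in> C n" for y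
    proof -
      obtain x where "x \<in> X" "y \<in> U x" using cover by blast
      then obtain n where "x = from_nat_into X n" by (metis X(1) from_nat_into_to_nat_on)
      then show ?thesis using \<open>y \<in> U x\<close> UK(4) unfolding C_def by blast
    qed
    then show ?thesis by blast
  qed
  ultimately show ?thesis by metis
qed

sublocale sigma_finite_measure m
proof
  obtain C :: "nat \<Rightarrow> 'a set" where C: "\<And>n. compact (C n)" "(\<Union>n. C n) = UNIV"
    using compact_exhaustion by metis
  show "\<exists>A. countable A \<and> A \<subseteq> sets m \<and> \<Union>A = space m \<and> (\<forall>a\<in>A. emeasure m a \<noteq> \<infinity>)"
  proof (intro exI[of _ "range C"] conjI ballI)
    show "range C \<subseteq> sets m" using borel_compact[OF C(1)] by auto
    fix a assume "a \<in> range C"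
    then show "emeasure m a \<noteq> \<infinity>" using emeasure_compact_finite[OF C(1)] by (auto simp: less_top)
  qed (use C(2) in auto)
qed

lemma pair_sigma_finite_m: "pair_sigma_finite m m" ..

text \<open>
  If an open set were null, countably many of its translates would cover the group by the
  Lindelof property, and the group itself would be null.
\<close>

lemma open_pos:
  assumes "open U" "U \<noteq> {}" shows "0 < emeasure m U"
proof (rule ccontr)
  assume "\<not> 0 < emeasure m U"
  then have 0: "emeasure m U = 0" by simp
  obtain u where u: "u \<in> U" using assms by blast
  define T where "T x = (+) x ` U" for x
  have T: "open (T x)" for x unfolding T_def by (rule open_translate[OF assms(1)])
  have cover: "\<Union>(range T) = UNIV"
  proof -
    have "y \<in> T (y - u)" for y using u unfolding T_def by (intro image_eqI[of _ _ u]) auto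
    then show ?thesis by blast
  qed
  obtain \<F> where \<F>: "\<F> \<subseteq> range T" "countable \<F>" "\<Union>\<F> = \<Union>(range T)"
    using Lindelof[of "range T"] T by (metis (no_types, lifting) imageE)
  have "(\<Union>A\<in>\<F>. A) \<in> null_sets m"
  proof (rule null_sets_UN'[OF \<F>(2)])
    fix A assume "A \<in> \<F>"
    then obtain x where "A = T x" using \<F>(1) by blast
    then show "A \<in> null_sets m"
      using 0 T assms(1) by (simp add: null_sets_def) (simp add: T_def emeasure_translate)
  qed
  then have "emeasure m UNIV = 0" using \<F>(3) cover by (simp add: null_sets_def)
  then show False using haar by (simp add: haar_measure_def)
qed

lemma exists_finite_open:
  obtains U :: "'a set" where "open U" "0 \<in> U" "emeasure m U < \<infinity>" "0 < emeasure m U"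
proof -
  obtain U K where UK: "open U" "compact K" "(0::'a) \<in> U" "U \<subseteq> K"
    using locally_compact unfolding locally_compact_space_def by simp blast
  have "emeasure m U \<le> emeasure m K" by (intro emeasure_mono UK) (simp add: borel_compact UK)
  then have "emeasure m U < \<infinity>" using emeasure_compact_finite[OF UK(2)] by (rule le_less_trans)
  then show ?thesis using UK open_pos[of U] by (intro that[of U]) auto
qed

lemma translate_measurable: "(+) x \<in> measurable m m"
  unfolding measurable_cong_sets[OF sets_m sets_m]
    by (intro borel_measurable_continuous_onI continuous_intros)

lemma distr_translate: "distr m m ((+) x) = m"
proof (rule measure_eqI)
  fix A assume "A \<in> sets (distr m m ((+) x))"
  then have A: "A \<in> sets borel" by simp
  have "(+) x -` A = (+) (- x) ` A"
    by (auto simp: image_iff simp flip: add.assoc intro!: bexI[of _ "x + _"])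
  then show "emeasure (distr m m ((+) x)) A = emeasure m A"
    using A by (simp add: emeasure_distr emeasure_translate translate_measurable)
qed simp

lemma nn_integral_translate:
  assumes "f \<in> borel_measurable borel"
  shows "(\<integral>\<^sup>+y. f (x + y) \<partial>m) = (\<integral>\<^sup>+y. f y \<partial>m)"
  using nn_integral_distr[OF translate_measurable, where f = f] assms by (simp add: distr_translate)

lemma integral_translate:
  fixes f :: "'a \<Rightarrow> real"
  assumes "f \<in> borel_measurable borel"
  shows "(\<integral>y. f (x + y) \<partial>m) = (\<integral>y. f y \<partial>m)"
  using integral_distr[OF translate_measurable, where f = f] assms by (simp add: distr_translate)

subsection \<open>Continuity of translation in the mean\<close>

text \<open>
  Continuity of \<open>v \<mapsto> f(v\<inverse> \<cdot>)\<close> in \<open>L\<^sup>1\<close> will yield continuity of the reproducing kernel. It is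
  checked on indicators of open sets, passes to Borel sets by outer regularity, and to all
  integrable functions by linearity and \<open>L\<^sup>1\<close> approximation.
\<close>

definition mean_shift :: "('a \<Rightarrow> real) \<Rightarrow> 'a \<Rightarrow> ennreal" where
  "mean_shift f v = (\<integral>\<^sup>+y. ennreal \<bar>f (- v + y) - f y\<bar> \<partial>m)"

definition mean_continuous :: "('a \<Rightarrow> real) \<Rightarrow> bool" where
  "mean_continuous f \<longleftrightarrow> (\<forall>\<epsilon>>0. \<exists>V. open V \<and> 0 \<in> V \<and> (\<forall>v\<in>V. mean_shift f v \<le> ennreal \<epsilon>))"

lemma shift_borel:
  assumes "f \<in> borel_measurable (borel :: 'a measure)"
  shows "(\<lambda>y. f (x + y)) \<in> borel_measurable borel"
  by (rule measurable_compose[OF _ assms]) (intro borel_measurable_continuous_onI continuous_intros)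

lemma mean_shift_triangle:
  assumes [measurable]: "f \<in> borel_measurable borel" "g \<in> borel_measurable borel"
  shows "mean_shift f v \<le> mean_shift g v + 2 * (\<integral>\<^sup>+y. ennreal \<bar>f y - g y\<bar> \<partial>m)"
proof -
  have [measurable]: "(\<lambda>y. f (- v + y)) \<in> borel_measurable borel" "(\<lambda>y. g (- v + y)) \<in> borel_measurable borel"
    by (auto intro!: shift_borel)
  have "mean_shift f v \<le> (\<integral>\<^sup>+y. ennreal \<bar>g (- v + y) - g y\<bar> +
      (ennreal \<bar>f (- v + y) - g (- v + y)\<bar> + ennreal \<bar>f y - g y\<bar>) \<partial>m)"
    unfolding mean_shift_def by (intro nn_integral_mono) (auto simp flip: ennreal_plus intro!: ennreal_leI)
  also have "\<dots> = mean_shift g v +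
      ((\<integral>\<^sup>+y. ennreal \<bar>f (- v + y) - g (- v + y)\<bar> \<partial>m) + (\<integral>\<^sup>+y. ennreal \<bar>f y - g y\<bar> \<partial>m))"
    unfolding mean_shift_def by (simp add: nn_integral_add)
  also have "(\<integral>\<^sup>+y. ennreal \<bar>f (- v + y) - g (- v + y)\<bar> \<partial>m) = (\<integral>\<^sup>+y. ennreal \<bar>f y - g y\<bar> \<partial>m)"
    by (rule nn_integral_translate) measurable
  finally show ?thesis by (simp add: mult_2)
qed

lemma mean_continuous_approx:
  assumes f: "f \<in> borel_measurable borel"
    and approx: "\<And>\<epsilon>. 0 < \<epsilon> \<Longrightarrow> \<exists>g\<in>borel_measurable borel. mean_continuous g \<and> (\<integral>\<^sup>+y. ennreal \<bar>f y - g y\<bar> \<partial>m) \<le> ennreal \<epsilon>"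
  shows "mean_continuous f"
  unfolding mean_continuous_def
proof (intro allI impI)
  fix \<epsilon> :: real assume e: "0 < \<epsilon>"
  then obtain g where g: "g \<in> borel_measurable borel" "mean_continuous g"
    and le: "(\<integral>\<^sup>+y. ennreal \<bar>f y - g y\<bar> \<partial>m) \<le> ennreal (\<epsilon> / 4)"
    using approx[of "\<epsilon> / 4"] by auto
  obtain V where V: "open V" "0 \<in> V" "\<And>v. v \<in> V \<Longrightarrow> mean_shift g v \<le> ennreal (\<epsilon> / 2)"
    using g(2) e unfolding mean_continuous_def by (meson half_gt_zero)
  have "mean_shift f v \<le> ennreal \<epsilon>" if "v \<in> V" for v
  proof -
    have "mean_shift f v \<le> ennreal (\<epsilon> / 2) + 2 * ennreal (\<epsilon> / 4)"
      by (rule order_trans[OF mean_shift_triangle[OF f g(1)]]) (intro add_mono V that mult_left_mono le; simp)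
    also have "\<dots> = ennreal (\<epsilon> / 2) + ennreal (2 * (\<epsilon> / 4))"
      by (subst ennreal_mult) (use e in auto)
    also have "\<dots> = ennreal \<epsilon>" using e by (simp flip: ennreal_plus)
    finally show ?thesis .
  qed
  then show "\<exists>V. open V \<and> 0 \<in> V \<and> (\<forall>v\<in>V. mean_shift f v \<le> ennreal \<epsilon>)" using V by blast
qed

text \<open>
  Inner regularity gives a compact \<open>K\<close> inside \<open>U\<close> with \<open>U - K\<close> small. A shift that keeps \<open>K\<close>
  inside \<open>U\<close> in both directions changes the indicator of \<open>U\<close> at \<open>y\<close> only if \<open>y\<close> or its shift
  lies in \<open>U - K\<close>.
\<close>

lemma mean_continuous_open:
  assumes U: "open U" "emeasure m U < \<infinity>"
  shows "mean_continuous (indicator U)"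
  unfolding mean_continuous_def
proof (intro allI impI)
  fix \<epsilon> :: real assume e: "0 < \<epsilon>"
  have sup: "emeasure m U = (SUP K\<in>{K. compact K \<and> K \<subseteq> U}. emeasure m K)"
    using haar U(1) unfolding haar_measure_def by blast
  have "\<exists>K. compact K \<and> K \<subseteq> U \<and> emeasure m U \<le> emeasure m K + ennreal (\<epsilon> / 2)"
  proof (cases "emeasure m U = 0")
    case True
    then show ?thesis by (intro exI[of _ "{}"]) auto
  next
    case False
    then have "emeasure m U - ennreal (\<epsilon> / 2) < emeasure m U"
      using U(2) e by (intro ennreal_between) (auto simp: less_top zero_less_iff_neq_zero)
    then obtain K where "compact K" "K \<subseteq> U" "emeasure m U - ennreal (\<epsilon> / 2) < emeasure m K"
      unfolding sup less_SUP_iff by auto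
    moreover from this have "emeasure m U - ennreal (\<epsilon> / 2) \<le> emeasure m K" by simp
    ultimately show ?thesis
      using U(2) by (intro exI[of _ K]) (auto simp: ennreal_minus_le_iff add.commute)
  qed
  then obtain K where K: "compact K" "K \<subseteq> U" "emeasure m U \<le> emeasure m K + ennreal (\<epsilon> / 2)" by blast
  have KU[measurable]: "K \<in> sets borel" "U \<in> sets borel" using K U by (auto simp: borel_compact)
  have "emeasure m (U - K) = emeasure m U - emeasure m K"
    using K emeasure_compact_finite[OF K(1)] by (intro emeasure_Diff) (auto simp: KU)
  also have "\<dots> \<le> ennreal (\<epsilon> / 2)"
    using K(3) U(2) by (auto simp: ennreal_minus_le_iff)
  finally have UK: "emeasure m (U - K) \<le> ennreal (\<epsilon> / 2)" .
  obtain V where V: "open V" "0 \<in> V" "\<And>v k. v \<in> V \<Longrightarrow> k \<in> K \<Longrightarrow> v + k \<in> U"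
    "\<And>v k. v \<in> V \<Longrightarrow> k \<in> K \<Longrightarrow> - v + k \<in> U"
    using compact_neighbourhood_in_open[OF K(1) U(1) K(2)] by metis
  have "mean_shift (indicator U) v \<le> ennreal \<epsilon>" if v: "v \<in> V" for v
  proof -
    have [measurable]: "(\<lambda>y. indicator (U - K) (- v + y) :: ennreal) \<in> borel_measurable borel"
      by (rule shift_borel) measurable
    have "ennreal \<bar>indicator U (- v + y) - indicator U y\<bar>
        \<le> indicator (U - K) (- v + y) + indicator (U - K) y" for y
      using V(3)[OF v, of "- v + y"] V(4)[OF v, of y] K(2)
      by (auto simp: indicator_def simp flip: add.assoc)
    then have "mean_shift (indicator U) v \<le>
        (\<integral>\<^sup>+y. indicator (U - K) (- v + y) + indicator (U - K) y \<partial>m)"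
      unfolding mean_shift_def by (intro nn_integral_mono) auto
    also have "\<dots> = (\<integral>\<^sup>+y. indicator (U - K) (- v + y) \<partial>m) + (\<integral>\<^sup>+y. indicator (U - K) y \<partial>m)"
      by (intro nn_integral_add) auto
    also have "(\<integral>\<^sup>+y. indicator (U - K) (- v + y) \<partial>m) = (\<integral>\<^sup>+y. indicator (U - K) y \<partial>m)"
      by (rule nn_integral_translate) measurable
    also have "(\<integral>\<^sup>+y. indicator (U - K) y \<partial>m) = emeasure m (U - K)" by simp
    also have "\<dots> + \<dots> \<le> ennreal (\<epsilon> / 2) + ennreal (\<epsilon> / 2)" by (intro add_mono UK)
    also have "\<dots> = ennreal \<epsilon>" using e by (simp flip: ennreal_plus)
    finally show ?thesis .
  qed
  then show "\<exists>V. open V \<and> 0 \<in> V \<and> (\<forall>v\<in>V. mean_shift (indicator U) v \<le> ennreal \<epsilon>)"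
    using V by blast
qed

lemma mean_continuous_indicator:
  assumes A[measurable]: "A \<in> sets borel" and fin: "emeasure m A < \<infinity>"
  shows "mean_continuous (indicator A)"
proof (rule mean_continuous_approx)
  fix \<epsilon> :: real assume e: "0 < \<epsilon>"
  have inf: "emeasure m A = (INF U\<in>{U. open U \<and> A \<subseteq> U}. emeasure m U)"
    using haar A unfolding haar_measure_def by blast
  have "emeasure m A < emeasure m A + ennreal \<epsilon>" using fin e by simp
  then obtain U where U: "open U" "A \<subseteq> U" "emeasure m U < emeasure m A + ennreal \<epsilon>"
    unfolding inf INF_less_iff by auto
  have U': "U \<in> sets borel" using U by simp
  have "emeasure m A + ennreal \<epsilon> < \<infinity>" using fin by simp
  with U(3) have "emeasure m U < \<infinity>" by (rule less_trans)
  then have "mean_continuous (indicator U)" by (intro mean_continuous_open U)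
  moreover have "(\<integral>\<^sup>+y. ennreal \<bar>indicator A y - indicator U y\<bar> \<partial>m) \<le> ennreal \<epsilon>"
  proof -
    have "(\<integral>\<^sup>+y. ennreal \<bar>indicator A y - indicator U y\<bar> \<partial>m) = (\<integral>\<^sup>+y. indicator (U - A) y \<partial>m)"
      using U(2) by (intro nn_integral_cong) (auto simp: indicator_def)
    also have "\<dots> = emeasure m U - emeasure m A"
      using U U' A fin by (simp add: emeasure_Diff)
    also have "\<dots> \<le> ennreal \<epsilon>" using U(3) fin by (auto simp: ennreal_minus_le_iff less_imp_le)
    finally show ?thesis .
  qed
  ultimately show "\<exists>g\<in>borel_measurable borel. mean_continuous g \<and>
      (\<integral>\<^sup>+y. ennreal \<bar>indicator A y - g y\<bar> \<partial>m) \<le> ennreal \<epsilon>"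
    using U' by (intro bexI[of _ "indicator U"]) auto
qed simp

lemma mean_continuous_scale:
  assumes f: "f \<in> borel_measurable borel" "mean_continuous f"
  shows "mean_continuous (\<lambda>y. f y * c)"
  unfolding mean_continuous_def
proof (intro allI impI)
  fix \<epsilon> :: real assume e: "0 < \<epsilon>"
  define d where "d = \<epsilon> / (\<bar>c\<bar> + 1)"
  have d: "0 < d" "\<bar>c\<bar> * d \<le> \<epsilon>" using e by (auto simp: d_def field_simps)
  obtain V where V: "open V" "0 \<in> V" "\<And>v. v \<in> V \<Longrightarrow> mean_shift f v \<le> ennreal d"
    using f(2) d unfolding mean_continuous_def by metis
  have "mean_shift (\<lambda>y. f y * c) v \<le> ennreal \<epsilon>" if "v \<in> V" for v
  proof -
    have [measurable]: "f \<in> borel_measurable borel" "(\<lambda>y. f (- v + y)) \<in> borel_measurable borel"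
      using f by (auto intro: shift_borel)
    have "mean_shift (\<lambda>y. f y * c) v = (\<integral>\<^sup>+y. ennreal \<bar>c\<bar> * ennreal \<bar>f (- v + y) - f y\<bar> \<partial>m)"
      unfolding mean_shift_def
      by (intro nn_integral_cong) (simp flip: ennreal_mult abs_mult add: algebra_simps)
    also have "\<dots> = ennreal \<bar>c\<bar> * mean_shift f v"
      unfolding mean_shift_def by (intro nn_integral_cmult) measurable
    also have "\<dots> \<le> ennreal \<bar>c\<bar> * ennreal d" by (intro mult_left_mono V that) simp
    also have "\<dots> = ennreal (\<bar>c\<bar> * d)" using d by (simp add: ennreal_mult)
    also have "\<dots> \<le> ennreal \<epsilon>" by (intro ennreal_leI d)
    finally show ?thesis .
  qed
  then show "\<exists>V. open V \<and> 0 \<in> V \<and> (\<forall>v\<in>V. mean_shift (\<lambda>y. f y * c) v \<le> ennreal \<epsilon>)" using V by blast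
qed

lemma mean_continuous_add:
  assumes f: "f \<in> borel_measurable borel" "mean_continuous f"
    and g: "g \<in> borel_measurable borel" "mean_continuous g"
  shows "mean_continuous (\<lambda>y. f y + g y)"
  unfolding mean_continuous_def
proof (intro allI impI)
  fix \<epsilon> :: real assume e: "0 < \<epsilon>"
  obtain V where V: "open V" "0 \<in> V" "\<And>v. v \<in> V \<Longrightarrow> mean_shift f v \<le> ennreal (\<epsilon> / 2)"
    using f(2) e unfolding mean_continuous_def by (meson half_gt_zero)
  obtain W where W: "open W" "0 \<in> W" "\<And>v. v \<in> W \<Longrightarrow> mean_shift g v \<le> ennreal (\<epsilon> / 2)"
    using g(2) e unfolding mean_continuous_def by (meson half_gt_zero)
  have "mean_shift (\<lambda>y. f y + g y) v \<le> ennreal \<epsilon>" if "v \<in> V \<inter> W" for v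
  proof -
    have [measurable]: "f \<in> borel_measurable borel" "(\<lambda>y. f (- v + y)) \<in> borel_measurable borel"
      "g \<in> borel_measurable borel" "(\<lambda>y. g (- v + y)) \<in> borel_measurable borel"
      using f g by (auto intro: shift_borel)
    have "mean_shift (\<lambda>y. f y + g y) v \<le>
        (\<integral>\<^sup>+y. ennreal \<bar>f (- v + y) - f y\<bar> + ennreal \<bar>g (- v + y) - g y\<bar> \<partial>m)"
      unfolding mean_shift_def
      by (intro nn_integral_mono) (auto simp flip: ennreal_plus intro!: ennreal_leI)
    also have "\<dots> = mean_shift f v + mean_shift g v"
      unfolding mean_shift_def by (intro nn_integral_add) auto
    also have "\<dots> \<le> ennreal (\<epsilon> / 2) + ennreal (\<epsilon> / 2)" using that by (intro add_mono V W) auto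
    also have "\<dots> = ennreal \<epsilon>" using e by (simp flip: ennreal_plus)
    finally show ?thesis .
  qed
  then show "\<exists>V. open V \<and> 0 \<in> V \<and> (\<forall>v\<in>V. mean_shift (\<lambda>y. f y + g y) v \<le> ennreal \<epsilon>)"
    using V W by (intro exI[of _ "V \<inter> W"]) auto
qed

lemma integrable_mean_continuous:
  assumes "integrable m f" shows "mean_continuous f"
  using assms
proof (induction f rule: integrable_induct)
  case (base A c)
  then show ?case
    using mean_continuous_scale[of "indicator A" c] mean_continuous_indicator[of A] by simp
next
  case (add f g)
  then show ?case by (intro mean_continuous_add) (auto dest: borel_measurable_integrable)
next
  case (lim f s)
  show ?case
  proof (rule mean_continuous_approx)
    show "f \<in> borel_measurable borel" using borel_measurable_integrable[OF lim.hyps(4)] by simp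
    fix \<epsilon> :: real assume e: "0 < \<epsilon>"
    have "(\<lambda>i. \<integral>\<^sup>+x. ennreal (norm (f x - s i x)) \<partial>m) \<longlonglongrightarrow> 0"
    proof (rule nn_integral_dominated_convergence_norm[where w = "\<lambda>x. 2 * norm (f x)"])
      have "integrable m (\<lambda>x. 2 * f x)" using lim.hyps(4) by simp
      then show "(\<integral>\<^sup>+x. ennreal (2 * norm (f x)) \<partial>m) < \<infinity>"
        unfolding integrable_iff_bounded real_norm_def abs_mult by simp
      show "s i \<in> borel_measurable m" for i by (rule borel_measurable_integrable[OF lim.hyps(1)])
      show "f \<in> borel_measurable m" "(\<lambda>x. 2 * norm (f x)) \<in> borel_measurable m"
        using borel_measurable_integrable[OF lim.hyps(4)] by (simp_all del: measurable_m)
    qed (use lim.hyps in auto)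
    then have "\<forall>\<^sub>F i in sequentially. (\<integral>\<^sup>+x. ennreal (norm (f x - s i x)) \<partial>m) < ennreal \<epsilon>"
      using e by (intro order_tendstoD) auto
    then obtain i where "(\<integral>\<^sup>+x. ennreal (norm (f x - s i x)) \<partial>m) < ennreal \<epsilon>"
      using eventually_sequentially by auto
    then show "\<exists>g\<in>borel_measurable borel. mean_continuous g \<and> (\<integral>\<^sup>+y. ennreal \<bar>f y - g y\<bar> \<partial>m) \<le> ennreal \<epsilon>"
      using lim.IH[of i] borel_measurable_integrable[OF lim.hyps(1)[of i]]
      by (intro bexI[of _ "s i"]) auto
  qed
qed

end

subsection \<open>Inversion on a unimodular group\<close>

locale unimodular_haar_group = haar_group +
  assumes unimodular: "unimodular m"
begin

lemma right_translate_measurable: "(\<lambda>y. y + x) \<in> measurable m m"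
  unfolding measurable_cong_sets[OF sets_m sets_m]
    by (intro borel_measurable_continuous_onI continuous_intros)

lemma distr_right_translate: "distr m m (\<lambda>y. y + x) = m"
proof (rule measure_eqI)
  fix A assume "A \<in> sets (distr m m (\<lambda>y. y + x))"
  then have A: "A \<in> sets borel" by simp
  have "(\<lambda>y. y + x) -` A = (\<lambda>y. y + (- x)) ` A"
    by (auto simp: image_iff add.assoc intro!: bexI[of _ "_ + x"])
  moreover have "emeasure m ((\<lambda>y. y + (- x)) ` A) = emeasure m A"
    using A unimodular unfolding unimodular_def by blast
  ultimately show "emeasure (distr m m (\<lambda>y. y + x)) A = emeasure m A"
    using A by (simp add: emeasure_distr right_translate_measurable)
qed simp

lemma nn_integral_right_translate:
  assumes "f \<in> borel_measurable borel"
  shows "(\<integral>\<^sup>+y. f (y + x) \<partial>m) = (\<integral>\<^sup>+y. f y \<partial>m)"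
  using nn_integral_distr[OF right_translate_measurable, where f = f] assms by (simp add: distr_right_translate)

lemma right_shift_borel:
  assumes "f \<in> borel_measurable (borel :: 'a measure)"
  shows "(\<lambda>y. f (y - x)) \<in> borel_measurable borel"
  unfolding diff_conv_add_uminus
  by (rule measurable_compose[OF _ assms]) (intro borel_measurable_continuous_onI continuous_intros)

lemma Fubini_swap:
  assumes "(\<lambda>p. f (fst p) (snd p)) \<in> borel_measurable (borel :: ('a \<times> 'a) measure)"
  shows "(\<integral>\<^sup>+y. (\<integral>\<^sup>+x. f x y \<partial>m) \<partial>m) = (\<integral>\<^sup>+x. (\<integral>\<^sup>+y. f x y \<partial>m) \<partial>m)"
proof -
  interpret P: pair_sigma_finite m m by (rule pair_sigma_finite_m)
  have "sets (m \<Otimes>\<^sub>M m) = sets (borel :: ('a \<times> 'a) measure)"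
    using sets_pair_measure_cong[OF sets_m sets_m] unfolding borel_prod .
  note eq = measurable_cong_sets[OF this refl]
  have "case_prod f \<in> borel_measurable (m \<Otimes>\<^sub>M m)"
    using assms unfolding case_prod_beta' eq .
  from P.Fubini'[OF this] show ?thesis by simp
qed

text \<open>
  The double integral of \<open>1\<^sub>A(x) 1\<^sub>B(x y\<inverse>)\<close> is computed twice. Integrating \<open>y\<close> first, with
  right invariance, gives \<open>m(A) m(B\<inverse>)\<close>; substituting \<open>x y\<close> for \<open>x\<close> and then integrating \<open>y\<close>,
  with left invariance, gives \<open>m(A) m(B)\<close>.
\<close>

lemma emeasure_uminus:
  assumes B[measurable]: "B \<in> sets borel"
  shows "emeasure m (uminus ` B) = emeasure m B"
proof -
  obtain A :: "'a set" where "open A" and A: "emeasure m A < \<infinity>" "0 < emeasure m A"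
    using exists_finite_open by metis
  then have A'[measurable]: "A \<in> sets borel" by simp
  have uB: "uminus ` B = uminus -` B" by (auto simp: image_iff intro!: bexI[of _ "- _"])
  have [measurable]: "uminus \<in> borel_measurable (borel :: 'a measure)"
    by (intro borel_measurable_continuous_onI continuous_intros)
  have uB'[measurable]: "uminus ` B \<in> sets borel"
    unfolding uB using measurable_sets[of uminus borel borel B] by simp
  have [measurable]: "fst \<in> borel_measurable (borel :: ('a \<times> 'a) measure)"
    "snd \<in> borel_measurable (borel :: ('a \<times> 'a) measure)"
    "(\<lambda>p. fst p - snd p) \<in> borel_measurable (borel :: ('a \<times> 'a) measure)"
    "(\<lambda>p. fst p + snd p) \<in> borel_measurable (borel :: ('a \<times> 'a) measure)"
    unfolding diff_conv_add_uminus
    by (intro borel_measurable_continuous_onI continuous_intros)+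
  have ind: "indicator (uminus ` B) z = indicator B (- z)" for z :: 'a
    by (auto simp: uB indicator_def)
  let ?I = "\<integral>\<^sup>+y. (\<integral>\<^sup>+x. indicator A x * indicator B (x - y) \<partial>m) \<partial>m :: ennreal"
  have "?I = (\<integral>\<^sup>+x. (\<integral>\<^sup>+y. indicator A x * indicator B (x - y) \<partial>m) \<partial>m)"
    by (rule Fubini_swap) measurable
  also have "\<dots> = (\<integral>\<^sup>+x. indicator A x * emeasure m (uminus ` B) \<partial>m)"
  proof (intro nn_integral_cong)
    fix x :: 'a
    have [measurable]: "(\<lambda>y. indicator (uminus ` B) (y - x) :: ennreal) \<in> borel_measurable borel"
      by (intro right_shift_borel) simp
    have "(\<integral>\<^sup>+y. indicator A x * indicator B (x - y) \<partial>m)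
        = (\<integral>\<^sup>+y. indicator A x * indicator (uminus ` B) (y - x) \<partial>m)"
      by (simp add: ind)
    also have "\<dots> = indicator A x * (\<integral>\<^sup>+y. indicator (uminus ` B) (y - x) \<partial>m)"
      by (intro nn_integral_cmult) simp
    also have "(\<integral>\<^sup>+y. indicator (uminus ` B) (y - x) \<partial>m) = (\<integral>\<^sup>+y. indicator (uminus ` B) y \<partial>m)"
      using nn_integral_right_translate[of "indicator (uminus ` B)" "- x"] by simp
    finally show "(\<integral>\<^sup>+y. indicator A x * indicator B (x - y) \<partial>m) = indicator A x * emeasure m (uminus ` B)"
      by simp
  qed
  also have "\<dots> = emeasure m A * emeasure m (uminus ` B)"
    by (simp add: nn_integral_multc)
  finally have 1: "?I = emeasure m A * emeasure m (uminus ` B)" .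
  have "?I = (\<integral>\<^sup>+y. (\<integral>\<^sup>+x. indicator A (x + y) * indicator B x \<partial>m) \<partial>m)"
  proof (rule nn_integral_cong)
    fix y :: 'a
    have [measurable]: "(\<lambda>x. indicator B (x - y) :: ennreal) \<in> borel_measurable borel"
      by (intro right_shift_borel) simp
    show "(\<integral>\<^sup>+x. indicator A x * indicator B (x - y) \<partial>m) = (\<integral>\<^sup>+x. indicator A (x + y) * indicator B x \<partial>m :: ennreal)"
      using nn_integral_right_translate[of "\<lambda>x. indicator A x * indicator B (x - y)" y] by simp
  qed
  also have "\<dots> = (\<integral>\<^sup>+x. (\<integral>\<^sup>+y. indicator A (x + y) * indicator B x \<partial>m) \<partial>m)"
    by (rule Fubini_swap) measurable
  also have "\<dots> = (\<integral>\<^sup>+x. indicator B x * emeasure m A \<partial>m)"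
  proof (intro nn_integral_cong)
    fix x :: 'a
    have [measurable]: "(\<lambda>y. indicator A (x + y) :: ennreal) \<in> borel_measurable borel"
      by (rule shift_borel) simp
    have "(\<integral>\<^sup>+y. indicator A (x + y) * indicator B x \<partial>m) = (\<integral>\<^sup>+y. indicator A (x + y) \<partial>m) * (indicator B x :: ennreal)"
      by (intro nn_integral_multc) simp
    also have "(\<integral>\<^sup>+y. indicator A (x + y) \<partial>m) = (\<integral>\<^sup>+y. indicator A y \<partial>m :: ennreal)"
      by (rule nn_integral_translate) simp
    finally show "(\<integral>\<^sup>+y. indicator A (x + y) * indicator B x \<partial>m) = indicator B x * emeasure m A"
      by (simp add: mult.commute)
  qed
  also have "\<dots> = emeasure m A * emeasure m B"
    by (simp add: nn_integral_multc mult.commute)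
  finally show ?thesis using 1 A by (auto simp: ennreal_mult_cancel_left)
qed

end

section \<open>Beurling densities along a strong Folner sequence\<close>

abbreviation ncard :: "'a set \<Rightarrow> ennreal" where "ncard A \<equiv> emeasure (count_space UNIV) A"

lemma ncard_le:
  assumes "\<And>S. finite S \<Longrightarrow> S \<subseteq> A \<Longrightarrow> of_nat (card S) \<le> c"
  shows "ncard A \<le> c"
proof (cases "finite A")
  case True
  then show ?thesis using assms[of A] by (simp add: emeasure_count_space)
next
  case False
  have "of_nat n \<le> c" for n
  proof -
    obtain S where "finite S" "card S = n" "S \<subseteq> A" using infinite_arbitrarily_large[OF False] by metis
    then show ?thesis using assms[of S] by simp
  qed
  then have "c = top" using ennreal_Ex_less_of_nat[of c] by (metis infinity_ennreal_def leD top.not_eq_extremum)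
  then show ?thesis by simp
qed

lemma mem_translate_iff: "l \<in> (+) z ` K \<longleftrightarrow> - z + l \<in> K" for l z :: "'a::group_add"
  by (auto simp: image_iff simp flip: add.assoc intro!: bexI[of _ "- z + l"])

lemma open_plus_set:
  fixes U :: "'a::topological_group_add set"
  assumes "open U" shows "open (U + K)"
proof -
  have "U + K = (\<Union>k\<in>K. (\<lambda>y. y - k) -` U)"
    by (auto simp: set_plus_def) (metis diff_add_cancel)
  moreover have "open ((\<lambda>y. y - k) -` U)" for k
    unfolding diff_conv_add_uminus by (intro open_vimage assms continuous_intros)
  ultimately show ?thesis by auto
qed

context unimodular_haar_group
begin

text \<open>
  The set whose relative measure tends to zero along a strong Folner sequence. For compact \<open>K\<close>
  containing the identity it contains both \<open>F K - F\<close> and the points of \<open>F\<close> moved out of \<open>F\<close>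
  by right multiplication with some element of \<open>K\<inverse>\<close>.
\<close>

definition boundary :: "'a set \<Rightarrow> 'a set \<Rightarrow> 'a set" where
  "boundary F K = (F + K) \<inter> ((UNIV - F) + K)"

lemma borel_boundary:
  assumes "compact F" "compact K" shows "boundary F K \<in> sets borel"
  using borel_compact[OF compact_set_plus[OF assms]]
    open_plus_set[of "UNIV - F" K] compact_imp_closed[OF assms(1)]
  unfolding boundary_def by (intro sets.Int) (auto simp: open_Diff)

lemma emeasure_plus_le:
  assumes "compact F" "compact K" "0 \<in> K"
  shows "emeasure m (F + K) \<le> emeasure m F + emeasure m (boundary F K)"
proof -
  have "F + K \<subseteq> F \<union> boundary F K"
    using set_plus_intro[of _ "UNIV - F" 0 K] assms(3) by (auto simp: boundary_def)
  then have "emeasure m (F + K) \<le> emeasure m (F \<union> boundary F K)"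
    using assms by (intro emeasure_mono) (auto simp: borel_compact borel_boundary)
  also have "\<dots> \<le> emeasure m F + emeasure m (boundary F K)"
    using assms by (intro emeasure_subadditive) (auto simp: borel_compact borel_boundary)
  finally show ?thesis .
qed

text \<open>
  Unimodularity enters here: the set of \<open>y\<close> for which \<open>x y K\<close> contains a given point \<open>l\<close> is a
  left translate of \<open>K\<inverse>\<close>, and its measure has to equal \<open>m K\<close>.
\<close>

lemma nn_integral_covering:
  assumes [measurable]: "K \<in> sets borel"
  shows "(\<integral>\<^sup>+y. indicator K (- (x + y) + l) \<partial>m) = emeasure m K"
    and "(\<lambda>y. indicator K (- (x + y) + l) :: ennreal) \<in> borel_measurable borel"
proof -
  have uK: "uminus ` K = uminus -` K" by (auto simp: image_iff intro!: bexI[of _ "- _"])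
  have "uminus \<in> borel_measurable (borel :: 'a measure)"
    by (intro borel_measurable_continuous_onI continuous_intros)
  then have uK'[measurable]: "uminus ` K \<in> sets borel"
    unfolding uK using measurable_sets[of uminus borel borel K] by simp
  have eq: "indicator K (- (x + y) + l) = (indicator (uminus ` K) ((- l + x) + y) :: ennreal)" for y
    by (auto simp: uK indicator_def minus_add add.assoc)
  show "(\<lambda>y. indicator K (- (x + y) + l) :: ennreal) \<in> borel_measurable borel"
    unfolding eq by (rule shift_borel) measurable
  have "(\<integral>\<^sup>+y. indicator K (- (x + y) + l) \<partial>m) = (\<integral>\<^sup>+y. indicator (uminus ` K) y \<partial>m)"
    unfolding eq by (rule nn_integral_translate) measurable
  then show "(\<integral>\<^sup>+y. indicator K (- (x + y) + l) \<partial>m) = emeasure m K"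
    by (simp add: emeasure_uminus)
qed

lemma nn_integral_covering_sum:
  assumes "K \<in> sets borel" "finite S"
  shows "(\<integral>\<^sup>+y. (\<Sum>l\<in>S. indicator K (- (x + y) + l)) \<partial>m) = of_nat (card S) * emeasure m K"
  using assms by (simp add: nn_integral_sum nn_integral_covering)

text \<open>
  Double counting of the pairs \<open>(y, l)\<close> with \<open>y \<in> F'\<close> and \<open>l \<in> \<Lambda> \<inter> x y K\<close>. Every \<open>y\<close> contributes
  at least the minimal count, every \<open>l\<close> is hit by a set of \<open>y\<close> of measure at most \<open>m K\<close>, and
  only points of \<open>\<Lambda> \<inter> x F\<close> are hit.
\<close>

lemma ncard_translate_ge:
  assumes K: "compact K" "0 < emeasure m K" and F': "F' \<in> sets borel" "F' + K \<subseteq> F"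
  shows "(INF z. relative_count m \<Lambda> K z) * emeasure m F' \<le> ncard (\<Lambda> \<inter> (+) x ` F)"
proof (cases "finite (\<Lambda> \<inter> (+) x ` F)")
  case False
  then show ?thesis by (simp add: emeasure_count_space)
next
  case True
  define S where "S = \<Lambda> \<inter> (+) x ` F"
  define a where "a = (INF z. relative_count m \<Lambda> K z)"
  have S: "finite S" using True by (simp add: S_def)
  have fin: "emeasure m K < \<infinity>" by (rule emeasure_compact_finite[OF K(1)])
  have le: "a * emeasure m K * indicator F' y \<le> (\<Sum>l\<in>S. indicator K (- (x + y) + l))" for y
  proof (cases "y \<in> F'")
    case y: True
    have "a \<le> ncard (\<Lambda> \<inter> (+) (x + y) ` K) / emeasure m K"
      unfolding a_def relative_count_def by (rule INF_lower) simp
    then have "a * emeasure m K \<le> ncard (\<Lambda> \<inter> (+) (x + y) ` K) / emeasure m K * emeasure m K"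
      by (rule mult_right_mono) simp
    also have "\<dots> = ncard (\<Lambda> \<inter> (+) (x + y) ` K)"
      using K(2) fin by (simp add: ennreal_divide_times ennreal_mult_divide_eq)
    also have "\<Lambda> \<inter> (+) (x + y) ` K = {l\<in>S. - (x + y) + l \<in> K}"
    proof -
      have "l \<in> (+) x ` F" if "- (x + y) + l \<in> K" for l
      proof -
        have "y + (- (x + y) + l) \<in> F" using that y F'(2) by (auto intro!: set_plus_intro)
        moreover have "l = x + (y + (- (x + y) + l))" by (simp add: minus_add add.assoc del: add_uminus_conv_diff)
        ultimately show ?thesis by blast
      qed
      then show ?thesis unfolding S_def mem_translate_iff by (auto simp: mem_translate_iff)
    qed
    also have "ncard {l\<in>S. - (x + y) + l \<in> K} = (\<Sum>l\<in>S. indicator K (- (x + y) + l))"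
      using S by (simp add: emeasure_count_space indicator_def sum.If_cases Int_def)
    finally show ?thesis using y by simp
  qed simp
  have "a * emeasure m K * emeasure m F' = (\<integral>\<^sup>+y. a * emeasure m K * indicator F' y \<partial>m)"
    using F' by (subst nn_integral_cmult) auto
  also have "\<dots> \<le> (\<integral>\<^sup>+y. (\<Sum>l\<in>S. indicator K (- (x + y) + l)) \<partial>m)"
    by (intro nn_integral_mono le)
  also have "\<dots> = ncard S * emeasure m K"
    using nn_integral_covering_sum[OF borel_compact[OF K(1)] S] S by (simp add: emeasure_count_space)
  finally have "emeasure m K * (a * emeasure m F') \<le> emeasure m K * ncard S"
    by (simp add: ac_simps)
  then show ?thesis using K(2) fin by (simp add: ennreal_mult_le_mult_iff a_def S_def)
qed

text \<open>
  The same double count from above: a point of \<open>\<Lambda> \<inter> x F\<close> lies in \<open>x y K\<close> exactly for a set of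
  \<open>y\<close> of measure \<open>m K\<close>, and all of these \<open>y\<close> lie in \<open>F K\<inverse>\<close>.
\<close>

lemma ncard_translate_le:
  assumes K: "compact K" "0 < emeasure m K" and F: "compact F"
  shows "ncard (\<Lambda> \<inter> (+) x ` F) \<le> (SUP z. relative_count m \<Lambda> K z) * emeasure m (F + uminus ` K)"
proof (rule ncard_le)
  fix S assume S: "finite S" "S \<subseteq> \<Lambda> \<inter> (+) x ` F"
  define b where "b = (SUP z. relative_count m \<Lambda> K z)"
  have fin: "emeasure m K < \<infinity>" by (rule emeasure_compact_finite[OF K(1)])
  have "compact (uminus ` K)"
    by (intro compact_continuous_image K continuous_intros)
  then have meas: "F + uminus ` K \<in> sets borel"
    by (intro borel_compact compact_set_plus F)
  have le: "(\<Sum>l\<in>S. indicator K (- (x + y) + l)) \<le> b * emeasure m K * indicator (F + uminus ` K) y" for y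
  proof (cases "y \<in> F + uminus ` K")
    case True
    have "(\<Sum>l\<in>S. indicator K (- (x + y) + l)) = ncard {l\<in>S. - (x + y) + l \<in> K}"
      using S by (simp add: emeasure_count_space indicator_def sum.If_cases Int_def)
    also have "\<dots> \<le> ncard (\<Lambda> \<inter> (+) (x + y) ` K)"
      using S(2) by (intro emeasure_mono) (auto simp: mem_translate_iff)
    also have "\<dots> = ncard (\<Lambda> \<inter> (+) (x + y) ` K) / emeasure m K * emeasure m K"
      using K(2) fin by (simp add: ennreal_divide_times ennreal_mult_divide_eq)
    also have "\<dots> \<le> b * emeasure m K"
      unfolding b_def relative_count_def by (intro mult_right_mono SUP_upper) simp_all
    finally show ?thesis using True by simp
  next
    case False
    have "- (x + y) + l \<notin> K" if l: "l \<in> S" for l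
    proof
      assume k: "- (x + y) + l \<in> K"
      obtain f where f: "f \<in> F" "l = x + f" using S(2) l by auto
      have "f + - (- (x + y) + l) = y" by (simp add: f(2) minus_add add.assoc del: add_uminus_conv_diff)
      then have "y \<in> F + uminus ` K" using f(1) k by (metis imageI set_plus_intro)
      then show False using False by simp
    qed
    then show ?thesis by simp
  qed
  have "of_nat (card S) * emeasure m K = (\<integral>\<^sup>+y. (\<Sum>l\<in>S. indicator K (- (x + y) + l)) \<partial>m)"
    using nn_integral_covering_sum[OF borel_compact[OF K(1)] S(1)] by simp
  also have "\<dots> \<le> (\<integral>\<^sup>+y. b * emeasure m K * indicator (F + uminus ` K) y \<partial>m)"
    by (intro nn_integral_mono le)
  also have "\<dots> = b * emeasure m K * emeasure m (F + uminus ` K)"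
    using meas by (subst nn_integral_cmult) auto
  finally have "emeasure m K * of_nat (card S) \<le> emeasure m K * (b * emeasure m (F + uminus ` K))"
    by (simp add: ac_simps)
  then show "of_nat (card S) \<le> b * emeasure m (F + uminus ` K)"
    using K(2) fin by (simp add: ennreal_mult_le_mult_iff)
qed

end

locale folner_group = unimodular_haar_group +
  fixes F :: "nat \<Rightarrow> 'a set"
  assumes folner: "strong_folner m F"
begin

lemma compact_F: "compact (F n)" and F_pos: "0 < emeasure m (F n)"
  using folner by (auto simp: strong_folner_def)

lemma F_finite: "emeasure m (F n) < \<infinity>"
  by (rule emeasure_compact_finite[OF compact_F])

lemma borel_F: "F n \<in> sets borel"
  by (rule borel_compact[OF compact_F])

definition boundary_ratio :: "'a set \<Rightarrow> nat \<Rightarrow> ennreal" where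
  "boundary_ratio K n = emeasure m (boundary (F n) K) / emeasure m (F n)"

lemma boundary_ratio_tendsto: "compact K \<Longrightarrow> boundary_ratio K \<longlonglongrightarrow> 0"
  using folner by (simp add: strong_folner_def boundary_ratio_def[abs_def] boundary_def)

lemma emeasure_boundary: "emeasure m (boundary (F n) K) = boundary_ratio K n * emeasure m (F n)"
  using F_pos[of n] F_finite[of n] by (simp add: boundary_ratio_def ennreal_divide_times ennreal_mult_divide_eq)

lemma emeasure_F_plus_le:
  assumes "compact K" "0 \<in> K"
  shows "emeasure m (F n + K) \<le> (1 + boundary_ratio K n) * emeasure m (F n)"
  using emeasure_plus_le[OF compact_F assms, of n] by (simp add: emeasure_boundary distrib_right)

lemma compact_insert_uminus: "compact K \<Longrightarrow> compact (insert 0 (uminus ` K))" for K :: "'a set"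
  using compact_Un[of "{0}" "uminus ` K"] compact_continuous_image[of K uminus]
  by (simp add: continuous_intros)

text \<open>
  Each \<open>F n\<close> is itself admissible in the supremum that defines the density. Conversely, the
  minimal relative count in any \<open>K\<close> is a lower bound for the one in \<open>F n\<close>, up to the factor
  \<open>m {y \<in> F n. y K \<subseteq> F n} / m (F n)\<close>, which tends to one.
\<close>

lemma lower_count_tendsto:
  "(\<lambda>n. INF x. relative_count m \<Lambda> (F n) x) \<longlonglongrightarrow> lower_beurling_density m \<Lambda>"
proof (rule order_tendstoI)
  fix c assume "c < lower_beurling_density m \<Lambda>"
  then obtain K where K: "compact K" "0 < emeasure m K" and "c < (INF x. relative_count m \<Lambda> K x)"
    unfolding lower_beurling_density_def less_SUP_iff by auto
  \<comment> \<open>A finite intermediate value: multiplication by \<open>\<infinity>\<close> is not continuous.\<close>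
  then obtain a where a: "c < a" "a < (INF x. relative_count m \<Lambda> K x)" using dense by blast
  then have "a < top" by (meson less_le_trans top_greatest)
  \<comment> \<open>As \<open>K'\<close> contains the identity and \<open>K\<inverse>\<close>, its boundary contains every \<open>y \<in> F n\<close> for which \<open>y K\<close> leaves \<open>F n\<close>.\<close>
  define K' where "K' = insert 0 (uminus ` K)"
  have K': "compact K'" unfolding K'_def by (rule compact_insert_uminus[OF K(1)])
  have le: "a * (1 - boundary_ratio K' n) \<le> relative_count m \<Lambda> (F n) x" for n x
  proof -
    have B: "boundary (F n) K' \<in> sets borel" by (rule borel_boundary[OF compact_F K'])
    define F' where "F' = F n - boundary (F n) K'"
    have "F' + K \<subseteq> F n"
    proof
      fix z assume "z \<in> F' + K"
      then obtain y k where z: "z = y + k" "y \<in> F'" "k \<in> K" by (auto simp: set_plus_def)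
      show "z \<in> F n"
      proof (rule ccontr)
        assume "z \<notin> F n"
        then have "z + - k \<in> (UNIV - F n) + K'" using z(3) by (intro set_plus_intro) (auto simp: K'_def)
        moreover have "y + 0 \<in> F n + K'" using z(2) by (intro set_plus_intro) (auto simp: K'_def F'_def)
        ultimately show False using z(1,2) by (auto simp: F'_def boundary_def add.assoc)
      qed
    qed
    then have "(INF x. relative_count m \<Lambda> K x) * emeasure m F' \<le> ncard (\<Lambda> \<inter> (+) x ` F n)"
      using B borel_F by (intro ncard_translate_ge K) (auto simp: F'_def)
    then have "a * emeasure m F' \<le> ncard (\<Lambda> \<inter> (+) x ` F n)"
      using a(2) by (meson less_imp_le mult_right_mono order_trans zero_le)
    moreover have "(1 - boundary_ratio K' n) * emeasure m (F n) \<le> emeasure m F'"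
    proof -
      have "emeasure m (F n) \<le> emeasure m (F' \<union> boundary (F n) K')"
        using B borel_F by (intro emeasure_mono) (auto simp: F'_def)
      also have "\<dots> \<le> emeasure m F' + emeasure m (boundary (F n) K')"
        using B borel_F by (intro emeasure_subadditive) (auto simp: F'_def)
      finally have "emeasure m (F n) - emeasure m (boundary (F n) K') \<le> emeasure m F'"
        using F_finite[of n] by (auto simp: ennreal_minus_le_iff add.commute)
      moreover have "emeasure m (boundary (F n) K') = boundary_ratio K' n * emeasure m (F n)"
        by (rule emeasure_boundary)
      moreover have "(1 - boundary_ratio K' n) * emeasure m (F n)
          = emeasure m (F n) - boundary_ratio K' n * emeasure m (F n)"
        using ennreal_right_diff_distrib[of "emeasure m (F n)" 1 "boundary_ratio K' n"] F_finite[of n]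
        by (simp add: mult.commute less_top)
      ultimately show ?thesis by simp
    qed
    ultimately have "a * ((1 - boundary_ratio K' n) * emeasure m (F n)) \<le> ncard (\<Lambda> \<inter> (+) x ` F n)"
      by (meson mult_left_mono order_trans zero_le)
    then have "a * (1 - boundary_ratio K' n) * emeasure m (F n) / emeasure m (F n)
        \<le> ncard (\<Lambda> \<inter> (+) x ` F n) / emeasure m (F n)"
      by (intro divide_right_mono_ennreal) (simp add: ac_simps)
    then show ?thesis
      using F_pos[of n] F_finite[of n] by (simp add: relative_count_def ennreal_mult_divide_eq)
  qed
  have "(\<lambda>n. a * (1 - boundary_ratio K' n)) \<longlonglongrightarrow> a * (1 - 0)"
    by (intro ennreal_tendsto_cmult tendsto_diff_ennreal tendsto_const boundary_ratio_tendsto K')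
      (simp_all add: \<open>a < top\<close>)
  then have "\<forall>\<^sub>F n in sequentially. c < a * (1 - boundary_ratio K' n)"
    using a(1) by (intro order_tendstoD) auto
  then show "\<forall>\<^sub>F n in sequentially. c < (INF x. relative_count m \<Lambda> (F n) x)"
    by eventually_elim (rule less_le_trans, assumption, rule INF_greatest, rule le)
next
  fix c assume c: "lower_beurling_density m \<Lambda> < c"
  have "(INF x. relative_count m \<Lambda> (F n) x) \<le> lower_beurling_density m \<Lambda>" for n
    unfolding lower_beurling_density_def
    by (rule SUP_upper[of "F n"]) (simp add: compact_F F_pos)
  then show "\<forall>\<^sub>F n in sequentially. (INF x. relative_count m \<Lambda> (F n) x) < c"
    by (intro always_eventually allI le_less_trans[OF _ c])
qed

text \<open>
  Dual to the lower density: the maximal relative count in \<open>K\<close> bounds the one in \<open>F n\<close>, up to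
  the factor \<open>m (F n K\<inverse>) / m (F n)\<close>, which is asymptotically at most one.
\<close>

lemma upper_count_tendsto:
  "(\<lambda>n. SUP x. relative_count m \<Lambda> (F n) x) \<longlonglongrightarrow> upper_beurling_density m \<Lambda>"
proof (rule order_tendstoI)
  fix c assume "upper_beurling_density m \<Lambda> < c"
  then obtain K where K: "compact K" "0 < emeasure m K" and c: "(SUP x. relative_count m \<Lambda> K x) < c"
    unfolding upper_beurling_density_def INF_less_iff by auto
  define b where "b = (SUP x. relative_count m \<Lambda> K x)"
  define K' where "K' = insert 0 (uminus ` K)"
  have K': "compact K'" unfolding K'_def by (rule compact_insert_uminus[OF K(1)])
  have le: "relative_count m \<Lambda> (F n) x \<le> b * (1 + boundary_ratio K' n)" for n x
  proof -
    have "F n + uminus ` K \<subseteq> F n + K'" by (auto simp: K'_def set_plus_def)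
    then have "emeasure m (F n + uminus ` K) \<le> emeasure m (F n + K')"
      by (rule emeasure_mono) (simp add: borel_compact compact_set_plus compact_F K')
    also have "\<dots> \<le> (1 + boundary_ratio K' n) * emeasure m (F n)"
      by (rule emeasure_F_plus_le[OF K']) (simp add: K'_def)
    finally have "b * emeasure m (F n + uminus ` K) \<le> b * ((1 + boundary_ratio K' n) * emeasure m (F n))"
      by (rule mult_left_mono) simp
    then have "ncard (\<Lambda> \<inter> (+) x ` F n) \<le> b * (1 + boundary_ratio K' n) * emeasure m (F n)"
      using ncard_translate_le[OF K compact_F, of \<Lambda> x n] by (simp add: b_def ac_simps)
    then have "ncard (\<Lambda> \<inter> (+) x ` F n) / emeasure m (F n)
        \<le> b * (1 + boundary_ratio K' n) * emeasure m (F n) / emeasure m (F n)"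
      by (rule divide_right_mono_ennreal)
    then show ?thesis
      using F_pos[of n] F_finite[of n] by (simp add: relative_count_def ennreal_mult_divide_eq)
  qed
  have "(\<lambda>n. b * (1 + boundary_ratio K' n)) \<longlonglongrightarrow> b * (1 + 0)"
    by (intro ennreal_tendsto_cmult tendsto_add tendsto_const boundary_ratio_tendsto K')
      (use c in \<open>auto simp: b_def intro: less_le_trans\<close>)
  then have "\<forall>\<^sub>F n in sequentially. b * (1 + boundary_ratio K' n) < c"
    using c by (intro order_tendstoD) (auto simp: b_def)
  then show "\<forall>\<^sub>F n in sequentially. (SUP x. relative_count m \<Lambda> (F n) x) < c"
    by eventually_elim (rule le_less_trans[rotated], assumption, rule SUP_least, rule le)
next
  fix c assume c: "c < upper_beurling_density m \<Lambda>"
  have "upper_beurling_density m \<Lambda> \<le> (SUP x. relative_count m \<Lambda> (F n) x)" for n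
    unfolding upper_beurling_density_def
    by (rule INF_lower[of "F n"]) (simp add: compact_F F_pos)
  then show "\<forall>\<^sub>F n in sequentially. c < (SUP x. relative_count m \<Lambda> (F n) x)"
    by (intro always_eventually allI less_le_trans[OF c])
qed

lemma folner_lower_density_eq: "folner_lower_density m F \<Lambda> = lower_beurling_density m \<Lambda>"
  unfolding folner_lower_density_def by (rule limI[OF lower_count_tendsto])

lemma folner_upper_density_eq: "folner_upper_density m F \<Lambda> = upper_beurling_density m \<Lambda>"
  unfolding folner_upper_density_def by (rule limI[OF upper_count_tendsto])

end

section \<open>Hilbert spaces of functions\<close>

text \<open>
  An inner product space is carried here by a set of functions and not by a type, so that one
  set can be given two inner products: the given one and the one obtained from samples.
\<close>

locale inner_product_functions =
  fixes H :: "('a \<Rightarrow> complex) set" and ip :: "('a \<Rightarrow> complex) \<Rightarrow> ('a \<Rightarrow> complex) \<Rightarrow> complex"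
  assumes inner_product_space: "function_inner_product_space H ip"
begin

lemma zero_mem: "(\<lambda>x. 0) \<in> H"
  and add_mem: "\<And>f g. f \<in> H \<Longrightarrow> g \<in> H \<Longrightarrow> (\<lambda>x. f x + g x) \<in> H"
  and scale_mem: "\<And>c f. f \<in> H \<Longrightarrow> (\<lambda>x. c * f x) \<in> H"
  and ip_add_left: "\<And>f g h. f \<in> H \<Longrightarrow> g \<in> H \<Longrightarrow> h \<in> H \<Longrightarrow> ip (\<lambda>x. f x + g x) h = ip f h + ip g h"
  and ip_scale_left: "\<And>c f g. f \<in> H \<Longrightarrow> g \<in> H \<Longrightarrow> ip (\<lambda>x. c * f x) g = c * ip f g"
  and ip_commute: "\<And>f g. f \<in> H \<Longrightarrow> g \<in> H \<Longrightarrow> ip g f = cnj (ip f g)"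
  and ip_self_pos: "\<And>f. f \<in> H \<Longrightarrow> f \<noteq> (\<lambda>x. 0) \<Longrightarrow> 0 < Re (ip f f)"
  using inner_product_space unfolding function_inner_product_space_def by blast+

lemma diff_mem:
  assumes "f \<in> H" "g \<in> H" shows "(\<lambda>x. f x - g x) \<in> H"
  using add_mem[OF assms(1) scale_mem[OF assms(2), of "-1"]] by simp

lemma sum_mem:
  assumes "finite I" "\<And>i. i \<in> I \<Longrightarrow> f i \<in> H"
  shows "(\<lambda>x. \<Sum>i\<in>I. f i x) \<in> H"
  using assms by (induction I rule: finite_induct) (auto intro: zero_mem add_mem)

lemma ip_zero_left: "g \<in> H \<Longrightarrow> ip (\<lambda>x. 0) g = 0"
  using ip_scale_left[OF zero_mem, of g 0] by simp

lemma ip_zero_right: "g \<in> H \<Longrightarrow> ip g (\<lambda>x. 0) = 0"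
  using ip_commute[OF zero_mem, of g] by (simp add: ip_zero_left)

lemma ip_add_right:
  assumes "f \<in> H" "g \<in> H" "h \<in> H"
  shows "ip h (\<lambda>x. f x + g x) = ip h f + ip h g"
  using ip_commute[OF add_mem[OF assms(1,2)] assms(3)] ip_add_left[OF assms]
    ip_commute[OF assms(1,3)] ip_commute[OF assms(2,3)] by simp

lemma ip_scale_right:
  assumes "f \<in> H" "g \<in> H"
  shows "ip f (\<lambda>x. c * g x) = cnj c * ip f g"
  using ip_commute[OF scale_mem[OF assms(2)] assms(1), of c] ip_scale_left[OF assms(2,1), of c]
    ip_commute[OF assms(2,1)] by simp

lemma ip_diff_left:
  assumes "f \<in> H" "g \<in> H" "h \<in> H"
  shows "ip (\<lambda>x. f x - g x) h = ip f h - ip g h"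
  using ip_add_left[OF assms(1) scale_mem[OF assms(2), of "-1"] assms(3)]
    ip_scale_left[OF assms(2,3), of "-1"] by simp

lemma ip_diff_right:
  assumes "f \<in> H" "g \<in> H" "h \<in> H"
  shows "ip h (\<lambda>x. f x - g x) = ip h f - ip h g"
  using ip_commute[OF diff_mem[OF assms(1,2)] assms(3)] ip_diff_left[OF assms]
    ip_commute[OF assms(1,3)] ip_commute[OF assms(2,3)] by simp

lemma ip_sum_left:
  assumes "finite I" "\<And>i. i \<in> I \<Longrightarrow> f i \<in> H" "g \<in> H"
  shows "ip (\<lambda>x. \<Sum>i\<in>I. f i x) g = (\<Sum>i\<in>I. ip (f i) g)"
  using assms
proof (induction I rule: finite_induct)
  case empty
  then show ?case by (simp add: ip_zero_left)
next
  case (insert i I)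
  then show ?case
    using ip_add_left[of "f i" "\<lambda>x. \<Sum>i\<in>I. f i x" g] sum_mem[of I f] by simp
qed

lemma ip_sum_right:
  assumes "finite I" "\<And>i. i \<in> I \<Longrightarrow> f i \<in> H" "g \<in> H"
  shows "ip g (\<lambda>x. \<Sum>i\<in>I. f i x) = (\<Sum>i\<in>I. ip g (f i))"
proof -
  have "ip g (\<lambda>x. \<Sum>i\<in>I. f i x) = cnj (\<Sum>i\<in>I. ip (f i) g)"
    using ip_commute[OF sum_mem[OF assms(1,2)] assms(3)] ip_sum_left[OF assms] by simp
  also have "\<dots> = (\<Sum>i\<in>I. ip g (f i))"
    unfolding cnj_sum using assms(2,3) by (intro sum.cong refl ip_commute[symmetric]) auto
  finally show ?thesis .
qed

abbreviation nrm :: "('a \<Rightarrow> complex) \<Rightarrow> real" where "nrm \<equiv> ip_norm ip"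

lemma Re_ip_self_nonneg: "f \<in> H \<Longrightarrow> 0 \<le> Re (ip f f)"
  using ip_self_pos[of f] ip_zero_left[OF zero_mem] by (cases "f = (\<lambda>x. 0)") auto

lemma nrm_nonneg: "f \<in> H \<Longrightarrow> 0 \<le> nrm f"
  by (simp add: ip_norm_def Re_ip_self_nonneg)

lemma nrm_sq: "f \<in> H \<Longrightarrow> (nrm f)\<^sup>2 = Re (ip f f)"
  by (simp add: ip_norm_def Re_ip_self_nonneg)

lemma ip_self: "f \<in> H \<Longrightarrow> ip f f = of_real ((nrm f)\<^sup>2)"
  using arg_cong[OF ip_commute[of f f], of Im] by (simp add: nrm_sq complex_eq_iff)

lemma nrm_pos: "f \<in> H \<Longrightarrow> f \<noteq> (\<lambda>x. 0) \<Longrightarrow> 0 < nrm f"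
  by (simp add: ip_norm_def ip_self_pos)

lemma nrm_zero: "nrm (\<lambda>x. 0) = 0"
  by (simp add: ip_norm_def ip_zero_left zero_mem)

lemma nrm_scale:
  assumes "f \<in> H" shows "nrm (\<lambda>x. c * f x) = cmod c * nrm f"
proof -
  have "ip (\<lambda>x. c * f x) (\<lambda>x. c * f x) = c * cnj c * ip f f"
    using assms by (simp add: ip_scale_left ip_scale_right scale_mem)
  then have "Re (ip (\<lambda>x. c * f x) (\<lambda>x. c * f x)) = (cmod c)\<^sup>2 * Re (ip f f)"
    by (simp add: complex_mult_cnj cmod_def)
  then show ?thesis by (simp add: ip_norm_def real_sqrt_mult)
qed

lemma nrm_add_sq:
  assumes "f \<in> H" "g \<in> H"
  shows "(nrm (\<lambda>x. f x + g x))\<^sup>2 = (nrm f)\<^sup>2 + (nrm g)\<^sup>2 + 2 * Re (ip f g)"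
  using assms ip_commute[OF assms]
  by (simp add: nrm_sq add_mem ip_add_left ip_add_right)

lemma nrm_diff_sq:
  assumes "f \<in> H" "g \<in> H"
  shows "(nrm (\<lambda>x. f x - g x))\<^sup>2 = (nrm f)\<^sup>2 + (nrm g)\<^sup>2 - 2 * Re (ip f g)"
  using assms ip_commute[OF assms]
  by (simp add: nrm_sq diff_mem ip_diff_left ip_diff_right)

lemma Cauchy_Schwarz:
  assumes f: "f \<in> H" and g: "g \<in> H"
  shows "cmod (ip f g) \<le> nrm f * nrm g"
proof (cases "g = (\<lambda>x. 0)")
  case True
  then show ?thesis using f by (simp add: ip_zero_right nrm_zero)
next
  case False
  define G where "G = (nrm g)\<^sup>2"
  have G: "0 < G" using nrm_pos[OF g False] by (simp add: G_def)
  define c where "c = ip f g / of_real G"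
  have cg: "(\<lambda>x. c * g x) \<in> H" by (rule scale_mem[OF g])
  have "ip f (\<lambda>x. c * g x) = of_real ((cmod (ip f g))\<^sup>2 / G)"
    unfolding ip_scale_right[OF f g] by (simp add: c_def mult.commute complex_norm_square[symmetric] del: of_real_power)
  then have "0 \<le> (nrm f)\<^sup>2 + (cmod c * nrm g)\<^sup>2 - 2 * ((cmod (ip f g))\<^sup>2 / G)"
    using nrm_diff_sq[OF f cg] zero_le_power2[of "nrm (\<lambda>x. f x - c * g x)"]
    by (simp add: nrm_scale[OF g])
  also have "(cmod c * nrm g)\<^sup>2 = (cmod (ip f g))\<^sup>2 / G"
    using G by (simp add: c_def norm_divide power_mult_distrib power_divide flip: G_def)
      (simp add: power2_eq_square)
  finally have "(cmod (ip f g))\<^sup>2 \<le> (nrm f)\<^sup>2 * G"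
    using G by (simp add: field_simps)
  then have "(cmod (ip f g))\<^sup>2 \<le> (nrm f * nrm g)\<^sup>2"
    by (simp add: G_def power_mult_distrib)
  then show ?thesis by (rule power2_le_imp_le) (simp add: nrm_nonneg f g)
qed

subsection \<open>Orthonormal systems\<close>

definition orthonormal :: "('a \<Rightarrow> complex) set \<Rightarrow> bool" where
  "orthonormal E \<longleftrightarrow> finite E \<and> E \<subseteq> H \<and> (\<forall>e\<in>E. \<forall>e'\<in>E. ip e e' = (if e = e' then 1 else 0))"

definition proj :: "('a \<Rightarrow> complex) set \<Rightarrow> ('a \<Rightarrow> complex) \<Rightarrow> 'a \<Rightarrow> complex" where
  "proj E f = (\<lambda>x. \<Sum>e\<in>E. ip f e * e x)"

lemma proj_mem: "orthonormal E \<Longrightarrow> proj E f \<in> H"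
  unfolding orthonormal_def proj_def by (intro sum_mem scale_mem) auto

lemma ip_proj_right:
  assumes "orthonormal E" "h \<in> H"
  shows "ip h (proj E f) = (\<Sum>e\<in>E. cnj (ip f e) * ip h e)"
  using assms unfolding orthonormal_def proj_def
  by (subst ip_sum_right) (auto intro!: sum.cong scale_mem simp: ip_scale_right subset_iff)

lemma ip_proj_left:
  assumes "orthonormal E" "e \<in> E"
  shows "ip (proj E f) e = ip f e"
proof -
  have E: "finite E" "E \<subseteq> H" "e \<in> H" using assms by (auto simp: orthonormal_def)
  have "ip (proj E f) e = (\<Sum>e'\<in>E. ip f e' * ip e' e)"
    unfolding proj_def using E by (subst ip_sum_left) (auto intro!: scale_mem sum.cong simp: ip_scale_left)
  also have "\<dots> = (\<Sum>e'\<in>E. if e' = e then ip f e' else 0)"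
    using assms by (intro sum.cong) (auto simp: orthonormal_def)
  also have "\<dots> = ip f e" using E assms by simp
  finally show ?thesis .
qed

lemma nrm_proj_sq:
  assumes "orthonormal E"
  shows "(nrm (proj E f))\<^sup>2 = (\<Sum>e\<in>E. (cmod (ip f e))\<^sup>2)"
proof -
  have "ip (proj E f) (proj E f) = (\<Sum>e\<in>E. cnj (ip f e) * ip f e)"
    using assms by (subst ip_proj_right) (auto simp: proj_mem ip_proj_left intro!: sum.cong)
  also have "\<dots> = of_real (\<Sum>e\<in>E. (cmod (ip f e))\<^sup>2)"
    by (simp add: mult.commute complex_norm_square[symmetric] del: of_real_power)
  finally show ?thesis by (simp add: nrm_sq proj_mem assms)
qed

lemma residual_orthogonal:
  assumes "orthonormal E" "f \<in> H" "e \<in> E"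
  shows "ip (\<lambda>x. f x - proj E f x) e = 0"
  using assms ip_diff_left[OF assms(2) proj_mem[OF assms(1)], of e]
  by (auto simp: ip_proj_left orthonormal_def)

lemma nrm_residual_sq:
  assumes "orthonormal E" "f \<in> H"
  shows "(nrm (\<lambda>x. f x - proj E f x))\<^sup>2 = (nrm f)\<^sup>2 - (\<Sum>e\<in>E. (cmod (ip f e))\<^sup>2)"
proof -
  have "ip f (proj E f) = (\<Sum>e\<in>E. of_real ((cmod (ip f e))\<^sup>2))"
    unfolding ip_proj_right[OF assms] complex_norm_square by (simp add: mult.commute)
  then have "Re (ip f (proj E f)) = (\<Sum>e\<in>E. (cmod (ip f e))\<^sup>2)" by simp
  then show ?thesis
    using nrm_diff_sq[OF assms(2) proj_mem[OF assms(1)], of f] nrm_proj_sq[OF assms(1), of f] by simp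
qed

lemma Bessel:
  assumes "orthonormal E" "f \<in> H"
  shows "(\<Sum>e\<in>E. (cmod (ip f e))\<^sup>2) \<le> (nrm f)\<^sup>2"
  using nrm_residual_sq[OF assms] zero_le_power2[of "nrm (\<lambda>x. f x - proj E f x)"] by linarith

definition combination :: "('b \<Rightarrow> 'a \<Rightarrow> complex) \<Rightarrow> 'b set \<Rightarrow> ('a \<Rightarrow> complex) \<Rightarrow> bool" where
  "combination v T f \<longleftrightarrow> (\<exists>a. f = (\<lambda>x. \<Sum>t\<in>T. a t * v t x))"

lemma combination_proj:
  assumes "\<And>e. e \<in> E \<Longrightarrow> combination v T e"
  shows "combination v T (proj E f)"
proof -
  have "\<forall>e\<in>E. \<exists>a. e = (\<lambda>x. \<Sum>t\<in>T. a t * v t x)" using assms by (auto simp: combination_def)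
  then obtain a where a: "\<And>e. e \<in> E \<Longrightarrow> e = (\<lambda>x. \<Sum>t\<in>T. a e t * v t x)" by metis
  have "proj E f x = (\<Sum>t\<in>T. (\<Sum>e\<in>E. ip f e * a e t) * v t x)" for x
  proof -
    have "e x = (\<Sum>t\<in>T. a e t * v t x)" if "e \<in> E" for e using fun_cong[OF a[OF that], of x] .
    then have "proj E f x = (\<Sum>e\<in>E. ip f e * (\<Sum>t\<in>T. a e t * v t x))" unfolding proj_def by simp
    also have "\<dots> = (\<Sum>t\<in>T. (\<Sum>e\<in>E. ip f e * a e t) * v t x)"
      unfolding sum_distrib_left sum_distrib_right by (subst sum.swap) (simp add: mult.assoc)
    finally show ?thesis .
  qed
  then show ?thesis
    unfolding combination_def by (intro exI[of _ "\<lambda>t. \<Sum>e\<in>E. ip f e * a e t"] ext)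
qed

lemma combination_insert:
  assumes "finite T" "t \<notin> T" "combination v T f"
  shows "combination v (insert t T) (\<lambda>x. c * (b * v t x - f x))"
proof -
  obtain a where a: "f = (\<lambda>x. \<Sum>s\<in>T. a s * v s x)" using assms(3) by (auto simp: combination_def)
  have "c * (b * v t x - f x) = (\<Sum>s\<in>insert t T. (if s = t then c * b else - c * a s) * v s x)" for x
  proof -
    have "(\<Sum>s\<in>T. (if s = t then c * b else - c * a s) * v s x) = (\<Sum>s\<in>T. - c * (a s * v s x))"
      using assms(2) by (intro sum.cong) auto
    then show ?thesis
      using assms(1,2) by (simp add: a sum_distrib_left sum_negf algebra_simps)
  qed
  then show ?thesis
    unfolding combination_def
    by (intro exI[of _ "\<lambda>s. if s = t then c * b else - c * a s"] ext)
qed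

text \<open>
  Gram--Schmidt orthonormalisation. Besides spanning, what is used later is that \<open>E\<close> and the
  vectors \<open>v t\<close> have the same orthogonal complement. Linear independence is expressed by
  elements \<open>f\<close> that separate each \<open>v t\<close> from the other vectors, because this is the form in
  which an interpolation property provides it.
\<close>

lemma Gram_Schmidt:
  assumes "finite T" "\<And>t. t \<in> T \<Longrightarrow> v t \<in> H"
  shows "\<exists>E. orthonormal E \<and> card E \<le> card T \<and> (\<forall>e\<in>E. combination v T e) \<and>
     (\<forall>h\<in>H. (\<forall>e\<in>E. ip h e = 0) \<longleftrightarrow> (\<forall>t\<in>T. ip h (v t) = 0)) \<and>
     ((\<forall>t\<in>T. \<exists>f\<in>H. ip f (v t) \<noteq> 0 \<and> (\<forall>s\<in>T - {t}. ip f (v s) = 0)) \<longrightarrow> card E = card T)"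
  using assms
proof (induction T rule: finite_induct)
  case empty
  show ?case by (rule exI[of _ "{}"]) (simp add: orthonormal_def)
next
  case (insert t T)
  have "\<exists>E. orthonormal E \<and> card E \<le> card T \<and> (\<forall>e\<in>E. combination v T e) \<and>
     (\<forall>h\<in>H. (\<forall>e\<in>E. ip h e = 0) \<longleftrightarrow> (\<forall>t\<in>T. ip h (v t) = 0)) \<and>
     ((\<forall>t\<in>T. \<exists>f\<in>H. ip f (v t) \<noteq> 0 \<and> (\<forall>s\<in>T - {t}. ip f (v s) = 0)) \<longrightarrow> card E = card T)"
    using insert.prems by (intro insert.IH) auto
  then obtain E where E: "orthonormal E" and cE: "card E \<le> card T"
    and comb: "\<And>e. e \<in> E \<Longrightarrow> combination v T e"
    and perp: "\<And>h. h \<in> H \<Longrightarrow> (\<forall>e\<in>E. ip h e = 0) \<longleftrightarrow> (\<forall>t\<in>T. ip h (v t) = 0)"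
    and ind: "(\<forall>t\<in>T. \<exists>f\<in>H. ip f (v t) \<noteq> 0 \<and> (\<forall>s\<in>T - {t}. ip f (v s) = 0)) \<Longrightarrow> card E = card T"
    by blast
  have vt: "v t \<in> H" and fE: "finite E" and EH: "E \<subseteq> H"
    using insert.prems E by (auto simp: orthonormal_def)
  have card_ind: "card E = card T"
    if "\<forall>t'\<in>insert t T. \<exists>f\<in>H. ip f (v t') \<noteq> 0 \<and> (\<forall>s\<in>insert t T - {t'}. ip f (v s) = 0)"
    using that by (intro ind) blast
  have comb': "\<forall>e\<in>E. combination v (insert t T) e"
  proof
    fix e assume "e \<in> E"
    from combination_insert[OF insert.hyps(1,2) comb[OF this], of "-1" 0]
    show "combination v (insert t T) e" by simp
  qed
  define w where "w = (\<lambda>x. v t x - proj E (v t) x)"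
  have w: "w \<in> H" unfolding w_def by (intro diff_mem vt proj_mem E)
  have w_perp: "ip w e = 0" "ip e w = 0" if "e \<in> E" for e
  proof -
    show *: "ip w e = 0" unfolding w_def by (rule residual_orthogonal[OF E vt that])
    show "ip e w = 0" using ip_commute[of w e] w EH that * by auto
  qed
  have ip_w: "ip h (v t) = ip h w" if h: "h \<in> H" and "\<forall>e\<in>E. ip h e = 0" for h
  proof -
    have "ip h (proj E (v t)) = 0" using that by (simp add: ip_proj_right[OF E])
    then show ?thesis unfolding w_def using ip_diff_right[OF vt proj_mem[OF E] h] by simp
  qed
  show ?case
  proof (cases "w = (\<lambda>x. 0)")
    case True
    have "ip h (v t) = 0" if "h \<in> H" "\<forall>e\<in>E. ip h e = 0" for h
      using ip_w[OF that] True that by (simp add: ip_zero_right)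
    then have "\<forall>h\<in>H. (\<forall>e\<in>E. ip h e = 0) \<longleftrightarrow> (\<forall>s\<in>insert t T. ip h (v s) = 0)"
      and "\<not> (\<exists>f\<in>H. ip f (v t) \<noteq> 0 \<and> (\<forall>s\<in>insert t T - {t}. ip f (v s) = 0))"
      using perp insert.hyps by auto
    moreover have "card E \<le> card (insert t T)" using cE insert.hyps by simp
    ultimately show ?thesis using E comb' by blast
  next
    case False
    define r where "r = nrm w"
    have r: "0 < r" using nrm_pos[OF w False] by (simp add: r_def)
    define e where "e = (\<lambda>x. of_real (1 / r) * w x)"
    have e: "e \<in> H" unfolding e_def by (rule scale_mem[OF w])
    have e_perp: "ip e e' = 0" "ip e' e = 0" if "e' \<in> E" for e'
    proof -
      have e': "e' \<in> H" using EH that by auto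
      show "ip e e' = 0" "ip e' e = 0"
        unfolding e_def ip_scale_left[OF w e'] ip_scale_right[OF e' w] by (simp_all add: w_perp[OF that])
    qed
    have "nrm e = 1"
      using r nrm_scale[OF w, of "of_real (1 / r)"] by (simp add: e_def r_def norm_divide)
    then have ee: "ip e e = 1" by (simp add: ip_self[OF e])
    have "e \<notin> E" using ee e_perp by force
    have ON: "orthonormal (insert e E)"
      using E e e_perp ee \<open>e \<notin> E\<close> by (auto simp: orthonormal_def)
    have ip_e: "ip h e = 0 \<longleftrightarrow> ip h w = 0" if "h \<in> H" for h
      using r unfolding e_def ip_scale_right[OF that w] by simp
    have perp': "\<forall>h\<in>H. (\<forall>e'\<in>insert e E. ip h e' = 0) \<longleftrightarrow> (\<forall>s\<in>insert t T. ip h (v s) = 0)"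
      using perp ip_w ip_e by auto
    have cards: "card (insert e E) = Suc (card E)" "card (insert t T) = Suc (card T)"
      using fE \<open>e \<notin> E\<close> insert.hyps by simp_all
    then have "card (insert e E) \<le> card (insert t T)" using cE by simp
    moreover have "card (insert e E) = card (insert t T)"
      if "\<forall>t'\<in>insert t T. \<exists>f\<in>H. ip f (v t') \<noteq> 0 \<and> (\<forall>s\<in>insert t T - {t'}. ip f (v s) = 0)"
      using card_ind[OF that] cards by simp
    moreover have "combination v (insert t T) e"
      using combination_insert[OF insert.hyps(1,2) combination_proj[OF comb, of E "v t"],
          of "of_real (1 / r)" 1]
      by (simp add: e_def w_def)
    ultimately show ?thesis using ON perp' comb' by blast
  qed
qed

end

subsection \<open>The Riesz representation theorem\<close>

locale hilbert_functions = inner_product_functions +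
  assumes complete: "\<And>u :: nat \<Rightarrow> 'a \<Rightarrow> complex. (\<And>n. u n \<in> H) \<Longrightarrow>
      \<forall>\<epsilon>>0. \<exists>N. \<forall>i\<ge>N. \<forall>j\<ge>N. ip_dist ip (u i) (u j) < \<epsilon> \<Longrightarrow>
      \<exists>f\<in>H. (\<lambda>n. ip_dist ip (u n) f) \<longlonglongrightarrow> 0"
begin

text \<open>
  The representing vector minimises \<open>\<parallel>f\<parallel>\<^sup>2 - 2 Re \<phi>(f)\<close>: by the parallelogram law every
  minimising sequence is Cauchy, and the first variation vanishes at its limit.
\<close>

lemma Riesz_representation:
  assumes add: "\<And>f g. f \<in> H \<Longrightarrow> g \<in> H \<Longrightarrow> \<phi> (\<lambda>x. f x + g x) = \<phi> f + \<phi> g"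
    and scale: "\<And>c f. f \<in> H \<Longrightarrow> \<phi> (\<lambda>x. c * f x) = c * \<phi> f"
    and bounded: "\<And>f. f \<in> H \<Longrightarrow> cmod (\<phi> f) \<le> C * nrm f"
  shows "\<exists>u\<in>H. \<forall>f\<in>H. \<phi> f = ip f u"
proof -
  define J where "J f = (nrm f)\<^sup>2 - 2 * Re (\<phi> f)" for f
  have J_lower: "- (C\<^sup>2) \<le> J f" if f: "f \<in> H" for f
  proof -
    have "Re (\<phi> f) \<le> C * nrm f"
      using complex_Re_le_cmod[of "\<phi> f"] bounded[OF f] by linarith
    then have "(nrm f - C)\<^sup>2 - C\<^sup>2 \<le> J f"
      by (simp add: J_def power2_eq_square algebra_simps)
    then show ?thesis using zero_le_power2[of "nrm f - C"] by linarith
  qed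
  define j where "j = Inf (J ` H)"
  have bdd: "bdd_below (J ` H)" using J_lower by (auto simp: bdd_below_def)
  have j_le: "j \<le> J f" if "f \<in> H" for f
    unfolding j_def using bdd that by (simp add: cINF_lower)
  have "\<exists>f\<in>H. J f < j + 1 / Suc n" for n
  proof -
    have "Inf (J ` H) < j + 1 / Suc n" by (simp add: j_def)
    then show ?thesis using cInf_lessD[of "J ` H"] zero_mem by auto
  qed
  then obtain u where u: "\<And>n. u n \<in> H" and Ju: "\<And>n. J (u n) < j + 1 / Suc n" by metis
  have sq: "(nrm (\<lambda>x. f x - g x))\<^sup>2 \<le> 2 * (J f - j) + 2 * (J g - j)"
    if f: "f \<in> H" and g: "g \<in> H" for f g
  proof -
    have s: "(\<lambda>x. f x + g x) \<in> H" by (rule add_mem[OF f g])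
    have h: "(\<lambda>x. (1/2) * (f x + g x)) \<in> H" by (rule scale_mem[OF s])
    have "j \<le> J (\<lambda>x. (1/2) * (f x + g x))" by (rule j_le[OF h])
    also have "\<dots> = (1/4) * (nrm (\<lambda>x. f x + g x))\<^sup>2 - Re (\<phi> f) - Re (\<phi> g)"
      unfolding J_def nrm_scale[OF s] scale[OF s] add[OF f g]
      by (simp add: power_mult_distrib norm_divide field_simps)
    finally show ?thesis
      using nrm_diff_sq[OF f g] nrm_add_sq[OF f g] unfolding J_def by argo
  qed
  have tail: "(nrm (\<lambda>x. u p x - u q x))\<^sup>2 < 4 / Suc N" if "N \<le> p" "N \<le> q" for p q N
  proof -
    have "1 / real (Suc p) \<le> 1 / Suc N" "1 / real (Suc q) \<le> 1 / Suc N"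
      using that by (auto intro!: divide_left_mono)
    then have "2 * (J (u p) - j) + 2 * (J (u q) - j) < 4 * (1 / Suc N)"
      using Ju[of p] Ju[of q] by argo
    then show ?thesis using sq[OF u u, of p q] by simp
  qed
  have "\<exists>f\<in>H. (\<lambda>n. ip_dist ip (u n) f) \<longlonglongrightarrow> 0"
  proof (rule complete[OF u], intro allI impI)
    fix \<epsilon> :: real assume e: "0 < \<epsilon>"
    obtain N where N: "inverse (Suc N) < \<epsilon>\<^sup>2 / 4" using reals_Archimedean[of "\<epsilon>\<^sup>2 / 4"] e by auto
    have "ip_dist ip (u p) (u q) < \<epsilon>" if "N \<le> p" "N \<le> q" for p q
    proof -
      have "(ip_dist ip (u p) (u q))\<^sup>2 < \<epsilon>\<^sup>2"
        unfolding ip_dist_def by (rule less_trans[OF tail[OF that]]) (use N in \<open>simp add: field_simps\<close>)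
      then show ?thesis by (rule power2_less_imp_less) (use e in simp)
    qed
    then show "\<exists>N. \<forall>i\<ge>N. \<forall>j\<ge>N. ip_dist ip (u i) (u j) < \<epsilon>" by blast
  qed
  then obtain v where v: "v \<in> H" and lim: "(\<lambda>n. ip_dist ip (u n) v) \<longlonglongrightarrow> 0" by blast
  have lim_ip: "(\<lambda>n. ip f (u n)) \<longlonglongrightarrow> ip f v" if f: "f \<in> H" for f
  proof -
    have "(\<lambda>n. nrm f * ip_dist ip (u n) v) \<longlonglongrightarrow> 0"
      using tendsto_mult_left[OF lim, of "nrm f"] by simp
    then have "(\<lambda>n. ip f (u n) - ip f v) \<longlonglongrightarrow> 0"
    proof (rule Lim_null_comparison[rotated])
      show "\<forall>\<^sub>F n in sequentially. norm (ip f (u n) - ip f v) \<le> nrm f * ip_dist ip (u n) v"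
        using Cauchy_Schwarz[OF f diff_mem[OF u v]] ip_diff_right[OF u v f]
        by (simp add: ip_dist_def)
    qed
    then show ?thesis by (rule LIM_zero_cancel)
  qed
  have Re_eq: "Re (ip f v) = Re (\<phi> f)" if f: "f \<in> H" for f
  proof -
    have var: "(Re (ip f (u n)) - Re (\<phi> f))\<^sup>2 \<le> (nrm f)\<^sup>2 / Suc n" for n
    proof (cases "f = (\<lambda>x. 0)")
      case True
      then show ?thesis using scale[OF zero_mem, of 0] u by (simp add: ip_zero_left)
    next
      case False
      define D where "D = Re (ip f (u n)) - Re (\<phi> f)"
      define t where "t = - D / (nrm f)\<^sup>2"
      have N: "0 < (nrm f)\<^sup>2" using nrm_pos[OF f False] by simp
      have tf: "(\<lambda>x. of_real t * f x) \<in> H" by (rule scale_mem[OF f])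
      have "J (\<lambda>x. u n x + of_real t * f x) = J (u n) + (t\<^sup>2 * (nrm f)\<^sup>2 + 2 * t * D)"
        unfolding J_def nrm_add_sq[OF u tf] add[OF u tf] scale[OF f] nrm_scale[OF f]
        using ip_commute[OF f u, of n]
        by (simp add: ip_scale_right f u D_def power_mult_distrib algebra_simps)
      also have "t\<^sup>2 * (nrm f)\<^sup>2 + 2 * t * D = - (D\<^sup>2) / (nrm f)\<^sup>2"
        using N by (simp add: t_def field_simps power2_eq_square)
      finally have "D\<^sup>2 / (nrm f)\<^sup>2 < 1 / Suc n"
        using j_le[OF add_mem[OF u[of n] tf]] Ju[of n] by simp
      then show ?thesis using N by (simp add: D_def field_simps)
    qed
    have "(\<lambda>n. (nrm f)\<^sup>2 * (1 / Suc n)) \<longlonglongrightarrow> (nrm f)\<^sup>2 * 0"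
      by (intro tendsto_mult_left LIMSEQ_Suc lim_1_over_n)
    moreover have "(\<lambda>n. (Re (ip f (u n)) - Re (\<phi> f))\<^sup>2) \<longlonglongrightarrow> (Re (ip f v) - Re (\<phi> f))\<^sup>2"
      by (intro tendsto_intros lim_ip f)
    ultimately have "(Re (ip f v) - Re (\<phi> f))\<^sup>2 \<le> (nrm f)\<^sup>2 * 0"
      using var by (intro LIMSEQ_le) auto
    then show ?thesis by simp
  qed
  have "\<phi> f = ip f v" if f: "f \<in> H" for f
  proof (rule complex_eqI)
    show "Re (\<phi> f) = Re (ip f v)" using Re_eq[OF f] by simp
    show "Im (\<phi> f) = Im (ip f v)"
      using Re_eq[OF scale_mem[OF f, of \<i>]] f v by (simp add: scale ip_scale_left)
  qed
  then show ?thesis using v by blast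
qed

end

section \<open>Translation invariant reproducing kernel Hilbert spaces\<close>

text \<open>
  The map \<open>a \<mapsto> a \<bar>a\<bar>\<close> turns a square integrable function into an integrable one. By this
  inequality, continuity of translations of the latter in \<open>L\<^sup>1\<close> implies continuity of
  translations of the former in \<open>L\<^sup>2\<close>.
\<close>

lemma power2_diff_le:
  fixes a b :: real
  shows "(a - b)\<^sup>2 \<le> 2 * \<bar>a * \<bar>a\<bar> - b * \<bar>b\<bar>\<bar>"
proof -
  have *: "(a - b)\<^sup>2 \<le> 2 * \<bar>a * \<bar>a\<bar> - b * \<bar>b\<bar>\<bar>" if "b \<le> a" for a b :: real
  proof -
    consider "0 \<le> b" | "a \<le> 0" | "b < 0" "0 < a" by linarith
    then have "(a - b)\<^sup>2 \<le> 2 * (a * \<bar>a\<bar> - b * \<bar>b\<bar>)"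
    proof cases
      case 1
      then have "(a - b) * (a - b) \<le> (a - b) * (2 * (a + b))"
        using that by (intro mult_left_mono) auto
      then show ?thesis using 1 that by (simp add: power2_eq_square algebra_simps)
    next
      case 2
      then have "(a - b) * (a - b) \<le> (a - b) * (- 2 * (a + b))"
        using that by (intro mult_left_mono) auto
      then show ?thesis using 2 that by (simp add: power2_eq_square algebra_simps)
    next
      case 3
      then show ?thesis
        using zero_le_power2[of "a + b"] by (simp add: power2_eq_square algebra_simps)
    qed
    then show ?thesis using abs_ge_self[of "a * \<bar>a\<bar> - b * \<bar>b\<bar>"] by (meson mult_left_mono order_trans zero_le_numeral)
  qed
  show ?thesis
    using *[of a b] *[of b a] by (cases "b \<le> a") (auto simp: power2_commute abs_minus_commute)
qed

context haar_group
begin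

lemma compact_tail:
  assumes f[measurable]: "f \<in> borel_measurable borel" and fin: "(\<integral>\<^sup>+y. f y \<partial>m) < \<infinity>" and e: "0 < e"
  shows "\<exists>K. compact K \<and> 0 \<in> K \<and> (\<integral>\<^sup>+y. f y * indicator (- K) y \<partial>m) \<le> e"
proof -
  obtain C :: "nat \<Rightarrow> 'a set" where C: "incseq C" "\<And>n. compact (C n)" "(\<Union>n. C n) = UNIV"
    using compact_exhaustion by metis
  have C'[measurable]: "C n \<in> sets borel" for n by (rule borel_compact[OF C(2)])
  have "(\<lambda>n. emeasure (density m f) (- C n)) \<longlonglongrightarrow> emeasure (density m f) (\<Inter>n. - C n)"
  proof (rule Lim_emeasure_decseq)
    show "decseq (\<lambda>n. - C n)" using C(1) by (auto simp: monotone_def)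
    show "emeasure (density m f) (- C n) \<noteq> \<infinity>" for n
    proof -
      have "emeasure (density m f) (- C n) \<le> (\<integral>\<^sup>+y. f y \<partial>m)"
        by (subst emeasure_density) (auto intro!: nn_integral_mono simp: indicator_def)
      then show ?thesis using fin by (auto simp: top_unique)
    qed
  qed auto
  moreover have "(\<Inter>n. - C n) = {}" using C(3) by blast
  ultimately have "(\<lambda>n. emeasure (density m f) (- C n)) \<longlonglongrightarrow> 0" by simp
  then have "\<forall>\<^sub>F n in sequentially. emeasure (density m f) (- C n) < e"
    using e by (rule order_tendstoD)
  then obtain n where n: "emeasure (density m f) (- C n) < e"
    using eventually_sequentially by auto
  have "(\<integral>\<^sup>+y. f y * indicator (- insert 0 (C n)) y \<partial>m) \<le> (\<integral>\<^sup>+y. f y * indicator (- C n) y \<partial>m)"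
    by (intro nn_integral_mono) (auto simp: indicator_def)
  also have "\<dots> = emeasure (density m f) (- C n)" by (subst emeasure_density) auto
  finally show ?thesis
    using n C(2) by (intro exI[of _ "insert 0 (C n)"]) (auto intro: compact_insert)
qed

end

locale translation_rkhs = unimodular_haar_group m + hilbert_functions H ip
  for m :: "'a::{topological_group_add, t2_space, second_countable_topology} measure"
    and H :: "('a \<Rightarrow> complex) set" and ip +
  fixes k :: "'a \<Rightarrow> complex"
  assumes isometric: "isometric_in_L2 m H ip"
    and translate_mem: "\<And>f x. f \<in> H \<Longrightarrow> (\<lambda>y. f (- x + y)) \<in> H"
    and k_mem: "k \<in> H"
    and k_reproduces: "\<And>f. f \<in> H \<Longrightarrow> f 0 = ip f k"
begin

lemma mem_borel: "f \<in> H \<Longrightarrow> f \<in> borel_measurable borel"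
  using isometric by (simp add: isometric_in_L2_def)

lemma square_integrable: "f \<in> H \<Longrightarrow> integrable m (\<lambda>y. (cmod (f y))\<^sup>2)"
  using isometric by (simp add: isometric_in_L2_def)

lemma nrm_L2: "f \<in> H \<Longrightarrow> (nrm f)\<^sup>2 = (\<integral>y. (cmod (f y))\<^sup>2 \<partial>m)"
  using isometric by (simp add: isometric_in_L2_def)

lemma nn_integral_square: "f \<in> H \<Longrightarrow> (\<integral>\<^sup>+y. ennreal ((cmod (f y))\<^sup>2) \<partial>m) = ennreal ((nrm f)\<^sup>2)"
  by (simp add: nn_integral_eq_integral square_integrable nrm_L2)

lemma nrm_translate:
  assumes "f \<in> H" shows "nrm (\<lambda>y. f (- x + y)) = nrm f"
proof -
  have [measurable]: "f \<in> borel_measurable borel" by (rule mem_borel[OF assms])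
  have "(nrm (\<lambda>y. f (- x + y)))\<^sup>2 = (nrm f)\<^sup>2"
    using integral_translate[of "\<lambda>y. (cmod (f y))\<^sup>2" "- x"] assms by (simp add: nrm_L2 translate_mem)
  then show ?thesis using nrm_nonneg assms translate_mem by (simp add: power2_eq_iff_nonneg)
qed

text \<open>
  Translations preserve the norm because it is the \<open>L\<^sup>2\<close> norm, hence also the inner product, by
  polarisation. It follows that the translates of \<open>k\<close> are the reproducing kernels.
\<close>

lemma ip_translate:
  assumes f: "f \<in> H" and g: "g \<in> H"
  shows "ip (\<lambda>y. f (- x + y)) (\<lambda>y. g (- x + y)) = ip f g"
proof -
  have re: "Re (ip (\<lambda>y. f (- x + y)) (\<lambda>y. g (- x + y))) = Re (ip f g)" if f: "f \<in> H" for f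
    using nrm_add_sq[OF f g] nrm_add_sq[OF translate_mem[OF f] translate_mem[OF g], of x x]
      nrm_translate[OF f, of x] nrm_translate[OF g, of x] nrm_translate[OF add_mem[OF f g], of x]
    by simp
  have "Im (ip (\<lambda>y. f (- x + y)) (\<lambda>y. g (- x + y))) = Im (ip f g)"
    using re[OF scale_mem[OF f, of "- \<i>"]]
      ip_scale_left[OF f g, of "- \<i>"] ip_scale_left[OF translate_mem[OF f] translate_mem[OF g], of "- \<i>" x x]
    by simp
  with re[OF f] show ?thesis by (rule complex_eqI)
qed

definition kern :: "'a \<Rightarrow> 'a \<Rightarrow> complex" where "kern x = (\<lambda>y. k (- x + y))"

lemma kern_mem: "kern x \<in> H"
  unfolding kern_def by (rule translate_mem[OF k_mem])

lemma nrm_kern: "nrm (kern x) = nrm k"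
  unfolding kern_def by (rule nrm_translate[OF k_mem])

lemma reproducing:
  assumes "f \<in> H" shows "ip f (kern x) = f x"
proof -
  have g: "(\<lambda>y. f (x + y)) \<in> H" using translate_mem[OF assms, of "- x"] by simp
  have "f x = ip (\<lambda>y. f (x + y)) k" using k_reproduces[OF g] by simp
  also have "\<dots> = ip f (kern x)"
    using ip_translate[OF g k_mem, of x] by (simp add: kern_def flip: add.assoc)
  finally show ?thesis by simp
qed

lemma kern_commute: "kern x y = cnj (kern y x)"
  using ip_commute[OF kern_mem kern_mem, of x y] by (simp add: reproducing kern_mem)

lemma kern_self: "kern x x = of_real ((nrm k)\<^sup>2)"
  using ip_self[OF kern_mem[of x]] by (simp add: reproducing kern_mem nrm_kern)

lemma ip_kern_left: "f \<in> H \<Longrightarrow> ip (kern x) f = cnj (f x)"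
  using ip_commute[OF _ kern_mem] by (simp add: reproducing)

lemma kern_continuous_at_0:
  assumes e: "0 < e"
  shows "\<exists>V. open V \<and> 0 \<in> V \<and> (\<forall>v\<in>V. nrm (\<lambda>y. kern v y - k y) < e)"
proof -
  define p where "p y = Re (k y) * \<bar>Re (k y)\<bar>" for y
  define q where "q y = Im (k y) * \<bar>Im (k y)\<bar>" for y
  have [measurable]: "k \<in> borel_measurable borel" by (rule mem_borel[OF k_mem])
  have p[measurable]: "p \<in> borel_measurable borel" and q[measurable]: "q \<in> borel_measurable borel"
    unfolding p_def[abs_def] q_def[abs_def] by measurable
  have int: "integrable m p" "integrable m q"
  proof -
    have "norm (p y) \<le> norm ((cmod (k y))\<^sup>2)" "norm (q y) \<le> norm ((cmod (k y))\<^sup>2)" for y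
      by (simp_all add: p_def q_def abs_mult cmod_power2 power2_eq_square[symmetric])
    then show "integrable m p" "integrable m q"
      by (auto intro!: Bochner_Integration.integrable_bound[OF square_integrable[OF k_mem]])
  qed
  define d where "d = e\<^sup>2 / 8"
  have d: "0 < d" using e by (simp add: d_def)
  obtain V where V: "open V" "0 \<in> V" "\<And>v. v \<in> V \<Longrightarrow> mean_shift p v \<le> ennreal d"
    using integrable_mean_continuous[OF int(1)] d unfolding mean_continuous_def by metis
  obtain W where W: "open W" "0 \<in> W" "\<And>v. v \<in> W \<Longrightarrow> mean_shift q v \<le> ennreal d"
    using integrable_mean_continuous[OF int(2)] d unfolding mean_continuous_def by metis
  have "nrm (\<lambda>y. kern v y - k y) < e" if v: "v \<in> V \<inter> W" for v
  proof -
    have [measurable]: "(\<lambda>y. p (- v + y)) \<in> borel_measurable borel" "(\<lambda>y. q (- v + y)) \<in> borel_measurable borel"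
      by (auto intro: shift_borel)
    have le: "(cmod (kern v y - k y))\<^sup>2 \<le> 2 * \<bar>p (- v + y) - p y\<bar> + 2 * \<bar>q (- v + y) - q y\<bar>" for y
      using power2_diff_le[of "Re (k (- v + y))" "Re (k y)"] power2_diff_le[of "Im (k (- v + y))" "Im (k y)"]
      by (simp add: cmod_power2 kern_def p_def q_def)
    have "ennreal ((nrm (\<lambda>y. kern v y - k y))\<^sup>2) = (\<integral>\<^sup>+y. ennreal ((cmod (kern v y - k y))\<^sup>2) \<partial>m)"
      by (rule nn_integral_square[symmetric]) (intro diff_mem kern_mem k_mem)
    also have "\<dots> \<le> (\<integral>\<^sup>+y. 2 * ennreal \<bar>p (- v + y) - p y\<bar> + 2 * ennreal \<bar>q (- v + y) - q y\<bar> \<partial>m)"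
    proof (rule nn_integral_mono)
      fix y
      have "ennreal ((cmod (kern v y - k y))\<^sup>2) \<le> ennreal (2 * \<bar>p (- v + y) - p y\<bar> + 2 * \<bar>q (- v + y) - q y\<bar>)"
        by (rule ennreal_leI[OF le])
      then show "ennreal ((cmod (kern v y - k y))\<^sup>2)
          \<le> 2 * ennreal \<bar>p (- v + y) - p y\<bar> + 2 * ennreal \<bar>q (- v + y) - q y\<bar>"
        by (simp add: ennreal_mult)
    qed
    also have "\<dots> = 2 * mean_shift p v + 2 * mean_shift q v"
      unfolding mean_shift_def by (simp add: nn_integral_add nn_integral_cmult)
    also have "\<dots> \<le> 2 * ennreal d + 2 * ennreal d"
      using v by (intro add_mono mult_left_mono V W) auto
    also have "\<dots> = ennreal (4 * d)"
      using d by (simp add: ennreal_mult flip: distrib_right)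
    finally have "(nrm (\<lambda>y. kern v y - k y))\<^sup>2 \<le> 4 * d" using d by simp
    also have "\<dots> < e\<^sup>2" using e by (simp add: d_def)
    finally show ?thesis by (rule power2_less_imp_less) (use e in simp)
  qed
  then show ?thesis using V W by (intro exI[of _ "V \<inter> W"]) auto
qed

text \<open>
  By translation invariance the norm of \<open>kern y - kern x\<close> depends only on \<open>x\<inverse> y\<close>, so continuity
  at the identity suffices.
\<close>

lemma k_continuous: "continuous_on UNIV k"
proof -
  have "(k \<longlongrightarrow> k x) (nhds x)" for x
  proof (rule tendstoI)
    fix e :: real assume e: "0 < e"
    define d where "d = e / (nrm k + 1)"
    have nk: "0 \<le> nrm k" by (rule nrm_nonneg[OF k_mem])
    then have d: "0 < d" using e by (simp add: d_def)
    obtain V where V: "open V" "0 \<in> V" "\<And>v. v \<in> V \<Longrightarrow> nrm (\<lambda>y. kern v y - k y) < d"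
      using kern_continuous_at_0[OF d] by blast
    have "dist (k y) (k x) < e" if y: "- x + y \<in> V" for y
    proof -
      have v: "(\<lambda>z. kern (- x + y) z - k z) \<in> H" by (intro diff_mem kern_mem k_mem)
      have "(\<lambda>z. kern y z - kern x z) = (\<lambda>z. kern (- x + y) (- x + z) - k (- x + z))"
        by (simp add: kern_def minus_add flip: add.assoc)
      then have "nrm (\<lambda>z. kern y z - kern x z) < d"
        using nrm_translate[OF v, of x] V(3)[OF y] by simp
      then have "nrm k * nrm (\<lambda>z. kern y z - kern x z) \<le> nrm k * d"
        by (intro mult_left_mono nk) simp
      moreover have "cmod (k y - k x) \<le> nrm k * nrm (\<lambda>z. kern y z - kern x z)"
        using Cauchy_Schwarz[OF k_mem diff_mem[OF kern_mem kern_mem], of y x]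
          ip_diff_right[OF kern_mem kern_mem k_mem, of y x] by (simp add: reproducing k_mem)
      moreover have "nrm k * d < e" using e nk by (simp add: d_def field_simps)
      ultimately show ?thesis by (simp add: dist_norm)
    qed
    moreover have "open ((\<lambda>y. - x + y) -` V)" by (intro open_vimage V continuous_intros)
    ultimately show "\<forall>\<^sub>F y in nhds x. dist (k y) (k x) < e"
      unfolding eventually_nhds using V(2) by (intro exI[of _ "(\<lambda>y. - x + y) -` V"]) auto
  qed
  then show ?thesis
    unfolding continuous_on_def by (auto intro: tendsto_mono[OF at_within_le_nhds])
qed

subsection \<open>Local traces\<close>

text \<open>
  For an orthonormal basis \<open>E\<close> of a subspace \<open>V\<close>, the sum of \<open>\<bar>e x\<bar>\<^sup>2\<close> over \<open>e\<close> in \<open>E\<close> is the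
  squared norm of the projection of \<open>kern x\<close> onto \<open>V\<close>. It is at most \<open>\<parallel>k\<parallel>\<^sup>2\<close> at every point, and
  its integral over the group is the dimension of \<open>V\<close>.
\<close>

lemma nn_integral_orthonormal:
  assumes E: "orthonormal E"
  shows "(\<integral>\<^sup>+x. ennreal (\<Sum>e\<in>E. (cmod (e x))\<^sup>2) \<partial>m) = of_nat (card E)"
proof -
  have EH: "e \<in> H" if "e \<in> E" for e using E that by (auto simp: orthonormal_def)
  have meas: "(\<lambda>x. ennreal ((cmod (e x))\<^sup>2)) \<in> borel_measurable m" if "e \<in> E" for e
    using mem_borel[OF EH[OF that]] by simp
  have one: "(nrm e)\<^sup>2 = 1" if "e \<in> E" for e
    using that EH[OF that] E by (simp add: nrm_sq orthonormal_def)
  have "(\<integral>\<^sup>+x. ennreal (\<Sum>e\<in>E. (cmod (e x))\<^sup>2) \<partial>m) = (\<integral>\<^sup>+x. (\<Sum>e\<in>E. ennreal ((cmod (e x))\<^sup>2)) \<partial>m)"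
    by simp
  also have "\<dots> = (\<Sum>e\<in>E. (\<integral>\<^sup>+x. ennreal ((cmod (e x))\<^sup>2) \<partial>m))"
    using meas by (rule nn_integral_sum)
  also have "\<dots> = (\<Sum>e\<in>E. 1)"
    by (intro sum.cong) (simp_all add: nn_integral_square EH one)
  finally show ?thesis by simp
qed

lemma orthonormal_sum_eq:
  assumes E: "orthonormal E"
  shows "(\<Sum>e\<in>E. (cmod (e x))\<^sup>2) = (\<Sum>e\<in>E. (cmod (ip (kern x) e))\<^sup>2)"
  using E by (intro sum.cong) (auto simp: orthonormal_def ip_kern_left)

lemma orthonormal_sum_le:
  assumes E: "orthonormal E"
  shows "(\<Sum>e\<in>E. (cmod (e x))\<^sup>2) \<le> (nrm k)\<^sup>2"
  unfolding orthonormal_sum_eq[OF E] using Bessel[OF E kern_mem[of x]] by (simp add: nrm_kern)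

end

section \<open>Interpolation\<close>

text \<open>
  A constructive form of the uniform boundedness principle on \<open>\<ell>\<^sup>2\<close> for the functionals
  \<open>c \<mapsto> \<langle>c, u n\<rangle>\<close>: the sequence \<open>c\<close> is a sum of \<open>\<plusminus> 3\<^sup>-\<^sup>n u n\<close>. Each sign is chosen so that the
  \<open>n\<close>-th functional is at least \<open>3\<^sup>-\<^sup>n\<close> on the partial sum up to \<open>n\<close>, and the later terms can
  change this value by at most \<open>3\<^sup>-\<^sup>n/2\<close>.
\<close>

lemma gliding_hump:
  fixes u :: "nat \<Rightarrow> 'b \<Rightarrow> complex"
  assumes fin: "\<And>n. finite (T n)" and unit: "\<And>n. (\<Sum>t\<in>T n. (cmod (u n t))\<^sup>2) = 1"
    and supp: "\<And>n t. t \<notin> T n \<Longrightarrow> u n t = 0"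
  shows "\<exists>c. (\<lambda>t. (cmod (c t))\<^sup>2) summable_on UNIV \<and>
    (\<forall>n. (1/3) ^ n / 2 \<le> cmod (\<Sum>t\<in>T n. c t * cnj (u n t)))"
proof -
  define L where "L n c = (\<Sum>t\<in>T n. c t * cnj (u n t))" for n and c :: "'b \<Rightarrow> complex"
  define r :: "nat \<Rightarrow> real" where "r n = (1/3) ^ n" for n
  have r: "0 < r n" "r (Suc n) = r n / 3" for n by (simp_all add: r_def)
  have u_le: "(\<Sum>t\<in>S. (cmod (u n t))\<^sup>2) \<le> 1" if "finite S" for S n
  proof -
    have "(\<Sum>t\<in>S. (cmod (u n t))\<^sup>2) = (\<Sum>t\<in>S \<inter> T n. (cmod (u n t))\<^sup>2)"
      using that supp by (intro sum.mono_neutral_right) auto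
    also have "\<dots> \<le> (\<Sum>t\<in>T n. (cmod (u n t))\<^sup>2)"
      using fin by (intro sum_mono2) auto
    finally show ?thesis by (simp add: unit)
  qed
  have L_diag: "L n (u n) = 1" for n
  proof -
    have "L n (u n) = of_real (\<Sum>t\<in>T n. (cmod (u n t))\<^sup>2)"
      unfolding L_def of_real_sum by (intro sum.cong refl) (simp only: complex_norm_square)
    then show ?thesis by (simp add: unit)
  qed
  have L_le: "cmod (L n (u j)) \<le> 1" for n j
  proof -
    have "cmod (L n (u j)) \<le> (\<Sum>t\<in>T n. cmod (u j t) * cmod (u n t))"
      unfolding L_def by (rule order_trans[OF norm_sum]) (simp add: norm_mult)
    also have "\<dots> \<le> (\<Sum>t\<in>T n. ((cmod (u j t))\<^sup>2 + (cmod (u n t))\<^sup>2) / 2)"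
    proof (rule sum_mono)
      fix t
      show "cmod (u j t) * cmod (u n t) \<le> ((cmod (u j t))\<^sup>2 + (cmod (u n t))\<^sup>2) / 2"
        using sum_squares_bound[of "cmod (u j t)" "cmod (u n t)"] by simp
    qed
    also have "\<dots> = ((\<Sum>t\<in>T n. (cmod (u j t))\<^sup>2) + (\<Sum>t\<in>T n. (cmod (u n t))\<^sup>2)) / 2"
      by (simp add: sum.distrib flip: sum_divide_distrib)
    also have "\<dots> \<le> 1" using u_le[OF fin, of j n] unit[of n] by simp
    finally show ?thesis .
  qed
  have L_add: "L n (\<lambda>t. x t + w * u j t) = L n x + w * L n (u j)" for n x w j
    by (simp add: L_def distrib_right sum.distrib sum_distrib_left mult.assoc)
  \<comment> \<open>One of \<open>z + r\<close> and \<open>z - r\<close> has modulus at least \<open>r\<close>.\<close>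
  define sg :: "nat \<Rightarrow> ('b \<Rightarrow> complex) \<Rightarrow> complex" where
    "sg n x = (if r n \<le> cmod (L n x + of_real (r n)) then 1 else -1)" for n x
  define x where "x = rec_nat (\<lambda>t. 0) (\<lambda>n x t. x t + sg n x * of_real (r n) * u n t)"
  have x0: "x 0 = (\<lambda>t. 0)" and xS: "x (Suc n) = (\<lambda>t. x n t + sg n (x n) * of_real (r n) * u n t)" for n
    by (simp_all add: x_def)
  have sg: "cmod (sg n y) = 1" for n y by (simp add: sg_def)
  have hump: "r n \<le> cmod (L n (x (Suc n)))" for n
  proof -
    have "2 * r n \<le> cmod (L n (x n) + of_real (r n)) + cmod (L n (x n) - of_real (r n))"
      using norm_triangle_ineq4[of "L n (x n) + of_real (r n)" "L n (x n) - of_real (r n)"] r(1)[of n]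
      by (simp add: norm_mult flip: mult_2)
    then show ?thesis
      unfolding xS L_add L_diag by (auto simp: sg_def)
  qed
  \<comment> \<open>The bound is the sum of \<open>r j\<close> over \<open>n < j < m\<close> in closed form.\<close>
  have tail: "cmod (L n (x m) - L n (x (Suc n))) \<le> r n / 2 - 3 / 2 * r m" if "Suc n \<le> m" for n m
    using that
  proof (induction m rule: dec_induct)
    case base
    then show ?case by (simp add: r(2))
  next
    case (step m)
    have "cmod (L n (x (Suc m)) - L n (x m)) \<le> r m"
      unfolding xS L_add using mult_left_mono[OF L_le[of n m], of "r m"] r(1)[of m]
      by (simp add: norm_mult sg)
    then show ?case
      using step.IH norm_triangle_ineq[of "L n (x (Suc m)) - L n (x m)" "L n (x m) - L n (x (Suc n))"]
      by (simp add: r(2))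
  qed
  have L2: "L2_set (\<lambda>t. cmod (x n t)) S \<le> 3 / 2 - 3 / 2 * r n" if S: "finite S" for n S
  proof (induction n)
    case 0
    then show ?case by (simp add: x0 r_def L2_set_def)
  next
    case (Suc n)
    have "L2_set (\<lambda>t. cmod (x (Suc n) t)) S \<le> L2_set (\<lambda>t. cmod (x n t) + r n * cmod (u n t)) S"
    proof (rule L2_set_mono)
      fix t
      show "cmod (x (Suc n) t) \<le> cmod (x n t) + r n * cmod (u n t)"
        unfolding xS using r(1)[of n] by (rule_tac order_trans[OF norm_triangle_ineq]) (simp add: norm_mult sg)
    qed simp
    also have "\<dots> \<le> L2_set (\<lambda>t. cmod (x n t)) S + L2_set (\<lambda>t. r n * cmod (u n t)) S"
      by (rule L2_set_triangle_ineq)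
    also have "L2_set (\<lambda>t. r n * cmod (u n t)) S = r n * L2_set (\<lambda>t. cmod (u n t)) S"
      using r(1)[of n] by (simp add: L2_set_right_distrib)
    also have "\<dots> \<le> r n * 1"
      using u_le[OF S, of n] r(1)[of n] by (intro mult_left_mono) (simp_all add: L2_set_def)
    finally show ?case using Suc by (simp add: r(2))
  qed
  have "convergent (\<lambda>n. x n t)" for t
  proof -
    have "cmod (u n t) \<le> 1" for n using u_le[of "{t}" n] by (simp add: power_le_one_iff abs_square_le_1)
    then have "norm (x (Suc n) t - x n t) \<le> r n" for n
      using mult_left_mono[of "cmod (u n t)" 1 "r n"] r(1)[of n] by (simp add: xS norm_mult sg)
    moreover have "summable r" unfolding r_def[abs_def] by (rule summable_geometric) simp
    ultimately have "summable (\<lambda>n. x (Suc n) t - x n t)"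
      by (intro summable_comparison_test[OF _ \<open>summable r\<close>]) auto
    then have "convergent (\<lambda>n. \<Sum>i<n. x (Suc i) t - x i t)" by (simp add: summable_iff_convergent)
    then show ?thesis using sum_lessThan_telescope[of "\<lambda>n. x n t"] by (simp add: x0)
  qed
  then obtain c where c: "\<And>t. (\<lambda>n. x n t) \<longlonglongrightarrow> c t" unfolding convergent_def by metis
  have sum_le: "(\<Sum>t\<in>S. (cmod (c t))\<^sup>2) \<le> (3 / 2)\<^sup>2" if S: "finite S" for S
  proof (rule LIMSEQ_le_const2)
    show "(\<lambda>n. \<Sum>t\<in>S. (cmod (x n t))\<^sup>2) \<longlonglongrightarrow> (\<Sum>t\<in>S. (cmod (c t))\<^sup>2)"
      by (intro tendsto_intros c)
    have "(\<Sum>t\<in>S. (cmod (x n t))\<^sup>2) \<le> (3 / 2)\<^sup>2" for n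
    proof -
      have "L2_set (\<lambda>t. cmod (x n t)) S \<le> 3 / 2" using L2[OF S, of n] r(1)[of n] by simp
      then have "(L2_set (\<lambda>t. cmod (x n t)) S)\<^sup>2 \<le> (3 / 2)\<^sup>2"
        by (intro power_mono L2_set_nonneg)
      then show ?thesis by (simp add: L2_set_def sum_nonneg)
    qed
    then show "\<exists>N. \<forall>n\<ge>N. (\<Sum>t\<in>S. (cmod (x n t))\<^sup>2) \<le> (3 / 2)\<^sup>2" by blast
  qed
  have "(\<lambda>t. (cmod (c t))\<^sup>2) summable_on UNIV"
    by (rule nonneg_bdd_above_summable_on) (auto intro!: bdd_aboveI2[where M = "(3 / 2)\<^sup>2"] sum_le)
  moreover have "r n / 2 \<le> cmod (L n c)" for n
  proof (rule LIMSEQ_le_const)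
    show "(\<lambda>m. cmod (L n (x m))) \<longlonglongrightarrow> cmod (L n c)"
      unfolding L_def by (intro tendsto_intros c)
    have "r n / 2 \<le> cmod (L n (x m))" if "Suc n \<le> m" for m
      using tail[OF that] hump[of n] r(1)[of m]
        norm_triangle_ineq2[of "L n (x (Suc n))" "L n (x m)"] norm_minus_commute[of "L n (x m)" "L n (x (Suc n))"]
      by linarith
    then show "\<exists>N. \<forall>m\<ge>N. r n / 2 \<le> cmod (L n (x m))" by blast
  qed
  ultimately show ?thesis unfolding L_def r_def by blast
qed

context translation_rkhs
begin

text \<open>
  The kernels at the points of an interpolation set satisfy the lower inequality of a Riesz
  sequence. Otherwise there are finitely supported unit vectors \<open>u n\<close> whose combinations
  \<open>g n\<close> of kernels have norm below \<open>4\<^sup>-\<^sup>n\<close>. An \<open>f\<close> interpolating the sequence \<open>c\<close> of the gliding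
  hump satisfies \<open>\<langle>f, g n\<rangle> = \<langle>c, u n\<rangle>\<close>, which is at least \<open>3\<^sup>-\<^sup>n/2\<close> in modulus, and this
  contradicts the Cauchy--Schwarz inequality for large \<open>n\<close>.
\<close>

lemma interpolation_lower_bound:
  assumes \<Lambda>: "interpolation_set H \<Lambda>"
  shows "\<exists>C>0. \<forall>T a. finite T \<longrightarrow> T \<subseteq> \<Lambda> \<longrightarrow>
    (\<Sum>t\<in>T. (cmod (a t))\<^sup>2) \<le> C * (nrm (\<lambda>x. \<Sum>t\<in>T. a t * kern t x))\<^sup>2"
proof (rule ccontr)
  assume contra: "\<not> ?thesis"
  define P where "P n T a \<longleftrightarrow> finite T \<and> T \<subseteq> \<Lambda> \<and>
      16 ^ n * (nrm (\<lambda>x. \<Sum>t\<in>T. a t * kern t x))\<^sup>2 < (\<Sum>t\<in>T. (cmod (a t))\<^sup>2)" for n :: nat and T a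
  have "\<exists>T a. P n T a" for n
  proof -
    have "0 < (16::real) ^ n" by simp
    then show ?thesis using contra unfolding P_def by (meson not_le)
  qed
  then obtain T a where P: "\<And>n. P n (T n) (a n)" by metis
  have T: "finite (T n)" "T n \<subseteq> \<Lambda>"
    and big: "16 ^ n * (nrm (\<lambda>x. \<Sum>t\<in>T n. a n t * kern t x))\<^sup>2 < (\<Sum>t\<in>T n. (cmod (a n t))\<^sup>2)" for n
    using P[of n] by (auto simp: P_def)
  define s where "s n = (\<Sum>t\<in>T n. (cmod (a n t))\<^sup>2)" for n
  have s: "0 < s n" for n
    unfolding s_def by (rule le_less_trans[OF _ big[of n]]) simp
  define u where "u n t = (if t \<in> T n then a n t / of_real (sqrt (s n)) else 0)" for n t
  define g where "g n = (\<lambda>x. \<Sum>t\<in>T n. u n t * kern t x)" for n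
  have "(\<Sum>t\<in>T n. (cmod (u n t))\<^sup>2) = 1" for n
  proof -
    have "(\<Sum>t\<in>T n. (cmod (u n t))\<^sup>2) = (\<Sum>t\<in>T n. (cmod (a n t))\<^sup>2 / s n)"
      using s[of n] by (intro sum.cong) (auto simp: u_def norm_divide power_divide)
    also have "\<dots> = 1" using s[of n] by (simp add: s_def flip: sum_divide_distrib)
    finally show ?thesis .
  qed
  then obtain c where c: "(\<lambda>t. (cmod (c t))\<^sup>2) summable_on UNIV"
    and hump: "\<And>n. (1/3) ^ n / 2 \<le> cmod (\<Sum>t\<in>T n. c t * cnj (u n t))"
    using gliding_hump[of T u] T(1) by (auto simp: u_def)
  have "(\<lambda>t. (cmod (c t))\<^sup>2) summable_on \<Lambda>" by (rule summable_on_subset_banach[OF c]) simp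
  then obtain f where f: "f \<in> H" "\<And>l. l \<in> \<Lambda> \<Longrightarrow> f l = c l"
    using \<Lambda> unfolding interpolation_set_def by blast
  have gH: "g n \<in> H" for n unfolding g_def by (intro sum_mem scale_mem kern_mem T)
  have "(4/3) ^ n \<le> 2 * nrm f" for n
  proof -
    have "(nrm (g n))\<^sup>2 \<le> (1/16) ^ n"
    proof -
      have S: "(\<lambda>x. \<Sum>t\<in>T n. a n t * kern t x) \<in> H" by (intro sum_mem scale_mem kern_mem T)
      have "g n = (\<lambda>x. of_real (1 / sqrt (s n)) * (\<Sum>t\<in>T n. a n t * kern t x))"
        unfolding g_def sum_distrib_left by (intro ext sum.cong) (auto simp: u_def)
      then have "(nrm (g n))\<^sup>2 = (nrm (\<lambda>x. \<Sum>t\<in>T n. a n t * kern t x))\<^sup>2 / s n"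
        using s[of n] by (simp only: nrm_scale[OF S]) (simp add: norm_divide power_divide)
      also have "\<dots> \<le> (1/16) ^ n"
        using big[of n] s[of n] by (simp add: s_def[symmetric] field_simps power_one_over)
      finally show ?thesis .
    qed
    also have "(1/16) ^ n = ((1/4::real) ^ n)\<^sup>2" by (simp add: power2_eq_square flip: power_mult_distrib)
    finally have g_le: "nrm (g n) \<le> (1/4) ^ n" by (rule power2_le_imp_le) simp
    have "ip f (g n) = (\<Sum>t\<in>T n. cnj (u n t) * f t)"
      unfolding g_def using f T
      by (subst ip_sum_right) (auto intro!: sum.cong scale_mem simp: kern_mem ip_scale_right reproducing)
    also have "\<dots> = (\<Sum>t\<in>T n. c t * cnj (u n t))"
      using f(2) T(2)[of n] by (intro sum.cong) (auto simp: mult.commute)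
    finally have "(1/3) ^ n / 2 \<le> nrm f * nrm (g n)"
      using hump[of n] Cauchy_Schwarz[OF f(1) gH, of n] by simp
    also have "\<dots> \<le> nrm f * (1/4) ^ n" by (intro mult_left_mono g_le nrm_nonneg f)
    finally show ?thesis by (simp add: field_simps power_divide)
  qed
  moreover obtain n where "2 * nrm f < (4/3) ^ n" using real_arch_pow[of "4/3" "2 * nrm f"] by auto
  ultimately show False by (meson not_le)
qed

text \<open>
  Let \<open>V\<close> be the span of the kernels at the points of \<open>T\<close>; its dimension is the cardinality of
  \<open>T\<close>, which is the integral of the local trace \<open>\<rho>\<close> of \<open>V\<close>. On \<open>x F K\<close> the trace is at most \<open>\<parallel>k\<parallel>\<^sup>2\<close>.
  Elsewhere the Riesz sequence inequality bounds it by \<open>C\<close> times the sum of \<open>\<bar>kern t y\<bar>\<^sup>2\<close>, and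
  each of these kernels is small in \<open>L\<^sup>2\<close> outside \<open>t K\<close>, which is contained in \<open>x F K\<close>.
\<close>

lemma interpolation_card_le:
  assumes bound: "\<And>a. (\<Sum>t\<in>T. (cmod (a t))\<^sup>2) \<le> C * (nrm (\<lambda>x. \<Sum>t\<in>T. a t * kern t x))\<^sup>2"
    and separating: "\<And>t. t \<in> T \<Longrightarrow> \<exists>f\<in>H. f t \<noteq> 0 \<and> (\<forall>s\<in>T - {t}. f s = 0)"
    and C: "0 \<le> C" and T: "finite T" "T \<subseteq> (+) x ` F" and F: "compact F" and K: "compact K"
    and tail: "(\<integral>\<^sup>+y. ennreal ((cmod (k y))\<^sup>2) * indicator (- K) y \<partial>m) \<le> ennreal \<delta>" and \<delta>: "0 \<le> \<delta>"
  shows "of_nat (card T) \<le> ennreal ((nrm k)\<^sup>2) * emeasure m (F + K) + ennreal (C * \<delta>) * of_nat (card T)"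
proof -
  have sep: "\<forall>t\<in>T. \<exists>f\<in>H. ip f (kern t) \<noteq> 0 \<and> (\<forall>s\<in>T - {t}. ip f (kern s) = 0)"
  proof
    fix t assume "t \<in> T"
    then obtain f where "f \<in> H" "f t \<noteq> 0" "\<forall>s\<in>T - {t}. f s = 0" using separating by blast
    then show "\<exists>f\<in>H. ip f (kern t) \<noteq> 0 \<and> (\<forall>s\<in>T - {t}. ip f (kern s) = 0)"
      by (intro bexI[of _ f]) (auto simp: reproducing)
  qed
  obtain E where E: "orthonormal E" and comb: "\<forall>e\<in>E. combination kern T e"
    and perp_kern: "\<forall>h\<in>H. (\<forall>e\<in>E. ip h e = 0) \<longleftrightarrow> (\<forall>t\<in>T. ip h (kern t) = 0)"
    and card: "card E = card T"
    using Gram_Schmidt[of T kern, OF T(1) kern_mem] sep by blast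
  have perp: "(\<forall>e\<in>E. ip h e = 0) \<longleftrightarrow> (\<forall>t\<in>T. h t = 0)" if "h \<in> H" for h
    using perp_kern that by (simp add: reproducing)
  define \<rho> where "\<rho> y = (\<Sum>e\<in>E. (cmod (e y))\<^sup>2)" for y
  \<comment> \<open>The projection of \<open>kern y\<close> onto \<open>V\<close> takes the same values on \<open>T\<close> as \<open>kern y\<close> itself.\<close>
  have \<rho>_le: "\<rho> y \<le> C * (\<Sum>t\<in>T. (cmod (kern t y))\<^sup>2)" for y
  proof -
    define h where "h = proj E (kern y)"
    have h: "h \<in> H" unfolding h_def by (rule proj_mem[OF E])
    have nh: "(nrm h)\<^sup>2 = \<rho> y"
      unfolding h_def nrm_proj_sq[OF E] \<rho>_def orthonormal_sum_eq[OF E] ..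
    have ht: "h t = kern y t" if "t \<in> T" for t
    proof -
      have "(\<lambda>z. kern y z - h z) \<in> H" by (intro diff_mem kern_mem h)
      moreover have "\<forall>e\<in>E. ip (\<lambda>z. kern y z - h z) e = 0"
        unfolding h_def using residual_orthogonal[OF E kern_mem] by blast
      ultimately show ?thesis using perp that by force
    qed
    obtain a where a: "h = (\<lambda>z. \<Sum>t\<in>T. a t * kern t z)"
      using combination_proj[of E kern T "kern y"] comb unfolding combination_def h_def by blast
    have "ip h (\<lambda>z. \<Sum>t\<in>T. a t * kern t z) = (\<Sum>t\<in>T. cnj (a t) * h t)"
      using h T by (subst ip_sum_right) (auto intro!: sum.cong scale_mem simp: kern_mem ip_scale_right reproducing)
    then have "ip h h = (\<Sum>t\<in>T. cnj (a t) * h t)" using a by simp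
    moreover have "cmod (ip h h) = (nrm h)\<^sup>2" by (simp add: ip_self[OF h] norm_power)
    ultimately have "(nrm h)\<^sup>2 = cmod (\<Sum>t\<in>T. cnj (a t) * h t)" by simp
    also have "\<dots> \<le> (\<Sum>t\<in>T. \<bar>cmod (a t)\<bar> * \<bar>cmod (h t)\<bar>)"
      by (rule order_trans[OF norm_sum]) (simp add: norm_mult)
    also have "\<dots> \<le> L2_set (\<lambda>t. cmod (a t)) T * L2_set (\<lambda>t. cmod (h t)) T"
      by (rule L2_set_mult_ineq)
    finally have "((nrm h)\<^sup>2)\<^sup>2 \<le> (L2_set (\<lambda>t. cmod (a t)) T * L2_set (\<lambda>t. cmod (h t)) T)\<^sup>2"
      by (rule power_mono) simp
    also have "\<dots> = (\<Sum>t\<in>T. (cmod (a t))\<^sup>2) * (\<Sum>t\<in>T. (cmod (h t))\<^sup>2)"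
      by (simp add: power_mult_distrib L2_set_def sum_nonneg)
    also have "\<dots> \<le> C * (nrm h)\<^sup>2 * (\<Sum>t\<in>T. (cmod (h t))\<^sup>2)"
      using bound[of a] a by (intro mult_right_mono sum_nonneg) auto
    finally have sq: "(nrm h)\<^sup>2 * (nrm h)\<^sup>2 \<le> (nrm h)\<^sup>2 * (C * (\<Sum>t\<in>T. (cmod (h t))\<^sup>2))"
      by (simp only: power2_eq_square ac_simps)
    have "(nrm h)\<^sup>2 \<le> C * (\<Sum>t\<in>T. (cmod (h t))\<^sup>2)"
    proof (cases "nrm h = 0")
      case True
      then show ?thesis using C by (simp add: sum_nonneg)
    next
      case False
      then have "0 < (nrm h)\<^sup>2" by simp
      with sq show ?thesis by (simp only: mult_le_cancel_left_pos)
    qed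
    also have "(\<Sum>t\<in>T. (cmod (h t))\<^sup>2) = (\<Sum>t\<in>T. (cmod (kern t y))\<^sup>2)"
      using ht by (intro sum.cong refl) (metis complex_mod_cnj kern_commute)
    finally show ?thesis by (simp add: nh)
  qed
  define Y where "Y = (+) x ` (F + K)"
  have FK: "compact (F + K)" by (rule compact_set_plus[OF F K])
  have "Y = (\<lambda>y. x + y) ` (F + K)" by (simp add: Y_def)
  then have Y[measurable]: "Y \<in> sets borel"
    using FK by (auto intro!: borel_compact compact_continuous_image continuous_intros)
  have kb[measurable]: "k \<in> borel_measurable borel" by (rule mem_borel[OF k_mem])
  have Kb[measurable]: "K \<in> sets borel" by (rule borel_compact[OF K])
  define \<tau> where "\<tau> y = ennreal ((cmod (k y))\<^sup>2) * indicator (- K) y" for y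
  have \<tau>[measurable]: "\<tau> \<in> borel_measurable borel" unfolding \<tau>_def[abs_def] by measurable
  have pointwise: "ennreal (\<rho> y) \<le> ennreal ((nrm k)\<^sup>2) * indicator Y y + ennreal C * (\<Sum>t\<in>T. \<tau> (- t + y))" for y
  proof (cases "y \<in> Y")
    case True
    have "ennreal (\<rho> y) \<le> ennreal ((nrm k)\<^sup>2)"
      unfolding \<rho>_def by (intro ennreal_leI orthonormal_sum_le E)
    then show ?thesis using True by (simp add: add_increasing2)
  next
    case False
    have "- t + y \<notin> K" if t: "t \<in> T" for t
    proof
      assume K: "- t + y \<in> K"
      obtain f where f: "f \<in> F" "t = x + f" using t T(2) by auto
      have "y = x + (f + (- t + y))" by (simp add: f(2) minus_add add.assoc del: add_uminus_conv_diff)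
      then show False using False K f(1) unfolding Y_def by (metis imageI set_plus_intro)
    qed
    then have "(\<Sum>t\<in>T. \<tau> (- t + y)) = (\<Sum>t\<in>T. ennreal ((cmod (kern t y))\<^sup>2))"
      by (intro sum.cong) (auto simp: \<tau>_def kern_def)
    also have "\<dots> = ennreal (\<Sum>t\<in>T. (cmod (kern t y))\<^sup>2)" by simp
    finally have "ennreal C * (\<Sum>t\<in>T. \<tau> (- t + y)) = ennreal (C * (\<Sum>t\<in>T. (cmod (kern t y))\<^sup>2))"
      using C by (simp add: ennreal_mult sum_nonneg)
    then show ?thesis using ennreal_leI[OF \<rho>_le[of y]] False by simp
  qed
  have \<tau>t[measurable]: "(\<lambda>y. \<tau> (- t + y)) \<in> borel_measurable borel" for t by (rule shift_borel[OF \<tau>])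
  have "of_nat (card T) = (\<integral>\<^sup>+y. ennreal (\<rho> y) \<partial>m)"
    using nn_integral_orthonormal[OF E] card by (simp add: \<rho>_def)
  also have "\<dots> \<le> (\<integral>\<^sup>+y. ennreal ((nrm k)\<^sup>2) * indicator Y y + ennreal C * (\<Sum>t\<in>T. \<tau> (- t + y)) \<partial>m)"
    by (intro nn_integral_mono pointwise)
  also have "\<dots> = ennreal ((nrm k)\<^sup>2) * emeasure m Y + ennreal C * (\<Sum>t\<in>T. (\<integral>\<^sup>+y. \<tau> (- t + y) \<partial>m))"
    by (simp add: nn_integral_add nn_integral_cmult nn_integral_sum)
  also have "(\<Sum>t\<in>T. (\<integral>\<^sup>+y. \<tau> (- t + y) \<partial>m)) = (\<Sum>t\<in>T. (\<integral>\<^sup>+y. \<tau> y \<partial>m))"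
    by (intro sum.cong refl nn_integral_translate \<tau>)
  also have "\<dots> \<le> (\<Sum>t\<in>T. ennreal \<delta>)"
    using tail by (intro sum_mono) (simp add: \<tau>_def[abs_def])
  also have "emeasure m Y = emeasure m (F + K)"
    unfolding Y_def using FK by (intro emeasure_translate borel_compact)
  finally show ?thesis
    using C \<delta> by (simp add: ennreal_mult mult.assoc mult.commute[of "ennreal \<delta>"] add_left_mono mult_left_mono)
qed

end

section \<open>Sampling\<close>

locale sampling_rkhs = translation_rkhs +
  fixes \<Lambda> :: "'a set" and A B :: real
  assumes A: "0 < A" and B: "0 \<le> B"
    and square_summable: "\<And>f. f \<in> H \<Longrightarrow> (\<lambda>l. (cmod (f l))\<^sup>2) summable_on \<Lambda>"
    and frame_lower: "\<And>f. f \<in> H \<Longrightarrow> A * (nrm f)\<^sup>2 \<le> (\<Sum>\<^sub>\<infinity>l\<in>\<Lambda>. (cmod (f l))\<^sup>2)"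
    and frame_upper: "\<And>f. f \<in> H \<Longrightarrow> (\<Sum>\<^sub>\<infinity>l\<in>\<Lambda>. (cmod (f l))\<^sup>2) \<le> B * (nrm f)\<^sup>2"
begin

lemma finite_square_sum_le:
  assumes "f \<in> H" "finite G" "G \<subseteq> \<Lambda>"
  shows "(\<Sum>l\<in>G. (cmod (f l))\<^sup>2) \<le> B * (nrm f)\<^sup>2"
proof -
  have "(\<Sum>l\<in>G. (cmod (f l))\<^sup>2) \<le> (\<Sum>\<^sub>\<infinity>l\<in>\<Lambda>. (cmod (f l))\<^sup>2)"
    using assms by (intro finite_sum_le_infsum square_summable) auto
  then show ?thesis using frame_upper[OF assms(1)] by linarith
qed

text \<open>
  By the sampling inequalities this is an inner product on \<open>H\<close> with an equivalent norm. Riesz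
  representation with respect to it replaces the inverse of the frame operator: \<open>skern x\<close> is the
  kernel of \<open>H\<close> under \<open>sip\<close>, and for \<open>l\<close> in \<open>\<Lambda>\<close> it is the canonical dual frame element at \<open>l\<close>.
\<close>

definition sip :: "('a \<Rightarrow> complex) \<Rightarrow> ('a \<Rightarrow> complex) \<Rightarrow> complex" where
  "sip f g = (\<Sum>\<^sub>\<infinity>l\<in>\<Lambda>. f l * cnj (g l))"

lemma product_summable:
  assumes "f \<in> H" "g \<in> H"
  shows "(\<lambda>l. f l * cnj (g l)) summable_on \<Lambda>"
proof (rule abs_summable_summable, rule abs_summable_product)
  show "(\<lambda>l. norm (f l * f l)) summable_on \<Lambda>"
    using square_summable[OF assms(1)] by (simp add: norm_mult power2_eq_square)
  show "(\<lambda>l. norm (cnj (g l) * cnj (g l))) summable_on \<Lambda>"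
    using square_summable[OF assms(2)] by (simp add: norm_mult power2_eq_square)
qed

lemma Re_sip_self:
  assumes "f \<in> H" shows "Re (sip f f) = (\<Sum>\<^sub>\<infinity>l\<in>\<Lambda>. (cmod (f l))\<^sup>2)"
proof -
  have "Re (sip f f) = (\<Sum>\<^sub>\<infinity>l\<in>\<Lambda>. Re (f l * cnj (f l)))"
    unfolding sip_def by (rule infsum_Re[OF product_summable[OF assms assms], symmetric])
  also have "\<dots> = (\<Sum>\<^sub>\<infinity>l\<in>\<Lambda>. (cmod (f l))\<^sup>2)"
    by (intro infsum_cong) (simp add: complex_norm_square[symmetric] del: of_real_power)
  finally show ?thesis .
qed

lemma sip_inner_product_space: "function_inner_product_space H sip"
  unfolding function_inner_product_space_def
proof (intro conjI ballI allI impI)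
  fix f g h :: "'a \<Rightarrow> complex" and c :: complex
  assume f: "f \<in> H"
  show "0 < Re (sip f f)" if "f \<noteq> (\<lambda>x. 0)"
  proof -
    have "0 < A * (nrm f)\<^sup>2" using A nrm_pos[OF f that] by simp
    then show ?thesis using frame_lower[OF f] by (simp add: Re_sip_self[OF f])
  qed
  assume g: "g \<in> H"
  show "sip (\<lambda>x. c * f x) g = c * sip f g"
    unfolding sip_def mult.assoc by (rule infsum_cmult_right[OF product_summable[OF f g]])
  show "sip g f = cnj (sip f g)"
    unfolding sip_def infsum_cnj[symmetric] by (simp add: mult.commute)
  assume h: "h \<in> H"
  show "sip (\<lambda>x. f x + g x) h = sip f h + sip g h"
    unfolding sip_def distrib_right
    by (rule infsum_add[OF product_summable[OF f h] product_summable[OF g h]])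
qed (auto intro: zero_mem add_mem scale_mem)

lemma snrm_sq: "f \<in> H \<Longrightarrow> (ip_norm sip f)\<^sup>2 = (\<Sum>\<^sub>\<infinity>l\<in>\<Lambda>. (cmod (f l))\<^sup>2)"
  by (simp add: ip_norm_def Re_sip_self infsum_nonneg)

lemma snrm_nonneg: "f \<in> H \<Longrightarrow> 0 \<le> ip_norm sip f"
  by (simp add: ip_norm_def Re_sip_self infsum_nonneg)

lemma snrm_lower:
  assumes "f \<in> H" shows "sqrt A * nrm f \<le> ip_norm sip f"
proof (rule power2_le_imp_le)
  show "(sqrt A * nrm f)\<^sup>2 \<le> (ip_norm sip f)\<^sup>2"
    using frame_lower[OF assms] A by (simp add: snrm_sq[OF assms] power_mult_distrib)
  show "0 \<le> ip_norm sip f" by (rule snrm_nonneg[OF assms])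
qed

lemma snrm_upper:
  assumes "f \<in> H" shows "ip_norm sip f \<le> sqrt B * nrm f"
proof (rule power2_le_imp_le)
  show "(ip_norm sip f)\<^sup>2 \<le> (sqrt B * nrm f)\<^sup>2"
    using frame_upper[OF assms] B by (simp add: snrm_sq[OF assms] power_mult_distrib)
  show "0 \<le> sqrt B * nrm f" using nrm_nonneg[OF assms] B by simp
qed

lemma sip_hilbert: "hilbert_functions H sip"
proof (unfold_locales)
  show "function_inner_product_space H sip" by (rule sip_inner_product_space)
  fix u :: "nat \<Rightarrow> 'a \<Rightarrow> complex"
  assume u: "\<And>n. u n \<in> H" and C: "\<forall>\<epsilon>>0. \<exists>N. \<forall>i\<ge>N. \<forall>j\<ge>N. ip_dist sip (u i) (u j) < \<epsilon>"
  have "\<exists>f\<in>H. (\<lambda>n. ip_dist ip (u n) f) \<longlonglongrightarrow> 0"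
  proof (rule complete[OF u], intro allI impI)
    fix \<epsilon> :: real assume e: "0 < \<epsilon>"
    then have "0 < sqrt A * \<epsilon>" using A by simp
    then obtain N where N: "\<And>i j. N \<le> i \<Longrightarrow> N \<le> j \<Longrightarrow> ip_dist sip (u i) (u j) < sqrt A * \<epsilon>"
      using C by blast
    have "ip_dist ip (u i) (u j) < \<epsilon>" if "N \<le> i" "N \<le> j" for i j
    proof -
      have "sqrt A * ip_dist ip (u i) (u j) < sqrt A * \<epsilon>"
        using N[OF that] snrm_lower[OF diff_mem[OF u u], of i j] by (simp add: ip_dist_def)
      then show ?thesis using A by simp
    qed
    then show "\<exists>N. \<forall>i\<ge>N. \<forall>j\<ge>N. ip_dist ip (u i) (u j) < \<epsilon>" by blast
  qed
  then obtain f where f: "f \<in> H" and lim: "(\<lambda>n. ip_dist ip (u n) f) \<longlonglongrightarrow> 0" by blast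
  have "(\<lambda>n. ip_dist sip (u n) f) \<longlonglongrightarrow> 0"
  proof (rule Lim_null_comparison)
    show "(\<lambda>n. sqrt B * ip_dist ip (u n) f) \<longlonglongrightarrow> 0"
      using tendsto_mult_left[OF lim, of "sqrt B"] by simp
    have "norm (ip_dist sip (u n) f) \<le> sqrt B * ip_dist ip (u n) f" for n
      using snrm_upper[OF diff_mem[OF u f], of n] snrm_nonneg[OF diff_mem[OF u f], of n]
      by (simp add: ip_dist_def)
    then show "\<forall>\<^sub>F n in sequentially. norm (ip_dist sip (u n) f) \<le> sqrt B * ip_dist ip (u n) f"
      by simp
  qed
  then show "\<exists>f\<in>H. (\<lambda>n. ip_dist sip (u n) f) \<longlonglongrightarrow> 0" using f by blast
qed

lemma sip_Riesz:
  assumes "\<And>f g. f \<in> H \<Longrightarrow> g \<in> H \<Longrightarrow> \<phi> (\<lambda>x. f x + g x) = \<phi> f + \<phi> g"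
    and "\<And>c f. f \<in> H \<Longrightarrow> \<phi> (\<lambda>x. c * f x) = c * \<phi> f"
    and bounded: "\<And>f. f \<in> H \<Longrightarrow> cmod (\<phi> f) \<le> C * nrm f" and C: "0 \<le> C"
  shows "\<exists>u\<in>H. \<forall>f\<in>H. \<phi> f = sip f u"
proof (rule hilbert_functions.Riesz_representation[OF sip_hilbert, where C = "C / sqrt A"])
  fix f assume f: "f \<in> H"
  have "nrm f \<le> ip_norm sip f / sqrt A" using snrm_lower[OF f] A by (simp add: field_simps)
  then have "C * nrm f \<le> C * (ip_norm sip f / sqrt A)" using C by (rule mult_left_mono)
  then show "cmod (\<phi> f) \<le> C / sqrt A * ip_norm sip f" using bounded[OF f] by simp
qed (use assms in auto)

lemma sampled_kernel_exists: "\<exists>u\<in>H. \<forall>f\<in>H. f x = sip f u"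
proof (rule sip_Riesz[where C = "nrm k"])
  fix f assume f: "f \<in> H"
  show "cmod (f x) \<le> nrm k * nrm f"
    using Cauchy_Schwarz[OF f kern_mem, of x] by (simp add: reproducing f nrm_kern mult.commute)
qed (simp_all add: nrm_nonneg k_mem)

definition skern :: "'a \<Rightarrow> 'a \<Rightarrow> complex" where
  "skern x = (SOME u. u \<in> H \<and> (\<forall>f\<in>H. f x = sip f u))"

lemma skern_mem: "skern x \<in> H" and skern_reproducing: "f \<in> H \<Longrightarrow> sip f (skern x) = f x"
  using someI_ex[of "\<lambda>u. u \<in> H \<and> (\<forall>f\<in>H. f x = sip f u)"] sampled_kernel_exists[of x]
  unfolding skern_def by (blast, metis (mono_tags, lifting))

text \<open>
  Represent \<open>f \<mapsto> \<langle>f, h\<rangle>\<close> as \<open>sip f u\<close>. Orthogonality of \<open>h\<close> to \<open>skern l\<close> says that \<open>u\<close> vanishes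
  at \<open>l\<close>. Hence \<open>h x\<close>, which is the conjugate of \<open>sip (kern x) u\<close>, only involves samples of
  \<open>kern x\<close> outside \<open>S\<close>. The factor \<open>B / A\<^sup>2\<close> comes from the upper inequality for the samples of
  \<open>u\<close> and from \<open>A \<parallel>u\<parallel> \<le> \<parallel>h\<parallel>\<close>.
\<close>

lemma orthogonal_to_skern_small:
  assumes h: "h \<in> H" and perp: "\<And>l. l \<in> S \<Longrightarrow> ip h (skern l) = 0"
    and tail: "\<And>G. finite G \<Longrightarrow> G \<subseteq> \<Lambda> - S \<Longrightarrow> (\<Sum>l\<in>G. (cmod (kern x l))\<^sup>2) \<le> \<epsilon>"
  shows "(cmod (h x))\<^sup>2 \<le> \<epsilon> * (B / A\<^sup>2) * (nrm h)\<^sup>2"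
proof -
  have e: "0 \<le> \<epsilon>" using tail[of "{}"] by simp
  have "\<exists>u\<in>H. \<forall>f\<in>H. ip f h = sip f u"
    by (rule sip_Riesz[where C = "nrm h"])
      (use Cauchy_Schwarz[OF _ h] in \<open>auto simp: ip_add_left ip_scale_left h nrm_nonneg mult.commute\<close>)
  then obtain u where u: "u \<in> H" and hu: "\<And>f. f \<in> H \<Longrightarrow> ip f h = sip f u" by blast
  have uS: "u l = 0" if "l \<in> S" for l
  proof -
    have "sip (skern l) u = cnj (ip h (skern l))"
      using hu[OF skern_mem] ip_commute[OF h skern_mem] by simp
    then have "sip (skern l) u = 0" by (simp add: perp[OF that])
    moreover have "sip u (skern l) = cnj (sip (skern l) u)"
      unfolding sip_def infsum_cnj[symmetric] by (simp add: mult.commute)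
    ultimately show ?thesis by (simp add: skern_reproducing[OF u])
  qed
  have energy: "A * (nrm u)\<^sup>2 \<le> nrm u * nrm h"
  proof -
    have "A * (nrm u)\<^sup>2 \<le> Re (ip u h)"
      using frame_lower[OF u] by (simp add: hu[OF u] Re_sip_self[OF u])
    also have "\<dots> \<le> cmod (ip u h)" by (rule complex_Re_le_cmod)
    also have "\<dots> \<le> nrm u * nrm h" by (rule Cauchy_Schwarz[OF u h])
    finally show ?thesis .
  qed
  have nu: "nrm u \<le> nrm h / A"
  proof (cases "nrm u = 0")
    case True
    then show ?thesis using nrm_nonneg[OF h] A by simp
  next
    case False
    then have "0 < nrm u" using nrm_nonneg[OF u] by simp
    moreover have "nrm u * (A * nrm u) \<le> nrm u * nrm h"
      using energy by (simp add: power2_eq_square ac_simps)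
    ultimately have "A * nrm u \<le> nrm h" by simp
    then show ?thesis using A by (simp add: field_simps)
  qed
  have ind: "(\<Sum>l\<in>G. cmod (kern x l * cnj (u l))) \<le> sqrt \<epsilon> * (sqrt B * nrm u)"
    if G: "finite G" "G \<subseteq> \<Lambda>" for G
  proof -
    have "(\<Sum>l\<in>G. cmod (kern x l * cnj (u l))) = (\<Sum>l\<in>G - S. cmod (kern x l * cnj (u l)))"
      using G uS by (intro sum.mono_neutral_right) auto
    also have "\<dots> = (\<Sum>l\<in>G - S. \<bar>cmod (kern x l)\<bar> * \<bar>cmod (u l)\<bar>)" by (simp add: norm_mult)
    also have "\<dots> \<le> L2_set (\<lambda>l. cmod (kern x l)) (G - S) * L2_set (\<lambda>l. cmod (u l)) (G - S)"
      by (rule L2_set_mult_ineq)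
    also have "\<dots> \<le> sqrt \<epsilon> * (sqrt B * nrm u)"
    proof (rule mult_mono)
      show "L2_set (\<lambda>l. cmod (kern x l)) (G - S) \<le> sqrt \<epsilon>"
        unfolding L2_set_def using G by (intro real_sqrt_le_mono tail) auto
      have "(\<Sum>l\<in>G - S. (cmod (u l))\<^sup>2) \<le> (sqrt B * nrm u)\<^sup>2"
        using finite_square_sum_le[OF u, of "G - S"] G B
        by (auto simp: power_mult_distrib)
      then show "L2_set (\<lambda>l. cmod (u l)) (G - S) \<le> sqrt B * nrm u"
        unfolding L2_set_def using nrm_nonneg[OF u] B by (intro real_le_lsqrt) (auto simp: sum_nonneg)
    qed (auto simp: e)
    finally show ?thesis .
  qed
  have abs: "(\<lambda>l. norm (kern x l * cnj (u l))) summable_on \<Lambda>"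
    using ind by (intro nonneg_bdd_above_summable_on bdd_aboveI2[where M = "sqrt \<epsilon> * (sqrt B * nrm u)"]) auto
  have "h x = cnj (sip (kern x) u)"
    using hu[OF kern_mem, of x] ip_kern_left[OF h, of x] by (metis complex_cnj_cnj)
  then have "cmod (h x) = cmod (sip (kern x) u)" by simp
  also have "\<dots> \<le> (\<Sum>\<^sub>\<infinity>l\<in>\<Lambda>. cmod (kern x l * cnj (u l)))"
    unfolding sip_def by (rule norm_infsum_bound[OF abs])
  also have "\<dots> \<le> sqrt \<epsilon> * (sqrt B * nrm u)"
    using ind by (intro infsum_le_finite_sums[OF abs]) auto
  also have "\<dots> \<le> sqrt \<epsilon> * (sqrt B * (nrm h / A))"
    using nu e B by (intro mult_left_mono) auto
  finally have "(cmod (h x))\<^sup>2 \<le> (sqrt \<epsilon> * (sqrt B * (nrm h / A)))\<^sup>2"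
    by (rule power_mono) simp
  then show ?thesis using e B by (simp add: power_mult_distrib power_divide)
qed

text \<open>
  The span of the vectors \<open>skern l\<close> with \<open>l \<in> S\<close> has dimension at most the cardinality of \<open>S\<close>.
  For \<open>x\<close> in \<open>Y\<close> it nearly contains \<open>kern x\<close>, because the component \<open>h\<close> of \<open>kern x\<close> orthogonal
  to it satisfies \<open>h x = \<parallel>h\<parallel>\<^sup>2\<close> and is small at \<open>x\<close>. The local trace is therefore nearly \<open>\<parallel>k\<parallel>\<^sup>2\<close>
  on \<open>Y\<close>, while its integral over the whole group is the dimension.
\<close>

lemma sampling_card_ge:
  assumes S: "finite S" and Y: "Y \<in> sets borel"
    and tail: "\<And>x G. x \<in> Y \<Longrightarrow> finite G \<Longrightarrow> G \<subseteq> \<Lambda> - S \<Longrightarrow> (\<Sum>l\<in>G. (cmod (kern x l))\<^sup>2) \<le> \<epsilon>"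
  shows "ennreal ((nrm k)\<^sup>2 - \<epsilon> * (B / A\<^sup>2)) * emeasure m Y \<le> of_nat (card S)"
proof -
  obtain E where E: "orthonormal E" and card: "card E \<le> card S"
    and perp: "\<forall>h\<in>H. (\<forall>e\<in>E. ip h e = 0) \<longleftrightarrow> (\<forall>t\<in>S. ip h (skern t) = 0)"
    using Gram_Schmidt[of S skern, OF S skern_mem] by blast
  define \<rho> where "\<rho> y = (\<Sum>e\<in>E. (cmod (e y))\<^sup>2)" for y
  have \<rho>_ge: "(nrm k)\<^sup>2 - \<epsilon> * (B / A\<^sup>2) \<le> \<rho> x" if x: "x \<in> Y" for x
  proof -
    define h where "h = (\<lambda>y. kern x y - proj E (kern x) y)"
    have h: "h \<in> H" unfolding h_def by (intro diff_mem kern_mem proj_mem E)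
    have hE: "\<forall>e\<in>E. ip h e = 0"
      unfolding h_def using residual_orthogonal[OF E kern_mem] by blast
    have nh: "(nrm h)\<^sup>2 = (nrm k)\<^sup>2 - \<rho> x"
      unfolding h_def nrm_residual_sq[OF E kern_mem] \<rho>_def orthonormal_sum_eq[OF E] nrm_kern ..
    have "ip h (proj E (kern x)) = 0" using hE by (simp add: ip_proj_right[OF E h])
    moreover have "ip h h = ip h (kern x) - ip h (proj E (kern x))"
      using ip_diff_right[OF kern_mem proj_mem[OF E] h, of x "kern x"] by (simp flip: h_def)
    ultimately have "h x = of_real ((nrm h)\<^sup>2)" using reproducing[OF h] ip_self[OF h] by simp
    then have "(cmod (h x))\<^sup>2 = (nrm h)\<^sup>2 * (nrm h)\<^sup>2" by (simp add: power2_eq_square norm_mult)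
    then have sq: "(nrm h)\<^sup>2 * (nrm h)\<^sup>2 \<le> (nrm h)\<^sup>2 * (\<epsilon> * (B / A\<^sup>2))"
      using orthogonal_to_skern_small[OF h, of S x \<epsilon>] perp h hE tail[OF x] by (simp only: mult.commute) 
    have "(nrm h)\<^sup>2 \<le> \<epsilon> * (B / A\<^sup>2)"
    proof (cases "nrm h = 0")
      case True
      then show ?thesis using tail[OF x, of "{}"] B by simp
    next
      case False
      then have "0 < (nrm h)\<^sup>2" by simp
      with sq show ?thesis by (simp only: mult_le_cancel_left_pos)
    qed
    then show ?thesis using nh by linarith
  qed
  have "ennreal ((nrm k)\<^sup>2 - \<epsilon> * (B / A\<^sup>2)) * emeasure m Y
      = (\<integral>\<^sup>+x. ennreal ((nrm k)\<^sup>2 - \<epsilon> * (B / A\<^sup>2)) * indicator Y x \<partial>m)"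
    using Y by (subst nn_integral_cmult) auto
  also have "\<dots> \<le> (\<integral>\<^sup>+x. ennreal (\<rho> x) \<partial>m)"
    using \<rho>_ge by (intro nn_integral_mono) (auto simp: indicator_def intro!: ennreal_leI)
  also have "\<dots> = of_nat (card E)" using nn_integral_orthonormal[OF E] by (simp add: \<rho>_def)
  also have "\<dots> \<le> of_nat (card S)" using card by simp
  finally show ?thesis .
qed

text \<open>
  The homogeneous approximation property: the samples of \<open>kern x\<close> outside \<open>x K\<close> are uniformly
  small in \<open>x\<close>. The upper sampling inequality for the kernels, which are bounded below near their
  centres, shows that \<open>\<Lambda>\<close> has a bounded number of points in each translate of a small
  neighbourhood \<open>W\<close>. Each sample is at most the average of the local maximal function \<open>\<phi>\<close> over a
  translate of \<open>W\<inverse>\<close>, and \<open>\<phi>\<close> is integrable, so its integral outside a compact set is small.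
\<close>

lemma kernel_tail:
  assumes k: "0 < nrm k" and Q: "compact Q" "0 \<in> interior Q"
    and amalgam: "(\<integral>\<^sup>+x. (SUP t\<in>(+) x ` Q. ennreal ((cmod (k t))\<^sup>2)) \<partial>m) < \<infinity>" and e: "0 < \<epsilon>"
  shows "\<exists>K. compact K \<and> 0 \<in> K \<and> (\<forall>x G. finite G \<longrightarrow> G \<subseteq> \<Lambda> \<longrightarrow> G \<inter> (+) x ` K = {} \<longrightarrow>
    (\<Sum>l\<in>G. (cmod (kern x l))\<^sup>2) \<le> \<epsilon>)"
proof -
  define \<kappa> where "\<kappa> = (nrm k)\<^sup>2"
  have \<kappa>: "0 < \<kappa>" using k by (simp add: \<kappa>_def)
  have k0: "cmod (k 0) = \<kappa>" using kern_self[of 0] \<kappa> by (simp add: kern_def \<kappa>_def norm_power)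
  define W where "W = interior Q \<inter> {y. \<kappa> / 2 < cmod (k y)}"
  have W: "open W" unfolding W_def
    by (intro open_Int open_interior open_Collect_less continuous_intros continuous_on_norm k_continuous)
  have W0: "0 \<in> W" using Q(2) k0 \<kappa> by (simp add: W_def)
  have WQ: "W \<subseteq> Q" using interior_subset by (auto simp: W_def)
  have Wb[measurable]: "W \<in> sets borel" using W by simp
  have "emeasure m W \<le> emeasure m Q" by (intro emeasure_mono WQ) (simp add: borel_compact Q)
  then have "emeasure m W < \<infinity>" using emeasure_compact_finite[OF Q(1)] by (rule le_less_trans)
  then obtain w where w: "emeasure m W = ennreal w" "0 \<le> w" by (cases "emeasure m W") auto
  have w0: "0 < w" using open_pos[OF W] W0 w by auto
  \<comment> \<open>The summand \<open>1\<close> keeps \<open>R\<close> positive; it is a divisor below.\<close>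
  define R where "R = B * \<kappa> / (\<kappa> / 2)\<^sup>2 + 1"
  have R: "0 < R" using B \<kappa> by (simp add: R_def add_nonneg_pos)
  have separated: "real (card {l\<in>G. - z + l \<in> W}) \<le> R" if G: "finite G" "G \<subseteq> \<Lambda>" for z G
  proof -
    let ?G = "{l\<in>G. - z + l \<in> W}"
    have "real (card ?G) * (\<kappa> / 2)\<^sup>2 = (\<Sum>l\<in>?G. (\<kappa> / 2)\<^sup>2)" by simp
    also have "\<dots> \<le> (\<Sum>l\<in>?G. (cmod (kern z l))\<^sup>2)"
      using \<kappa> by (intro sum_mono power_mono) (auto simp: W_def kern_def)
    also have "\<dots> \<le> B * \<kappa>"
      using finite_square_sum_le[OF kern_mem, of ?G z] G by (auto simp: nrm_kern \<kappa>_def)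
    finally have "real (card ?G) \<le> B * \<kappa> / (\<kappa> / 2)\<^sup>2" using \<kappa> by (simp add: pos_le_divide_eq)
    then show ?thesis by (simp add: R_def)
  qed
  define \<phi> where "\<phi> x = (SUP t\<in>(+) x ` Q. ennreal ((cmod (k t))\<^sup>2))" for x
  \<comment> \<open>Continuity of \<open>k\<close> makes the supremum lower semicontinuous.\<close>
  have \<phi>[measurable]: "\<phi> \<in> borel_measurable borel"
  proof (rule borel_measurableI_greater)
    fix a :: ennreal
    have "{x \<in> space borel. a < \<phi> x} = (\<Union>q\<in>Q. (\<lambda>x. ennreal ((cmod (k (x + q)))\<^sup>2)) -` {a<..})"
      by (auto simp: \<phi>_def less_SUP_iff)
    moreover have "open ((\<lambda>x. ennreal ((cmod (k (x + q)))\<^sup>2)) -` {a<..})" for q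
    proof -
      have "continuous_on UNIV (\<lambda>x. k (x + q))"
        by (rule continuous_on_compose2[OF k_continuous]) (auto intro!: continuous_intros)
      then have "continuous_on UNIV (\<lambda>x. ennreal ((cmod (k (x + q)))\<^sup>2))"
        by (intro continuous_on_ennreal continuous_intros)
      then show ?thesis by (intro open_vimage) auto
    qed
    ultimately have "open {x \<in> space borel. a < \<phi> x}" by auto
    then show "{x \<in> space borel. a < \<phi> x} \<in> sets borel" by simp
  qed
  define \<eta> where "\<eta> = \<epsilon> * w / R"
  have \<eta>: "0 < \<eta>" using e w0 R by (simp add: \<eta>_def)
  obtain K1 where K1: "compact K1" "0 \<in> K1" "(\<integral>\<^sup>+y. \<phi> y * indicator (- K1) y \<partial>m) \<le> ennreal \<eta>"
    using compact_tail[OF \<phi>, of "ennreal \<eta>"] amalgam \<eta> by (auto simp: \<phi>_def[abs_def])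
  have K1b[measurable]: "K1 \<in> sets borel" by (rule borel_compact[OF K1(1)])
  define K where "K = K1 + Q"
  have K: "compact K" unfolding K_def by (rule compact_set_plus[OF K1(1) Q(1)])
  have K0: "0 \<in> K" unfolding K_def using set_plus_intro[OF K1(2), of 0 Q] interior_subset Q(2) by auto
  have "(\<Sum>l\<in>G. (cmod (kern x l))\<^sup>2) \<le> \<epsilon>"
    if G: "finite G" "G \<subseteq> \<Lambda>" and disj: "G \<inter> (+) x ` K = {}" for x G
  proof -
    let ?I = "\<lambda>l y. indicator W (- (x + y) + l) :: ennreal"
    have pt: "(\<Sum>l\<in>G. ennreal ((cmod (kern x l))\<^sup>2) * ?I l y) \<le> ennreal R * (\<phi> y * indicator (- K1) y)" for y
    proof -
      have le: "ennreal ((cmod (kern x l))\<^sup>2) * ?I l y \<le> \<phi> y * indicator (- K1) y * ?I l y" if l: "l \<in> G" for l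
      proof (cases "- (x + y) + l \<in> W")
        case True
        define q where "q = - (x + y) + l"
        have q: "q \<in> Q" using True WQ by (auto simp: q_def)
        have yq: "- x + l = y + q" by (simp add: q_def minus_add add.assoc del: add_uminus_conv_diff)
        have "y \<notin> K1"
        proof
          assume "y \<in> K1"
          then have "- x + l \<in> K" unfolding yq K_def using q by (rule set_plus_intro)
          then have "l \<in> (+) x ` K" by (simp add: mem_translate_iff)
          then show False using disj l by blast
        qed
        moreover have "ennreal ((cmod (kern x l))\<^sup>2) \<le> \<phi> y"
          unfolding \<phi>_def kern_def yq using q by (intro SUP_upper) auto
        ultimately show ?thesis by (simp add: mult_right_mono)
      qed simp
      have "(\<Sum>l\<in>G. ?I l y) = of_nat (card {l\<in>G. - (x + y) + l \<in> W})"
        using G by (simp add: indicator_def sum.If_cases Int_def)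
      also have "\<dots> \<le> ennreal R"
        using ennreal_leI[OF separated[OF G, of "x + y"]] by (simp add: ennreal_of_nat_eq_real_of_nat)
      finally have card: "(\<Sum>l\<in>G. ?I l y) \<le> ennreal R" .
      have "(\<Sum>l\<in>G. ennreal ((cmod (kern x l))\<^sup>2) * ?I l y) \<le> (\<Sum>l\<in>G. \<phi> y * indicator (- K1) y * ?I l y)"
        by (rule sum_mono[OF le])
      also have "\<dots> = \<phi> y * indicator (- K1) y * (\<Sum>l\<in>G. ?I l y)" by (simp add: sum_distrib_left)
      also have "\<dots> \<le> \<phi> y * indicator (- K1) y * ennreal R" by (intro mult_left_mono card) simp
      also have "\<dots> = ennreal R * (\<phi> y * indicator (- K1) y)" by (rule mult.commute)
      finally show ?thesis .
    qed
    have "ennreal ((\<Sum>l\<in>G. (cmod (kern x l))\<^sup>2) * w) = (\<Sum>l\<in>G. ennreal ((cmod (kern x l))\<^sup>2)) * emeasure m W"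
      using w by (simp add: ennreal_mult sum_nonneg)
    also have "\<dots> = (\<Sum>l\<in>G. ennreal ((cmod (kern x l))\<^sup>2) * (\<integral>\<^sup>+y. ?I l y \<partial>m))"
      by (simp only: nn_integral_covering(1)[OF Wb] sum_distrib_right)
    also have "\<dots> = (\<integral>\<^sup>+y. (\<Sum>l\<in>G. ennreal ((cmod (kern x l))\<^sup>2) * ?I l y) \<partial>m)"
      using nn_integral_covering(2)[OF Wb] by (simp add: nn_integral_sum nn_integral_cmult)
    also have "\<dots> \<le> (\<integral>\<^sup>+y. ennreal R * (\<phi> y * indicator (- K1) y) \<partial>m)"
      by (intro nn_integral_mono pt)
    also have "\<dots> = ennreal R * (\<integral>\<^sup>+y. \<phi> y * indicator (- K1) y \<partial>m)"
      by (rule nn_integral_cmult) simp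
    also have "\<dots> \<le> ennreal R * ennreal \<eta>" by (intro mult_left_mono K1) simp
    also have "\<dots> = ennreal (\<epsilon> * w)" using R \<eta> by (simp add: \<eta>_def flip: ennreal_mult)
    finally have "(\<Sum>l\<in>G. (cmod (kern x l))\<^sup>2) * w \<le> \<epsilon> * w" using e w0 by simp
    then show ?thesis using w0 by simp
  qed
  then show ?thesis using K K0 by blast
qed

end

section \<open>The density theorem\<close>

locale folner_rkhs = translation_rkhs m H ip k + folner_group m F
  for m :: "'a::{topological_group_add, t2_space, second_countable_topology} measure"
    and H ip k F
begin

text \<open>
  The count on \<open>x F n\<close> is compared with the measure of \<open>F n K\<close>, where \<open>K\<close> carries \<open>k\<close> up to a
  small \<open>L\<^sup>2\<close> error; along the Folner sequence this costs a factor tending to one.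
\<close>

lemma upper_density_le:
  assumes \<Lambda>: "interpolation_set H \<Lambda>"
  shows "upper_beurling_density m \<Lambda> \<le> ennreal ((nrm k)\<^sup>2)"
proof (rule ennreal_le_epsilon)
  fix e :: real assume e: "0 < e"
  define \<kappa> where "\<kappa> = (nrm k)\<^sup>2"
  have \<kappa>: "0 \<le> \<kappa>" by (simp add: \<kappa>_def)
  obtain C where C: "0 < C" and bound: "\<And>T a. finite T \<Longrightarrow> T \<subseteq> \<Lambda> \<Longrightarrow>
      (\<Sum>t\<in>T. (cmod (a t))\<^sup>2) \<le> C * (nrm (\<lambda>x. \<Sum>t\<in>T. a t * kern t x))\<^sup>2"
    using interpolation_lower_bound[OF \<Lambda>] by blast
  have separating: "\<exists>f\<in>H. f t \<noteq> 0 \<and> (\<forall>s\<in>T - {t}. f s = 0)" if "t \<in> T" "T \<subseteq> \<Lambda>" for t T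
  proof -
    have "(\<lambda>l. (cmod (if l = t then 1 else 0))\<^sup>2) summable_on \<Lambda>"
      by (rule finite_nonzero_values_imp_summable_on) (auto intro: finite_subset[of _ "{t}"])
    then obtain f where "f \<in> H" "\<forall>l\<in>\<Lambda>. f l = (if l = t then 1 else 0)"
      using \<Lambda> unfolding interpolation_set_def by (auto dest: spec[of _ "\<lambda>l. if l = t then 1 else 0"])
    then show ?thesis using that by (intro bexI[of _ f]) (auto simp: subset_iff)
  qed
  \<comment> \<open>Small enough that \<open>\<kappa> / (1 - \<theta>) \<le> \<kappa> + e\<close>, and below one also when \<open>\<kappa> = 0\<close>.\<close>
  define \<theta> where "\<theta> = e / (2 * (\<kappa> + e))"
  have \<theta>: "0 < \<theta>" "\<theta> < 1" "\<kappa> / (1 - \<theta>) \<le> \<kappa> + e"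
  proof -
    show "0 < \<theta>" "\<theta> < 1" using e \<kappa> by (simp_all add: \<theta>_def field_simps)
    have "\<kappa> \<le> (\<kappa> + e) * (1 - \<theta>)" using e \<kappa> by (simp add: \<theta>_def field_simps)
    then show "\<kappa> / (1 - \<theta>) \<le> \<kappa> + e" using \<open>\<theta> < 1\<close> by (simp add: pos_divide_le_eq)
  qed
  have [measurable]: "k \<in> borel_measurable borel" by (rule mem_borel[OF k_mem])
  obtain K where K: "compact K" "0 \<in> K"
    and tail: "(\<integral>\<^sup>+y. ennreal ((cmod (k y))\<^sup>2) * indicator (- K) y \<partial>m) \<le> ennreal (\<theta> / C)"
    using compact_tail[of "\<lambda>y. ennreal ((cmod (k y))\<^sup>2)" "ennreal (\<theta> / C)"]
      nn_integral_square[OF k_mem] \<theta>(1) C by auto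
  have count: "ncard (\<Lambda> \<inter> (+) x ` F n) \<le> ennreal (\<kappa> + e) * emeasure m (F n + K)" for x n
  proof (rule ncard_le)
    fix T assume T: "finite T" "T \<subseteq> \<Lambda> \<inter> (+) x ` F n"
    have "emeasure m (F n + K) < \<infinity>"
      by (intro emeasure_compact_finite compact_set_plus compact_F K)
    then obtain M where M: "emeasure m (F n + K) = ennreal M" "0 \<le> M"
      by (cases "emeasure m (F n + K)") auto
    have "of_nat (card T) \<le> ennreal \<kappa> * emeasure m (F n + K) + ennreal (C * (\<theta> / C)) * of_nat (card T)"
      unfolding \<kappa>_def using T C \<theta>
      by (intro interpolation_card_le bound separating compact_F K tail) auto
    then have "ennreal (card T) \<le> ennreal (\<kappa> * M + \<theta> * card T)"
      using C M \<kappa> \<theta> by (simp add: ennreal_of_nat_eq_real_of_nat ennreal_mult)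
    then have "card T \<le> \<kappa> * M + \<theta> * card T"
      by (subst (asm) ennreal_le_iff) (use \<kappa> M \<theta> in auto)
    then have "card T \<le> \<kappa> / (1 - \<theta>) * M" using \<theta> by (simp add: field_simps)
    also have "\<dots> \<le> (\<kappa> + e) * M" using \<theta> M by (intro mult_right_mono) auto
    finally have "ennreal (card T) \<le> ennreal ((\<kappa> + e) * M)" by (rule ennreal_leI)
    also have "\<dots> = ennreal (\<kappa> + e) * emeasure m (F n + K)"
      unfolding M(1) using \<kappa> e M(2) by (intro ennreal_mult) auto
    finally show "of_nat (card T) \<le> ennreal (\<kappa> + e) * emeasure m (F n + K)"
      by (simp only: ennreal_of_nat_eq_real_of_nat)
  qed
  have "upper_beurling_density m \<Lambda> \<le> ennreal (\<kappa> + e) * (1 + boundary_ratio K n)" for n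
  proof -
    have "relative_count m \<Lambda> (F n) x \<le> ennreal (\<kappa> + e) * (1 + boundary_ratio K n)" for x
    proof -
      have "ncard (\<Lambda> \<inter> (+) x ` F n) \<le> ennreal (\<kappa> + e) * ((1 + boundary_ratio K n) * emeasure m (F n))"
        by (rule order_trans[OF count]) (intro mult_left_mono emeasure_F_plus_le K; simp)
      then have "ncard (\<Lambda> \<inter> (+) x ` F n) / emeasure m (F n)
          \<le> ennreal (\<kappa> + e) * (1 + boundary_ratio K n) * emeasure m (F n) / emeasure m (F n)"
        by (intro divide_right_mono_ennreal) (simp add: mult.assoc)
      then show ?thesis
        using F_pos[of n] F_finite[of n] by (simp add: relative_count_def ennreal_mult_divide_eq)
    qed
    moreover have "upper_beurling_density m \<Lambda> \<le> (SUP x. relative_count m \<Lambda> (F n) x)"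
      unfolding upper_beurling_density_def by (rule INF_lower) (simp add: compact_F F_pos)
    ultimately show ?thesis by (meson SUP_least order_trans)
  qed
  moreover have "(\<lambda>n. ennreal (\<kappa> + e) * (1 + boundary_ratio K n)) \<longlonglongrightarrow> ennreal (\<kappa> + e) * (1 + 0)"
    by (intro ennreal_tendsto_cmult tendsto_add tendsto_const boundary_ratio_tendsto K) simp
  ultimately have "upper_beurling_density m \<Lambda> \<le> ennreal (\<kappa> + e) * (1 + 0)"
    by (intro LIMSEQ_le_const) auto
  then show "upper_beurling_density m \<Lambda> \<le> ennreal ((nrm k)\<^sup>2) + ennreal e"
    using \<kappa> e by (simp add: \<kappa>_def)
qed

lemma sampling_set_bounds:
  assumes "sampling_set H ip \<Lambda>"
  shows "\<exists>A B. sampling_rkhs m H ip k \<Lambda> A B"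
proof -
  obtain A B where AB: "0 < A" "A \<le> B"
    and lower: "\<And>f. f \<in> H \<Longrightarrow> ennreal (A * (nrm f)\<^sup>2) \<le> (\<Sum>\<^sub>\<infinity>l\<in>\<Lambda>. ennreal ((cmod (f l))\<^sup>2))"
    and upper: "\<And>f. f \<in> H \<Longrightarrow> (\<Sum>\<^sub>\<infinity>l\<in>\<Lambda>. ennreal ((cmod (f l))\<^sup>2)) \<le> ennreal (B * (nrm f)\<^sup>2)"
    using assms unfolding sampling_set_def by blast
  have sup: "(\<Sum>\<^sub>\<infinity>l\<in>\<Lambda>. ennreal ((cmod (f l))\<^sup>2))
      = (SUP G\<in>{G. finite G \<and> G \<subseteq> \<Lambda>}. ennreal (\<Sum>l\<in>G. (cmod (f l))\<^sup>2))" for f :: "'a \<Rightarrow> complex"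
    by (subst nonneg_infsum_complete) simp_all
  have summable: "(\<lambda>l. (cmod (f l))\<^sup>2) summable_on \<Lambda>" if f: "f \<in> H" for f
  proof (rule nonneg_bdd_above_summable_on)
    have "(\<Sum>l\<in>G. (cmod (f l))\<^sup>2) \<le> B * (nrm f)\<^sup>2" if "finite G" "G \<subseteq> \<Lambda>" for G
    proof -
      have "ennreal (\<Sum>l\<in>G. (cmod (f l))\<^sup>2) \<le> ennreal (B * (nrm f)\<^sup>2)"
        using upper[OF f] unfolding sup by (rule order_trans[rotated]) (use that in \<open>auto intro: SUP_upper\<close>)
      then show ?thesis using AB by simp
    qed
    then show "bdd_above (sum (\<lambda>l. (cmod (f l))\<^sup>2) ` {G. G \<subseteq> \<Lambda> \<and> finite G})"
      by (intro bdd_aboveI2[where M = "B * (nrm f)\<^sup>2"]) auto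
  qed simp
  have eq: "(\<Sum>\<^sub>\<infinity>l\<in>\<Lambda>. ennreal ((cmod (f l))\<^sup>2)) = ennreal (\<Sum>\<^sub>\<infinity>l\<in>\<Lambda>. (cmod (f l))\<^sup>2)" if "f \<in> H" for f
    unfolding sup by (rule infsum_nonneg_is_SUPREMUM_ennreal[OF summable[OF that], symmetric]) simp
  have "sampling_rkhs m H ip k \<Lambda> A B"
  proof unfold_locales
    fix f assume f: "f \<in> H"
    have nonneg: "0 \<le> (\<Sum>\<^sub>\<infinity>l\<in>\<Lambda>. (cmod (f l))\<^sup>2)" by (rule infsum_nonneg) simp
    show "(\<lambda>l. (cmod (f l))\<^sup>2) summable_on \<Lambda>" by (rule summable[OF f])
    show "A * (nrm f)\<^sup>2 \<le> (\<Sum>\<^sub>\<infinity>l\<in>\<Lambda>. (cmod (f l))\<^sup>2)"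
      using lower[OF f] nonneg unfolding eq[OF f] by simp
    show "(\<Sum>\<^sub>\<infinity>l\<in>\<Lambda>. (cmod (f l))\<^sup>2) \<le> B * (nrm f)\<^sup>2"
      using upper[OF f] AB unfolding eq[OF f] by simp
  qed (use AB in auto)
  then show ?thesis by blast
qed

text \<open>
  The points of \<open>\<Lambda>\<close> in \<open>x F n K\<close> already determine the kernels at points of \<open>x F n\<close> up to a small
  error. Using the compact set \<open>F n K\<close> in the supremum that defines the density costs only the
  factor \<open>m (F n K) / m (F n)\<close>, which is asymptotically at most one.
\<close>

lemma lower_density_ge:
  assumes \<Lambda>: "sampling_set H ip \<Lambda>" and Q: "compact Q" "0 \<in> interior Q"
    and amalgam: "(\<integral>\<^sup>+x. (SUP t\<in>(+) x ` Q. ennreal ((cmod (k t))\<^sup>2)) \<partial>m) < \<infinity>"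
  shows "ennreal ((nrm k)\<^sup>2) \<le> lower_beurling_density m \<Lambda>"
proof (cases "nrm k = 0")
  case True
  then show ?thesis by simp
next
  case False
  then have k0: "0 < nrm k" using nrm_nonneg[OF k_mem] by simp
  obtain A B where "sampling_rkhs m H ip k \<Lambda> A B" using sampling_set_bounds[OF \<Lambda>] by blast
  then interpret S: sampling_rkhs m H ip k \<Lambda> A B .
  show ?thesis
  proof (rule ennreal_le_epsilon)
    fix e :: real assume e: "0 < e"
    \<comment> \<open>The choice of \<open>\<epsilon>\<close> makes the loss \<open>\<epsilon> B / A\<^sup>2\<close> in the local trace at most \<open>e\<close>.\<close>
    define b where "b = B / A\<^sup>2"
    define \<epsilon> where "\<epsilon> = e / (b + 1)"
    have "0 \<le> b" using S.B by (simp add: b_def)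
    then have \<epsilon>: "0 < \<epsilon>" "\<epsilon> * (B / A\<^sup>2) \<le> e"
      using e by (simp_all add: \<epsilon>_def field_simps flip: b_def)
    obtain K where K: "compact K" "0 \<in> K"
      and tail: "\<And>x G. finite G \<Longrightarrow> G \<subseteq> \<Lambda> \<Longrightarrow> G \<inter> (+) x ` K = {} \<Longrightarrow> (\<Sum>l\<in>G. (cmod (kern x l))\<^sup>2) \<le> \<epsilon>"
      using S.kernel_tail[OF k0 Q amalgam \<epsilon>(1)] by blast
    have count: "ennreal ((nrm k)\<^sup>2 - e) * emeasure m (F n) \<le> ncard (\<Lambda> \<inter> (+) x ` (F n + K))" for n x
    proof (cases "finite (\<Lambda> \<inter> (+) x ` (F n + K))")
      case True
      define Y where "Y = (+) x ` F n"
      have "Y = (\<lambda>y. x + y) ` F n" by (simp add: Y_def)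
      then have Y: "Y \<in> sets borel"
        using compact_F by (auto intro!: borel_compact compact_continuous_image continuous_intros)
      have disj: "G \<inter> (+) y ` K = {}" if "y \<in> Y" "G \<subseteq> \<Lambda> - \<Lambda> \<inter> (+) x ` (F n + K)" for y G
        using that unfolding Y_def by (force simp: add.assoc intro: set_plus_intro)
      have "ennreal ((nrm k)\<^sup>2 - \<epsilon> * (B / A\<^sup>2)) * emeasure m Y \<le> of_nat (card (\<Lambda> \<inter> (+) x ` (F n + K)))"
      proof (rule S.sampling_card_ge[OF True Y])
        fix y G assume "y \<in> Y" "finite G" "G \<subseteq> \<Lambda> - \<Lambda> \<inter> (+) x ` (F n + K)"
        then show "(\<Sum>l\<in>G. (cmod (kern y l))\<^sup>2) \<le> \<epsilon>" by (intro tail disj) auto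
      qed
      moreover have "emeasure m Y = emeasure m (F n)"
        unfolding Y_def by (rule emeasure_translate[OF borel_F])
      moreover have "ennreal ((nrm k)\<^sup>2 - e) \<le> ennreal ((nrm k)\<^sup>2 - \<epsilon> * (B / A\<^sup>2))"
        using \<epsilon>(2) by (intro ennreal_leI) simp
      ultimately show ?thesis
        using True by (simp add: emeasure_count_space) (meson mult_right_mono order_trans zero_le)
    next
      case False
      then show ?thesis by (simp add: emeasure_count_space)
    qed
    have le: "ennreal ((nrm k)\<^sup>2 - e) \<le> lower_beurling_density m \<Lambda> * (1 + boundary_ratio K n)" for n
    proof -
      have FK: "compact (F n + K)" by (intro compact_set_plus compact_F K)
      have "F n \<subseteq> F n + K" using set_plus_intro[of _ "F n" 0 K] K(2) by auto
      then have "emeasure m (F n) \<le> emeasure m (F n + K)"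
        by (rule emeasure_mono) (simp add: borel_compact FK)
      then have pos: "0 < emeasure m (F n + K)" using F_pos[of n] by (rule less_le_trans[rotated])
      have fin: "emeasure m (F n + K) < \<infinity>" by (rule emeasure_compact_finite[OF FK])
      have cancel: "a / emeasure m (F n + K) * emeasure m (F n + K) = a" for a
        using pos fin by (simp add: ennreal_divide_times)
      have "ennreal ((nrm k)\<^sup>2 - e) * emeasure m (F n) / emeasure m (F n + K)
          \<le> (INF x. relative_count m \<Lambda> (F n + K) x)"
        unfolding relative_count_def by (intro INF_greatest divide_right_mono_ennreal count)
      also have "\<dots> \<le> lower_beurling_density m \<Lambda>"
        unfolding lower_beurling_density_def by (rule SUP_upper) (simp add: FK pos)
      finally have "ennreal ((nrm k)\<^sup>2 - e) * emeasure m (F n) / emeasure m (F n + K) * emeasure m (F n + K)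
          \<le> lower_beurling_density m \<Lambda> * emeasure m (F n + K)"
        by (rule mult_right_mono) simp
      also have "\<dots> \<le> lower_beurling_density m \<Lambda> * ((1 + boundary_ratio K n) * emeasure m (F n))"
        by (intro mult_left_mono emeasure_F_plus_le K) simp
      finally have "emeasure m (F n) * ennreal ((nrm k)\<^sup>2 - e)
          \<le> emeasure m (F n) * (lower_beurling_density m \<Lambda> * (1 + boundary_ratio K n))"
        unfolding cancel by (simp only: ac_simps)
      then show ?thesis using F_pos[of n] F_finite[of n] by (simp add: ennreal_mult_le_mult_iff)
    qed
    have "ennreal ((nrm k)\<^sup>2 - e) \<le> lower_beurling_density m \<Lambda>"
    proof (cases "lower_beurling_density m \<Lambda> = top")
      case False
      have "(\<lambda>n. lower_beurling_density m \<Lambda> * (1 + boundary_ratio K n)) \<longlonglongrightarrow> lower_beurling_density m \<Lambda> * (1 + 0)"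
        using False by (intro ennreal_tendsto_cmult tendsto_add tendsto_const boundary_ratio_tendsto K)
          (simp add: less_top)
      then have "ennreal ((nrm k)\<^sup>2 - e) \<le> lower_beurling_density m \<Lambda> * (1 + 0)"
        by (rule LIMSEQ_le_const) (use le in blast)
      then show ?thesis by simp
    qed simp
    then have "ennreal ((nrm k)\<^sup>2 - e) + ennreal e \<le> lower_beurling_density m \<Lambda> + ennreal e"
      by (rule add_right_mono)
    moreover have "ennreal ((nrm k)\<^sup>2) \<le> ennreal ((nrm k)\<^sup>2 - e) + ennreal e"
      using e by (cases "e \<le> (nrm k)\<^sup>2") (auto simp: ennreal_neg intro: ennreal_leI simp flip: ennreal_plus)
    ultimately show "ennreal ((nrm k)\<^sup>2) \<le> lower_beurling_density m \<Lambda> + ennreal e" by (rule order_trans[rotated])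
  qed
qed

end

theorem corollary3p15:
  fixes m :: "'a::{topological_group_add, t2_space, second_countable_topology} measure"
    and F :: "nat \<Rightarrow> 'a set"
    and \<Lambda> :: "'a set"
    and H :: "('a \<Rightarrow> complex) set"
    and ip :: "('a \<Rightarrow> complex) \<Rightarrow> ('a \<Rightarrow> complex) \<Rightarrow> complex"
    and k\<^sub>e :: "'a \<Rightarrow> complex"
  assumes "locally_compact_space (euclidean :: 'a topology)"
    and "haar_measure m"
    and "unimodular m"
    and "amenable m"
    and "strong_folner m F"
    and "rkhs H ip"
    and "isometric_in_L2 m H ip"
    and "\<forall>f\<in>H. \<forall>x. (\<lambda>y. f (- x + y)) \<in> H"
    and "\<exists>Q. compact Q \<and> 0 \<in> interior Q \<and>
           (\<forall>f\<in>H. (\<integral>\<^sup>+x. (SUP t\<in>(+) x ` Q. ennreal ((cmod (f t))\<^sup>2)) \<partial>m) < \<infinity>)"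
    and "k\<^sub>e \<in> H"
    and "\<forall>f\<in>H. f 0 = ip f k\<^sub>e"
  shows "(sampling_set H ip \<Lambda> \<longrightarrow>
            ennreal ((ip_norm ip k\<^sub>e)\<^sup>2) \<le> folner_lower_density m F \<Lambda> \<and>
            ennreal ((ip_norm ip k\<^sub>e)\<^sup>2) \<le> lower_beurling_density m \<Lambda>) \<and>
         (interpolation_set H \<Lambda> \<longrightarrow>
            folner_upper_density m F \<Lambda> \<le> ennreal ((ip_norm ip k\<^sub>e)\<^sup>2) \<and>
            upper_beurling_density m \<Lambda> \<le> ennreal ((ip_norm ip k\<^sub>e)\<^sup>2))"
proof -
  interpret folner_rkhs m H ip k\<^sub>e F
  proof unfold_locales
    show "function_inner_product_space H ip" using assms(6) by (simp add: rkhs_def)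
    show "\<exists>f\<in>H. (\<lambda>n. ip_dist ip (u n) f) \<longlonglongrightarrow> 0"
      if "\<And>n. u n \<in> H" "\<forall>\<epsilon>>0. \<exists>N. \<forall>i\<ge>N. \<forall>j\<ge>N. ip_dist ip (u i) (u j) < \<epsilon>" for u :: "nat \<Rightarrow> 'a \<Rightarrow> complex"
      using assms(6) that unfolding rkhs_def by blast
  qed (use assms in auto)
  obtain Q where Q: "compact Q" "0 \<in> interior Q"
    and amalgam: "(\<integral>\<^sup>+x. (SUP t\<in>(+) x ` Q. ennreal ((cmod (k\<^sub>e t))\<^sup>2)) \<partial>m) < \<infinity>"
    using assms(9,10) by blast
  show ?thesis
    using lower_density_ge[OF _ Q amalgam] upper_density_le
    by (simp add: folner_lower_density_eq folner_upper_density_eq)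
qed

end
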